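(* Let $Q$ be the infinitesimal generator of an ergodic regular-jump Markov chain $\{(X(t),J(t));t\ge 0\}$ on $\mathbb F$ with stationary distribution $\pi$, and assume that for each $n\in\mathbb N$ the LC-block-augmented truncation ${}_{(n)}Q$ has a unique closed communicating class in $\mathbb F_n$; let ${}_{(n)}\pi$ be its stationary distribution. Suppose there exist $b>0$, $c>0$, $K\in\mathbb Z_+$ and a column vector $v\ge e/c$ on $\mathbb F$ such that $$Qv\le -c\,v+b\,1_{\mathbb F_K}.$$ Let $\beta>0$ and fix any $N\in\{K,K+1,\dots\}$ such that $O<[\Phi^{(\beta)}_{\mathbb F_N}]_{\mathbb F_K}\le[\Phi^{(\beta)}]_{\mathbb F_K}$. Then for all $n\in\mathbb N$, $$|\pi-{}_{(n)}\pi|\,g\le\frac{\pi g+1}{2}\,\widetilde E_N(n)\quad\text{for all }0\le g\le cv,$$ $$\sup_{e\le g\le cv}\frac{|\pi-{}_{(n)}\pi|\,g}{\pi g}\le\widetilde E_N(n),$$ where $$\widetilde E_N(n)=2\sum_{k=0}^n{}_{(n)}\pi(k)\sum_{m=n+1}^\infty Q(k;m)\left\{v(m)+v(n)+2b\left(\frac1c+\frac{2}{\beta\,\overline\phi^{(\beta)}_{K,N}}\right)e\right\}.$$ Furthermore, if the subvector $(v(k,i))_{(k,i)\in\overline{\mathbb F}_0}$ is level-wise nondecreasing, then $\widetilde E_N(n)\le\widetilde E_N^+(n)$ for all $n\in\mathbb N$, where $$\widetilde E_N^+(n)=4\sum_{k=0}^n{}_{(n)}\pi(k)\sum_{m=n+1}^\infty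 Q(k;m)\left\{v(m)+b\left(\frac1c+\frac{2}{\beta\,\overline\phi^{(\beta)}_{K,N}}\right)e\right\}.$$
   Context: Notation: $\mathbb Z_+=\{0,1,2,\dots\}$, $\mathbb N=\{1,2,\dots\}$. For $k\in\mathbb Z_+$, $\mathbb S_k=\{0,1,\dots,S_k\}$ with $S_k\in\mathbb Z_+$, and $S_k=S_1$ for all $k\in\mathbb N$. Levels: $\mathbb L_k=\{k\}\times\mathbb S_k$; $\mathbb F=\bigcup_{k\ge0}\mathbb L_k$, $\mathbb F_n=\bigcup_{k=0}^n\mathbb L_k$, $\overline{\mathbb F}_n=\mathbb F\setminus\mathbb F_n$. For a vector $x=(x(k,i))_{(k,i)\in\mathbb F}$, $x(k)=(x(k,i))_{i\in\mathbb S_k}$ is its subvector for level $k$. The subvector of $v$ on $\overline{\mathbb F}_0$ is level-wise nondecreasing if $v(k)\le v(k+1)$ for all $k\in\mathbb N$. $e$ is a column vector of ones of appropriate size, $1_{\mathbb C}$ is the column indicator vector of $\mathbb C\subseteq\mathbb F$, $O$ the zero matrix; inequalities and absolute values $|\cdot|$ of vectors and matrices are entrywise. $\{(X(t),J(t))\}$ is a continuous-time regular-jump (non-explosive) Markov chain with state space $\mathbb F$, transition matrix function $P^{(t)}=(p^{(t)}(k,i;\ell,j))$ and stable, conservative infinitesimal generator $Q=(q(k,i;\ell,j))$ with blocks $Q(k;\ell)=(q(k,i;\ell,j))_{i\in\mathbb S_k,\,j\in\mathbb S_\ell}$. Ergodic means irreducible and positive recurrent; $\pi$ is the unique stationary distribution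 (row vector, $\pi Q=0$, $\pi e=1$). For $n\in\mathbb N$, the last-column-block-augmented (LC-block-augmented) truncation ${}_{(n)}Q$ of $Q$ is the conservative $q$-matrix on $\mathbb F$ with blocks $${}_{(n)}Q(k;\ell)=\begin{cases}Q(k;\ell),&k\in\mathbb Z_+,\ 0\le\ell\le n-1,\\ Q(k;n)+\sum_{m>n,\,m\ne k}Q(k;m),&k\in\mathbb Z_+,\ \ell=n,\\ Q(k;k),&k=\ell\ge n+1,\\ O,&\text{otherwise.}\end{cases}$$ ${}_{(n)}\pi=({}_{(n)}\pi(k,i))_{(k,i)\in\mathbb F}$ is its unique stationary distribution (row vector); ${}_{(n)}\pi(k)=0$ for $k\ge n+1$. For $\beta>0$: $\Phi^{(\beta)}=\int_0^\infty\beta e^{-\beta t}P^{(t)}\,dt$. For $N\ge K$, $Q_{\mathbb F_N}=(q(k,i;\ell,j))_{(k,i),(\ell,j)\in\mathbb F_N}$ is the northwest-corner truncation of $Q$, and $\Phi^{(\beta)}_{\mathbb F_N}=(\phi^{(\beta)}_{\mathbb F_N}(k,i;\ell,j))=\int_0^\infty\beta e^{-\beta t}\exp\{Q_{\mathbb F_N}t\}\,dt=(I-Q_{\mathbb F_N}/\beta)^{-1}$. $[\,\cdot\,]_{\mathbb F_K}$ denotes the $|\mathbb F_K|\times|\mathbb F_K|$ northwest corner of a matrix (rows and columns in $\mathbb F_K$). Finally $\overline\phi^{(\beta)}_{K,N}=\sup_{(\ell,j)\in\mathbb F_N}\min_{(k,i)\in\mathbb F_K}\phi^{(\beta)}_{\mathbb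 F_N}(k,i;\ell,j)$. *)

theory Defs
  imports "HOL-Probability.Probability"
begin

text \<open>
  A state is a pair (level, phase); \<open>S k\<close> is the largest phase of level \<open>k\<close>. Vectors and
  matrices are functions on the whole type of states, and only their values on \<open>FF S\<close> matter.
\<close>

type_synonym state = "nat \<times> nat"
type_synonym vector = "state \<Rightarrow> real"
type_synonym matrix = "state \<Rightarrow> state \<Rightarrow> real"

definition FF :: "(nat \<Rightarrow> nat) \<Rightarrow> state set" where
  "FF S = (SIGMA k:UNIV. {..S k})"

definition FF_upto :: "(nat \<Rightarrow> nat) \<Rightarrow> nat \<Rightarrow> state set" where
  "FF_upto S n = (SIGMA k:{..n}. {..S k})"

definition row_col :: "state set \<Rightarrow> vector \<Rightarrow> vector \<Rightarrow> real" where
  "row_col F x g = (\<Sum>\<^sub>\<infinity>s\<in>F. x s * g s)"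

definition levelwise_nondecreasing :: "(nat \<Rightarrow> nat) \<Rightarrow> vector \<Rightarrow> bool" where
  "levelwise_nondecreasing S v \<longleftrightarrow> (\<forall>k\<ge>1. \<forall>i\<le>S k. v (k, i) \<le> v (k + 1, i))"

definition transition_matrix_function :: "state set \<Rightarrow> (real \<Rightarrow> matrix) \<Rightarrow> bool" where
  "transition_matrix_function F P \<longleftrightarrow>
     (\<forall>t\<ge>0. \<forall>s\<in>F. (\<forall>s'\<in>F. 0 \<le> P t s s') \<and> (P t s has_sum 1) F) \<and>
     (\<forall>s\<in>F. \<forall>s'\<in>F. P 0 s s' = of_bool (s = s')) \<and>
     (\<forall>t\<ge>0. \<forall>h\<ge>0. \<forall>s\<in>F. \<forall>s'\<in>F. ((\<lambda>u. P t s u * P h u s') has_sum P (t + h) s s') F)"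

text \<open>The process has an arbitrary initial law; the set \<open>A\<close> is a finite piece of the past.\<close>

definition markov_chain ::
  "state set \<Rightarrow> (real \<Rightarrow> matrix) \<Rightarrow> 'w measure \<Rightarrow> (real \<Rightarrow> 'w \<Rightarrow> state) \<Rightarrow> bool" where
  "markov_chain F P M Z \<longleftrightarrow>
     prob_space M \<and> transition_matrix_function F P \<and>
     (\<forall>t\<ge>0. Z t \<in> M \<rightarrow>\<^sub>M count_space F) \<and>
     (\<forall>A t h s s'. finite A \<and> (\<forall>(r, x)\<in>A. 0 \<le> r \<and> r < t) \<and> 0 \<le> t \<and> 0 \<le> h \<and> s \<in> F \<and> s' \<in> F \<and>
        \<P>(w in M. (\<forall>(r, x)\<in>A. Z r w = x) \<and> Z t w = s) > 0 \<longrightarrow>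
        \<P>(w in M. Z (t + h) w = s' \<bar> (\<forall>(r, x)\<in>A. Z r w = x) \<and> Z t w = s) = P h s s')"

text \<open>
  Almost every path is right-continuous (for the discrete topology) and has finitely many
  discontinuities in every bounded time interval, so that the chain does not explode.
\<close>

definition regular_jump :: "'w measure \<Rightarrow> (real \<Rightarrow> 'w \<Rightarrow> state) \<Rightarrow> bool" where
  "regular_jump M Z \<longleftrightarrow>
     (AE w in M.
        (\<forall>t\<ge>0. \<forall>\<^sub>F u in at_right t. Z u w = Z t w) \<and>
        (\<forall>a\<ge>0. finite {t \<in> {0..a}. \<not> (\<forall>\<^sub>F u in at t within {0..}. Z u w = Z t w)}))"

text \<open>Time from \<open>u\<close> until the first return to \<open>s\<close> after an exit from \<open>s\<close>; infinite if there is none.\<close>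

definition return_time :: "(real \<Rightarrow> 'w \<Rightarrow> state) \<Rightarrow> state \<Rightarrow> real \<Rightarrow> 'w \<Rightarrow> ennreal" where
  "return_time Z s u w =
     (INF t \<in> {t. 0 \<le> t \<and> Z (u + t) w = s \<and> (\<exists>r\<in>{0..<t}. Z (u + r) w \<noteq> s)}. ennreal t)"

text \<open>
  Finite conditional mean return time given \<open>Z u = s\<close>. By the Markov property and homogeneity it is
  the same for every time \<open>u\<close> at which \<open>s\<close> has positive probability; such a \<open>u\<close> is needed because
  the initial law may give \<open>s\<close> no mass.
\<close>

definition positive_recurrent :: "'w measure \<Rightarrow> (real \<Rightarrow> 'w \<Rightarrow> state) \<Rightarrow> state \<Rightarrow> bool" where
  "positive_recurrent M Z s \<longleftrightarrow>
     (\<exists>u\<ge>0. \<P>(w in M. Z u w = s) > 0 \<and>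
        (\<integral>\<^sup>+w. return_time Z s u w \<partial>uniform_measure M {w \<in> space M. Z u w = s}) < \<infinity>)"

definition irreducible_chain :: "state set \<Rightarrow> (real \<Rightarrow> matrix) \<Rightarrow> bool" where
  "irreducible_chain F P \<longleftrightarrow> (\<forall>s\<in>F. \<forall>s'\<in>F. \<exists>t>0. 0 < P t s s')"

definition ergodic ::
  "state set \<Rightarrow> (real \<Rightarrow> matrix) \<Rightarrow> 'w measure \<Rightarrow> (real \<Rightarrow> 'w \<Rightarrow> state) \<Rightarrow> bool" where
  "ergodic F P M Z \<longleftrightarrow> irreducible_chain F P \<and> (\<forall>s\<in>F. positive_recurrent M Z s)"

text \<open>Stability (finite diagonal) is built into the real-valued type.\<close>

definition conservative_q_matrix :: "state set \<Rightarrow> matrix \<Rightarrow> bool" where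
  "conservative_q_matrix F Q \<longleftrightarrow>
     (\<forall>s\<in>F. (\<forall>s'\<in>F. s \<noteq> s' \<longrightarrow> 0 \<le> Q s s') \<and> (Q s has_sum 0) F)"

definition infinitesimal_generator :: "state set \<Rightarrow> (real \<Rightarrow> matrix) \<Rightarrow> matrix \<Rightarrow> bool" where
  "infinitesimal_generator F P Q \<longleftrightarrow>
     (\<forall>s\<in>F. \<forall>s'\<in>F. ((\<lambda>h. (P h s s' - of_bool (s = s')) / h) \<longlongrightarrow> Q s s') (at_right 0))"

definition stationary_distribution :: "state set \<Rightarrow> matrix \<Rightarrow> vector \<Rightarrow> bool" where
  "stationary_distribution F Q x \<longleftrightarrow>
     (\<forall>s\<in>F. 0 \<le> x s) \<and> (x has_sum 1) F \<and>
     (\<forall>s'\<in>F. ((\<lambda>s. x s * Q s s') has_sum 0) F)"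

definition leads_to :: "state set \<Rightarrow> matrix \<Rightarrow> (state \<times> state) set" where
  "leads_to F Q = {(s, s'). s \<in> F \<and> s' \<in> F \<and> s \<noteq> s' \<and> 0 < Q s s'}\<^sup>*"

definition closed_communicating_class :: "state set \<Rightarrow> matrix \<Rightarrow> state set \<Rightarrow> bool" where
  "closed_communicating_class F Q C \<longleftrightarrow>
     (\<exists>s\<in>F. C = {s' \<in> F. (s, s') \<in> leads_to F Q \<and> (s', s) \<in> leads_to F Q}) \<and>
     (\<forall>s\<in>C. \<forall>s'\<in>F. (s, s') \<in> leads_to F Q \<longrightarrow> s' \<in> C)"

text \<open>
  The LC-block-augmented truncation, entry by entry. It is used for \<open>n \<ge> 1\<close> only, where all the
  levels \<open>m \<ge> n\<close> have the same phases, so that adding the blocks makes sense.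
\<close>

definition lc_trunc :: "matrix \<Rightarrow> nat \<Rightarrow> matrix" where
  "lc_trunc Q n = (\<lambda>(k, i) (l, j).
     if l < n then Q (k, i) (l, j)
     else if l = n then Q (k, i) (n, j) + (\<Sum>\<^sub>\<infinity>m\<in>{m. n < m \<and> m \<noteq> k}. Q (k, i) (m, j))
     else if k = l then Q (k, i) (l, j)
     else 0)"

text \<open>
  The drift condition \<open>Q v \<le> - c v + b 1\<^sub>B\<close>. Since \<open>Q\<close> is nonnegative off the diagonal and \<open>v\<close> is
  positive, the inequality presupposes that the series \<open>Q v\<close> converges; this is stated explicitly
  because a divergent \<open>infsum\<close> has the value 0.
\<close>

definition drift_condition :: "state set \<Rightarrow> matrix \<Rightarrow> vector \<Rightarrow> real \<Rightarrow> real \<Rightarrow> state set \<Rightarrow> bool" where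
  "drift_condition F Q v c b B \<longleftrightarrow>
     (\<forall>s\<in>F. (\<lambda>s'. Q s s' * v s') summable_on F \<and>
        (\<Sum>\<^sub>\<infinity>s'\<in>F. Q s s' * v s') \<le> - c * v s + b * indicator B s)"

definition Phi :: "(real \<Rightarrow> matrix) \<Rightarrow> real \<Rightarrow> matrix" where
  "Phi P \<beta> s s' = (LINT t:{0..}|lborel. \<beta> * exp (- \<beta> * t) * P t s s')"

primrec submatrix_power :: "state set \<Rightarrow> matrix \<Rightarrow> nat \<Rightarrow> matrix" where
  "submatrix_power A Q 0 = (\<lambda>s s'. of_bool (s = s'))"
| "submatrix_power A Q (Suc p) = (\<lambda>s s'. \<Sum>u\<in>A. Q s u * submatrix_power A Q p u s')"

text \<open>\<open>exp (Q\<^sub>A t)\<close> for the restriction \<open>Q\<^sub>A\<close> of \<open>Q\<close> to a finite set \<open>A\<close>.\<close>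

definition submatrix_exp :: "state set \<Rightarrow> matrix \<Rightarrow> real \<Rightarrow> matrix" where
  "submatrix_exp A Q t s s' = (\<Sum>p. t ^ p / fact p * submatrix_power A Q p s s')"

definition Phi_trunc :: "(nat \<Rightarrow> nat) \<Rightarrow> matrix \<Rightarrow> real \<Rightarrow> nat \<Rightarrow> matrix" where
  "Phi_trunc S Q \<beta> N = Phi (submatrix_exp (FF_upto S N) Q) \<beta>"

definition phi_bar :: "(nat \<Rightarrow> nat) \<Rightarrow> matrix \<Rightarrow> real \<Rightarrow> nat \<Rightarrow> nat \<Rightarrow> real" where
  "phi_bar S Q \<beta> K N =
     (SUP s'\<in>FF_upto S N. Min ((\<lambda>s. Phi_trunc S Q \<beta> N s s') ` FF_upto S K))"

text \<open>Here \<open>x\<close> is the stationary distribution of the truncation at level \<open>n\<close>.\<close>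

definition E_tilde ::
  "(nat \<Rightarrow> nat) \<Rightarrow> matrix \<Rightarrow> vector \<Rightarrow> real \<Rightarrow> real \<Rightarrow> real \<Rightarrow> nat \<Rightarrow> nat \<Rightarrow> vector \<Rightarrow> nat \<Rightarrow> real" where
  "E_tilde S Q v b c \<beta> K N x n =
     2 * (\<Sum>k\<le>n. \<Sum>i\<le>S k. x (k, i) *
       (\<Sum>\<^sub>\<infinity>m\<in>{n<..}. \<Sum>j\<le>S m. Q (k, i) (m, j) *
          (v (m, j) + v (n, j) + 2 * b * (1 / c + 2 / (\<beta> * phi_bar S Q \<beta> K N)))))"

definition E_tilde_plus ::
  "(nat \<Rightarrow> nat) \<Rightarrow> matrix \<Rightarrow> vector \<Rightarrow> real \<Rightarrow> real \<Rightarrow> real \<Rightarrow> nat \<Rightarrow> nat \<Rightarrow> vector \<Rightarrow> nat \<Rightarrow> real" where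
  "E_tilde_plus S Q v b c \<beta> K N x n =
     4 * (\<Sum>k\<le>n. \<Sum>i\<le>S k. x (k, i) *
       (\<Sum>\<^sub>\<infinity>m\<in>{n<..}. \<Sum>j\<le>S m. Q (k, i) (m, j) *
          (v (m, j) + b * (1 / c + 2 / (\<beta> * phi_bar S Q \<beta> K N)))))"

end

theory Submission
  imports Defs
begin

text \<open>
  Fix a level \<open>n\<close>, write \<open>x\<close> for the stationary distribution of the truncation and put
  \<open>\<sigma> = sgn (\<pi> - x) g\<close>, so that \<open>|\<pi> - x| g = (\<pi> - x) \<sigma>\<close>. If \<open>h\<close> solves the Poisson equation
  \<open>Q h = - (\<sigma> - \<pi> \<sigma>)\<close>, then \<open>(\<pi> - x) \<sigma> = x Q h\<close>, and since \<open>x\<close> annihilates the truncated generator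
  only the difference of the two generators contributes. That difference redirects every jump from
  \<open>s\<close> to a state \<open>(m, j)\<close> with \<open>m > n\<close> to the state \<open>(n, j)\<close>, so the error is
  \<open>\<Sum> x(s) Q(s; m, j) (h(m, j) - h(n, j))\<close> (lemma \<open>truncation_error\<close>). Everything reduces to a pointwise
  bound \<open>|h| \<le> (\<pi> g + 1) (v + B)\<close> with \<open>B = b (1/c + 2/(\<beta> \<phi>))\<close>, where \<open>\<phi>\<close> is the supremum of minima
  that occurs in the error term.

  Such an \<open>h\<close> is built from excursions (lemma \<open>poisson\<close>). Let \<open>\<alpha>\<close> be a state at which the supremum
  \<open>\<phi>\<close> is attained, and for a cost rate \<open>f \<ge> 0\<close> let \<open>h s\<close> be the expected cost accumulated from \<open>s\<close> until
  \<open>\<alpha>\<close> is hit. This is a potential of the jump chain killed at \<open>\<alpha>\<close>, and it is the least nonnegative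
  solution of an inequality; hence it is dominated by any function \<open>w\<close> with \<open>Q w \<le> - f\<close> off \<open>\<alpha>\<close>
  (lemma \<open>potential_least\<close>). A suitable \<open>w\<close> comes from the drift condition once the constant
  \<open>b\<close> on the levels up to \<open>K\<close> is compensated: the column \<open>p\<close> of the truncated resolvent at \<open>\<alpha>\<close> satisfies
  \<open>Q p \<ge> \<beta> \<phi>\<close> on those levels off \<open>\<alpha>\<close>, and \<open>Q p \<ge> 0\<close> at all other states off \<open>\<alpha>\<close>, so
  \<open>w = v + b/(\<beta> \<phi>) (1 - p)\<close> has \<open>Q w \<le> - c v\<close> off \<open>\<alpha>\<close> (lemma \<open>atom_drift\<close>). Because \<open>0 \<le> p \<le> 1\<close>, it exceeds \<open>v\<close> by at most \<open>b/(\<beta> \<phi>) \<le> B\<close>. As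
  \<open>|\<sigma> - \<pi> \<sigma>| \<le> g + \<pi> g \<le> (1 + \<pi> g) c v\<close>, the factor \<open>\<pi> g + 1\<close> appears.

  The Poisson equation at \<open>\<alpha>\<close> itself is the cycle formula, which expresses \<open>\<pi>\<close> through the occupation
  of one excursion from \<open>\<alpha>\<close> (lemma \<open>entrance_potential\<close>). It requires that excursions return, and the
  drift inequality alone gives only that an excursion is short: its path could still be lost by
  explosion. Regularity of the sample paths excludes this (lemma \<open>no_explosion\<close>): a path sampled along
  arbitrarily fine grids changes no more often than it has discontinuities, so with high probability
  the number of changes is bounded uniformly in the grid, and the grid estimates converge to
  estimates for the jump chain.

  Finally, \<open>x\<close> vanishes above level \<open>n\<close>: its support in a higher level would be a finite set closed
  under \<open>Q\<close>, which irreducibility excludes (lemma \<open>lc_trunc_stationary_above\<close>).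
\<close>

section \<open>Sums over countable sets\<close>

lemma nn_integral_count_space_swap:
  fixes f :: "'a::countable \<Rightarrow> 'b::countable \<Rightarrow> ennreal"
  shows "(\<integral>\<^sup>+x. (\<integral>\<^sup>+y. f x y \<partial>count_space UNIV) \<partial>count_space UNIV) =
         (\<integral>\<^sup>+y. (\<integral>\<^sup>+x. f x y \<partial>count_space UNIV) \<partial>count_space UNIV)"
proof -
  interpret pair_sigma_finite "count_space (UNIV :: 'a set)" "count_space (UNIV :: 'b set)"
    by (intro pair_sigma_finite.intro sigma_finite_measure_count_space)
  have "case_prod f \<in> borel_measurable (count_space UNIV \<Otimes>\<^sub>M count_space UNIV)"
    by (simp add: pair_measure_countable)
  from Fubini'[OF this] show ?thesis by simp
qed

lemma nn_integral_count_space_has_sum: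
  assumes "\<And>s. s \<in> A \<Longrightarrow> 0 \<le> f s" "(f has_sum x) A"
  shows "(\<integral>\<^sup>+s. (if s \<in> A then ennreal (f s) else 0) \<partial>count_space UNIV) = ennreal x"
proof -
  have "f summable_on A" using assms(2) by (auto simp: summable_on_def)
  then have abs: "Infinite_Set_Sum.abs_summable_on f A"
    using summable_on_iff_abs_summable_on_real abs_summable_equivalent by blast
  have "(\<integral>\<^sup>+s. (if s \<in> A then ennreal (f s) else 0) \<partial>count_space UNIV) =
      (\<integral>\<^sup>+s. ennreal (f s) * indicator A s \<partial>count_space UNIV)"
    by (intro nn_integral_cong) (auto simp: indicator_def)
  also have "\<dots> = (\<integral>\<^sup>+s. ennreal (f s) \<partial>count_space A)"
    by (rule nn_integral_count_space_indicator[symmetric]) auto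
  also have "\<dots> = ennreal (infsetsum f A)"
    using abs assms(1) by (rule nn_integral_conv_infsetsum)
  also have "infsetsum f A = x"
    using abs assms(2) by (simp add: infsetsum_infsum infsumI)
  finally show ?thesis .
qed

lemma has_sum_of_nn_integral_count_space:
  assumes "\<And>s. s \<in> A \<Longrightarrow> 0 \<le> f s" "0 \<le> x"
    "(\<integral>\<^sup>+s. (if s \<in> A then ennreal (f s) else 0) \<partial>count_space UNIV) = ennreal x"
  shows "(f has_sum x) A"
proof -
  have "(\<integral>\<^sup>+s. (if s \<in> A then ennreal (f s) else 0) \<partial>count_space UNIV) =
      (\<integral>\<^sup>+s. ennreal (f s) * indicator A s \<partial>count_space UNIV)"
    by (intro nn_integral_cong) (auto simp: indicator_def)
  also have "\<dots> = (\<integral>\<^sup>+s. ennreal (f s) \<partial>count_space A)"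
    by (rule nn_integral_count_space_indicator[symmetric]) auto
  finally have *: "(\<integral>\<^sup>+s. ennreal (f s) \<partial>count_space A) = ennreal x" using assms(3) by simp
  have "integrable (count_space A) f"
    using * assms(1) by (intro integrableI_nonneg) (auto simp: AE_count_space)
  then have "Infinite_Set_Sum.abs_summable_on f A"
    by (simp add: Infinite_Set_Sum.abs_summable_on_def)
  then have "f summable_on A"
    using assms(1) summable_on_iff_abs_summable_on_real abs_summable_equivalent by blast
  then obtain y where y: "(f has_sum y) A" by (auto simp: summable_on_def)
  have "y \<ge> 0" using has_sum_nonneg[OF y assms(1)] .
  with nn_integral_count_space_has_sum[OF assms(1) y] assms(2,3) have "x = y" by simp
  with y show ?thesis by simp
qed

lemma has_sum_diff:
  fixes f g :: "'a \<Rightarrow> real"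
  assumes "(f has_sum a) A" "(g has_sum b) A"
  shows "((\<lambda>x. f x - g x) has_sum (a - b)) A"
  using has_sum_add[OF assms(1), of "\<lambda>x. - g x" "- b"] assms(2) by (simp add: has_sum_uminus)

lemma has_sum_sum:
  fixes f :: "'i \<Rightarrow> 'a \<Rightarrow> real"
  assumes "\<And>i. i \<in> I \<Longrightarrow> (f i has_sum x i) A"
  shows "((\<lambda>a. \<Sum>i\<in>I. f i a) has_sum (\<Sum>i\<in>I. x i)) A"
  using assms by (induction I rule: infinite_finite_induct) (auto intro: has_sum_add)

section \<open>Kernels, potentials and the comparison principle\<close>

definition act :: "('a \<Rightarrow> 'a \<Rightarrow> ennreal) \<Rightarrow> ('a \<Rightarrow> ennreal) \<Rightarrow> 'a \<Rightarrow> ennreal" where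
  "act H u s = (\<integral>\<^sup>+s'. H s s' * u s' \<partial>count_space UNIV)"

definition potential :: "('a \<Rightarrow> 'a \<Rightarrow> ennreal) \<Rightarrow> ('a \<Rightarrow> ennreal) \<Rightarrow> 'a \<Rightarrow> ennreal" where
  "potential H u s = (\<Sum>j. (act H ^^ j) u s)"

abbreviation (input) transpose_kernel :: "('a \<Rightarrow> 'a \<Rightarrow> ennreal) \<Rightarrow> 'a \<Rightarrow> 'a \<Rightarrow> ennreal" ("_\<^sup>T" [1000] 1000) where
  "H\<^sup>T \<equiv> (\<lambda>s s'. H s' s)"

definition pairing :: "('a \<Rightarrow> ennreal) \<Rightarrow> ('a \<Rightarrow> ennreal) \<Rightarrow> ennreal" where
  "pairing \<mu> u = (\<integral>\<^sup>+s. \<mu> s * u s \<partial>count_space UNIV)"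

lemma act_mono:
  assumes "\<And>s'. H s s' \<le> H' s s'" "\<And>s'. u s' \<le> u' s'"
  shows "act H u s \<le> act H' u' s"
  unfolding act_def by (intro nn_integral_mono mult_mono assms) auto

lemma act_add: "act H (\<lambda>s. u s + u' s) s = act H u s + act H u' s"
  unfolding act_def by (simp add: distrib_left nn_integral_add)

lemma act_cmult: "act H (\<lambda>s. C * u s) s = C * act H u s"
  unfolding act_def by (simp add: mult.left_commute nn_integral_cmult)

lemma act_suminf: "act H (\<lambda>s. \<Sum>j. f j s) s = (\<Sum>j. act H (f j) s)"
  unfolding act_def ennreal_suminf_cmult[symmetric] by (rule nn_integral_suminf) simp

lemma funpow_act_mono:
  assumes "\<And>s s'. H s s' \<le> H' s s'" "\<And>s'. u s' \<le> u' s'"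
  shows "(act H ^^ j) u s \<le> (act H' ^^ j) u' s"
  by (induction j arbitrary: s) (auto intro!: act_mono assms)

lemma potential_unfold: "potential H u s = u s + act H (potential H u) s"
proof -
  have "potential H u s = (act H ^^ 0) u s + (\<Sum>j. (act H ^^ Suc j) u s)"
    unfolding potential_def by (subst suminf_offset[of _ 1]) auto
  then show ?thesis
    unfolding potential_def[abs_def] by (simp add: act_suminf)
qed

text \<open>
  The series has the comparison property of a least solution: a supersolution dominates every
  partial sum, by induction on the length. This is how a Lyapunov function bounds expected costs.
\<close>

lemma potential_least:
  assumes "\<And>s. u s + act H w s \<le> w s"
  shows "potential H u s \<le> w s"
proof -
  have *: "(\<Sum>j<n. (act H ^^ j) u s) \<le> w s" for n s
  proof (induction n arbitrary: s)
    case (Suc n)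
    have eq: "act H (\<lambda>s. \<Sum>j<n. (act H ^^ j) u s) s = (\<Sum>j<n. (act H ^^ Suc j) u s)" for s
      unfolding act_def by (simp add: sum_distrib_left nn_integral_sum flip: act_def)
    have "(\<Sum>j<Suc n. (act H ^^ j) u s) = u s + act H (\<lambda>s. \<Sum>j<n. (act H ^^ j) u s) s"
      unfolding eq by (subst sum.lessThan_Suc_shift) simp
    also have "\<dots> \<le> u s + act H w s"
      by (intro add_left_mono act_mono Suc.IH) auto
    finally show ?case using assms[of s] by simp
  qed simp
  show ?thesis
    unfolding potential_def by (rule suminf_le_const) (auto simp: *)
qed

lemma funpow_act_commute:
  "(act H ^^ j) (act H u) = act H ((act H ^^ j) u)"
  by (metis comp_apply funpow_Suc_right funpow.simps(2))

lemma pairing_act: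
  fixes H :: "'a::countable \<Rightarrow> 'a \<Rightarrow> ennreal"
  shows "pairing \<mu> (act H u) = pairing (act H\<^sup>T \<mu>) u"
proof -
  have "pairing \<mu> (act H u) =
      (\<integral>\<^sup>+s. (\<integral>\<^sup>+s'. \<mu> s * (H s s' * u s') \<partial>count_space UNIV) \<partial>count_space UNIV)"
    unfolding pairing_def act_def by (subst nn_integral_cmult) auto
  also have "\<dots> = (\<integral>\<^sup>+s'. (\<integral>\<^sup>+s. H s s' * \<mu> s * u s' \<partial>count_space UNIV) \<partial>count_space UNIV)"
    by (subst nn_integral_count_space_swap) (simp add: mult_ac)
  also have "\<dots> = pairing (act H\<^sup>T \<mu>) u"
    unfolding pairing_def act_def by (subst nn_integral_multc) auto
  finally show ?thesis .
qed

lemma pairing_potential: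
  fixes H :: "'a::countable \<Rightarrow> 'a \<Rightarrow> ennreal"
  shows "pairing a (potential H u) = pairing (potential H\<^sup>T a) u"
proof -
  have *: "pairing a ((act H ^^ j) u) = pairing ((act H\<^sup>T ^^ j) a) u" for j
  proof (induction j arbitrary: u)
    case (Suc j)
    have "pairing a ((act H ^^ Suc j) u) = pairing a ((act H ^^ j) (act H u))"
      by (simp add: funpow_act_commute)
    then show ?case by (simp add: Suc pairing_act)
  qed simp
  have "pairing a (potential H u) = (\<Sum>j. pairing a ((act H ^^ j) u))"
    unfolding pairing_def potential_def ennreal_suminf_cmult[symmetric]
    by (rule nn_integral_suminf) simp
  also have "\<dots> = pairing (potential H\<^sup>T a) u"
    unfolding * unfolding pairing_def potential_def ennreal_suminf_multc[symmetric]
    by (rule nn_integral_suminf[symmetric]) simp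
  finally show ?thesis .
qed

text \<open>
  By comparison \<open>\<rho>\<close> dominates the potential of \<open>a\<close>. If both charge a function \<open>u0\<close> equally and
  finitely, they charge each \<open>H\<^sup>j u0\<close> equally, because the same finite term \<open>pairing a (H\<^sup>j u0)\<close> splits off on
  both sides. At a state where some \<open>H\<^sup>j u0\<close> is positive the two measures therefore agree.
\<close>

lemma potential_eq_of_recurrent:
  fixes H :: "'a::countable \<Rightarrow> 'a \<Rightarrow> ennreal"
  assumes \<rho>: "\<And>s. \<rho> s = a s + act H\<^sup>T \<rho> s"
    and u0: "pairing \<rho> u0 = pairing a (potential H u0)" "pairing \<rho> u0 < \<infinity>"
    and pos: "potential H u0 s > 0"
  shows "\<rho> s = potential H\<^sup>T a s"
proof -
  let ?\<mu> = "potential H\<^sup>T a"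
  have le: "?\<mu> s \<le> \<rho> s" for s
    using \<rho> by (intro potential_least) (metis order.refl)
  have step: "pairing \<nu> u = pairing a u + pairing \<nu> (act H u)"
    if "\<And>s. \<nu> s = a s + act H\<^sup>T \<nu> s" for \<nu> u
  proof -
    have "\<nu> = (\<lambda>s. a s + act H\<^sup>T \<nu> s)"
      using that by (rule ext)
    then have "pairing \<nu> u = pairing (\<lambda>s. a s + act H\<^sup>T \<nu> s) u"
      by (rule arg_cong)
    also have "\<dots> = pairing a u + pairing (act H\<^sup>T \<nu>) u"
      unfolding pairing_def by (simp add: distrib_right nn_integral_add)
    finally show ?thesis by (simp add: pairing_act)
  qed
  have eq: "pairing \<rho> ((act H ^^ n) u0) = pairing ?\<mu> ((act H ^^ n) u0) \<and>
            pairing \<rho> ((act H ^^ n) u0) < \<infinity>" for n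
  proof (induction n)
    case 0 then show ?case using u0 by (simp add: pairing_potential)
  next
    case (Suc n)
    let ?u = "(act H ^^ n) u0"
    have 1: "pairing \<rho> ?u = pairing a ?u + pairing \<rho> (act H ?u)" by (rule step[OF \<rho>])
    have 2: "pairing ?\<mu> ?u = pairing a ?u + pairing ?\<mu> (act H ?u)"
      by (rule step[OF potential_unfold])
    have "pairing a ?u < \<infinity>" "pairing \<rho> (act H ?u) < \<infinity>"
      using Suc 1 by (auto simp: ennreal_add_eq_top less_top)
    moreover have "pairing a ?u + pairing \<rho> (act H ?u) = pairing a ?u + pairing ?\<mu> (act H ?u)"
      using Suc.IH unfolding 1[symmetric] 2[symmetric] by simp
    ultimately show ?case
      unfolding ennreal_add_left_cancel by auto
  qed
  obtain n where n: "(act H ^^ n) u0 s > 0"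
  proof (rule ccontr)
    assume "\<not> thesis"
    with that have "(\<lambda>j. (act H ^^ j) u0 s) = (\<lambda>_. 0)"
      by (auto simp: fun_eq_iff zero_less_iff_neq_zero)
    with pos show False by (simp add: potential_def)
  qed
  let ?u = "(act H ^^ n) u0"
  have prod_le: "?\<mu> s * ?u s \<le> \<rho> s * ?u s" for s
    by (rule mult_right_mono[OF le]) simp
  have prod_fin: "\<rho> s * ?u s < \<infinity>"
    using eq[of n] nn_integral_ge_point[of s UNIV "\<lambda>s. \<rho> s * ?u s"]
    unfolding pairing_def by (metis UNIV_I order_le_less_trans)
  have "(\<integral>\<^sup>+s. \<rho> s * ?u s - ?\<mu> s * ?u s \<partial>count_space UNIV) =
      pairing \<rho> ?u - pairing ?\<mu> ?u"
    unfolding pairing_def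
    by (rule nn_integral_diff) (use eq[of n] prod_le in \<open>auto simp: pairing_def\<close>)
  also have "\<dots> = 0" using eq[of n] by auto
  finally have "\<rho> s * ?u s - ?\<mu> s * ?u s = 0"
    by (subst (asm) nn_integral_0_iff_AE) (auto simp: AE_count_space)
  then have "\<rho> s * ?u s \<le> ?\<mu> s * ?u s"
    by (rule ennreal_minus_eq_0)
  show ?thesis
  proof (rule antisym[OF _ le], rule ccontr)
    assume "\<not> \<rho> s \<le> ?\<mu> s"
    then have less: "?\<mu> s < \<rho> s" by simp
    then have "?u s < top"
      using prod_fin by (auto simp: ennreal_mult_less_top)
    from ennreal_mult_strict_right_mono[OF less n this] \<open>\<rho> s * ?u s \<le> ?\<mu> s * ?u s\<close>
    show False by simp
  qed
qed

lemma act_one_le: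
  assumes "\<And>s'. u s' \<le> 1" "act H (\<lambda>_. 1) s \<le> 1" shows "act H u s \<le> 1"
  using act_mono[of H s H u "\<lambda>_. 1"] assms by (meson order.refl order.trans)

lemma funpow_act_one_le:
  assumes "\<And>s. act H (\<lambda>_. 1) s \<le> 1" shows "(act H ^^ n) (\<lambda>_. 1) s \<le> 1"
  by (induction n arbitrary: s) (auto intro!: act_one_le assms)

text \<open>
  A form of Fatou's lemma: the tail infima of the kernels increase to the limit kernel, so monotone
  convergence carries the bound through each power.
\<close>

lemma funpow_act_limit_le:
  fixes K :: "nat \<Rightarrow> 'a::countable \<Rightarrow> 'a \<Rightarrow> ennreal"
  assumes lim: "\<And>s s'. (\<lambda>m. K m s s') \<longlonglongrightarrow> H s s'" and fin: "\<And>s s'. H s s' < \<infinity>"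
    and sub: "\<And>s. act H (\<lambda>_. 1) s \<le> 1"
    and le: "\<And>m. (act (K m) ^^ n) (\<lambda>_. 1) s \<le> C"
  shows "(act H ^^ n) (\<lambda>_. 1) s \<le> C"
proof -
  define L where "L m s s' = (INF k\<in>{m..}. K k s s')" for m s s'
  have L_mono: "L m s s' \<le> L m' s s'" if "m \<le> m'" for m m' s s'
    unfolding L_def using that by (intro INF_superset_mono) auto
  have L_lim: "(\<lambda>m. L m s s') \<longlonglongrightarrow> H s s'" for s s'
  proof -
    have "(\<lambda>m. L m s s') \<longlonglongrightarrow> (SUP m. L m s s')"
      by (intro LIMSEQ_SUP) (simp add: incseq_def L_mono)
    moreover have "(SUP m. L m s s') = H s s'"
      using lim_imp_Liminf[OF _ lim, of s s'] by (simp add: liminf_SUP_INF L_def)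
    ultimately show ?thesis by simp
  qed
  have "(\<lambda>m. (act (L m) ^^ k) (\<lambda>_. 1) s) \<longlonglongrightarrow> (act H ^^ k) (\<lambda>_. 1) s" for k s
  proof (induction k arbitrary: s)
    case (Suc k)
    have "(\<lambda>m. \<integral>\<^sup>+s'. L m s s' * (act (L m) ^^ k) (\<lambda>_. 1) s' \<partial>count_space UNIV) \<longlonglongrightarrow>
       (\<integral>\<^sup>+s'. H s s' * (act H ^^ k) (\<lambda>_. 1) s' \<partial>count_space UNIV)"
    proof (rule nn_integral_LIMSEQ)
      show "incseq (\<lambda>m s'. L m s s' * (act (L m) ^^ k) (\<lambda>_. 1) s')"
        by (unfold incseq_def, intro allI impI le_funI mult_mono funpow_act_mono L_mono) auto
      fix s'
      have "(act H ^^ k) (\<lambda>_. 1) s' < \<infinity>"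
        using funpow_act_one_le[OF sub, of k s'] by (rule order_le_less_trans) simp
      then show "(\<lambda>m. L m s s' * (act (L m) ^^ k) (\<lambda>_. 1) s') \<longlonglongrightarrow> H s s' * (act H ^^ k) (\<lambda>_. 1) s'"
        using fin[of s s'] by (intro tendsto_mult_ennreal L_lim Suc) auto
    qed auto
    then show ?case by (simp flip: act_def)
  qed simp
  then show ?thesis
  proof (rule LIMSEQ_le_const2)
    show "\<exists>N. \<forall>m\<ge>N. (act (L m) ^^ n) (\<lambda>_. 1) s \<le> C"
      by (intro exI[of _ 0] allI impI order.trans[OF funpow_act_mono le])
         (auto simp: L_def intro: INF_lower)
  qed
qed

text \<open>
  For \<open>p = Q\<close> and \<open>r s = - Q s s\<close> this is the embedded jump chain. For \<open>r s = \<lambda> - Q s s\<close> it is the jump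
  chain killed at rate \<open>\<lambda>\<close>, and its \<open>n\<close>-th power applied to \<open>1\<close> is the Laplace transform at \<open>\<lambda>\<close> of the
  \<open>n\<close>-th jump time.
\<close>

definition jump_kernel :: "'a set \<Rightarrow> ('a \<Rightarrow> 'a \<Rightarrow> real) \<Rightarrow> ('a \<Rightarrow> real) \<Rightarrow> 'a \<Rightarrow> 'a \<Rightarrow> ennreal" where
  "jump_kernel F p r s s' = (if s \<in> F \<and> s' \<in> F \<and> s \<noteq> s' then ennreal (p s s' / r s) else 0)"

lemma act_jump_kernel_one:
  assumes "s \<in> F" "\<And>s'. s' \<in> F \<Longrightarrow> s \<noteq> s' \<Longrightarrow> 0 \<le> p s s'" "((p s) has_sum x) F" "r s > 0"
  shows "act (jump_kernel F p r) (\<lambda>_. 1) s = ennreal ((x - p s s) / r s)"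
proof -
  have "(p s has_sum (x - p s s)) (F - {s})"
    using has_sum_Diff[OF assms(3) has_sum_finite[of "{s}" "p s"]] assms(1) by simp
  then have "((\<lambda>s'. p s s' / r s) has_sum ((x - p s s) / r s)) (F - {s})"
    unfolding divide_inverse by (rule has_sum_cmult_left)
  moreover have "0 \<le> p s s' / r s" if "s' \<in> F - {s}" for s'
    using assms(2)[of s'] assms(4) that by auto
  ultimately have "(\<integral>\<^sup>+s'. (if s' \<in> F - {s} then ennreal (p s s' / r s) else 0) \<partial>count_space UNIV) =
      ennreal ((x - p s s) / r s)"
    by (intro nn_integral_count_space_has_sum) auto
  also have "(\<integral>\<^sup>+s'. (if s' \<in> F - {s} then ennreal (p s s' / r s) else 0) \<partial>count_space UNIV) =
      act (jump_kernel F p r) (\<lambda>_. 1) s"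
    unfolding act_def jump_kernel_def using assms(1) by (intro nn_integral_cong) auto
  finally show ?thesis .
qed

section \<open>Changes of a discrete skeleton of the chain\<close>

text \<open>
  The probability that a discrete chain with kernel \<open>p\<close> changes its state at least \<open>n\<close> times within
  \<open>k\<close> steps.
\<close>

fun change_prob :: "'a set \<Rightarrow> ('a \<Rightarrow> 'a \<Rightarrow> real) \<Rightarrow> nat \<Rightarrow> nat \<Rightarrow> 'a \<Rightarrow> ennreal" where
  "change_prob F p k 0 s = 1"
| "change_prob F p 0 (Suc n) s = 0"
| "change_prob F p (Suc k) (Suc n) s = ennreal (p s s) * change_prob F p k (Suc n) s +
     act (jump_kernel F p (\<lambda>_. 1)) (change_prob F p k n) s"

text \<open>
  The left-hand side is the probability that the chain with kernel \<open>p\<close>, surviving each step with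
  probability \<open>1 / (1 + \<mu>)\<close>, changes \<open>n\<close> times before it is killed. Either the \<open>n\<close> changes occur within
  the first \<open>k\<close> steps or the chain survives \<open>k\<close> steps.
\<close>

lemma killed_skeleton_le:
  assumes nonneg: "\<And>s s'. s \<in> F \<Longrightarrow> s' \<in> F \<Longrightarrow> 0 \<le> p s s'"
    and sum: "\<And>s. s \<in> F \<Longrightarrow> (p s has_sum 1) F" and \<mu>: "\<mu> > 0" and s: "s \<in> F"
  shows "(act (jump_kernel F p (\<lambda>s. \<mu> + 1 - p s s)) ^^ n) (\<lambda>_. 1) s
           \<le> change_prob F p k n s + ennreal ((1 / (1 + \<mu>)) ^ k)"
  using s
proof (induction k arbitrary: n s)
  case (0 n s)
  let ?r = "\<lambda>s. \<mu> + 1 - p s s"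
  have one: "act (jump_kernel F p ?r) (\<lambda>_. 1) s \<le> 1" for s
  proof (cases "s \<in> F")
    case True
    have "p s s \<le> 1"
      using has_sum_mono_neutral[OF has_sum_finite[of "{s}" "p s"] sum[OF True]] nonneg True by auto
    then show ?thesis
      using True \<mu> by (subst act_jump_kernel_one[OF _ _ sum]) (auto simp: nonneg)
  qed (simp add: act_def jump_kernel_def)
  show ?case using funpow_act_one_le[of "jump_kernel F p ?r" n s, OF one] by (cases n) (auto intro: add_increasing)
next
  case (Suc k n s)
  let ?r = "\<lambda>s. \<mu> + 1 - p s s" and ?q = "1 / (1 + \<mu>)"
  let ?K = "jump_kernel F p ?r" and ?O = "jump_kernel F p (\<lambda>_. 1)"
  show ?case
  proof (cases n)
    case 0 then show ?thesis by (auto intro: add_increasing2)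
  next
    case (Suc m)
    have p0: "0 \<le> p s s" and p1: "p s s \<le> 1"
      using has_sum_mono_neutral[OF has_sum_finite[of "{s}" "p s"] sum[OF Suc.prems]] nonneg Suc.prems
      by auto
    define y where "y = (act ?K ^^ m) (\<lambda>_. 1)"
    define B where "B = act ?K y s"
    have B: "B = ennreal (1 / ?r s) * act ?O y s"
      unfolding B_def act_def jump_kernel_def using p1 \<mu> Suc.prems nonneg
      by (subst nn_integral_cmult[symmetric])
         (auto intro!: nn_integral_cong simp flip: ennreal_mult mult.assoc)
    have "ennreal (1 + \<mu>) * B = ennreal (p s s) * B + ennreal (?r s) * B"
      using p0 p1 \<mu> by (simp add: add.commute flip: distrib_right ennreal_plus)
    also have "ennreal (?r s) * B = act ?O y s"
      unfolding B using p1 \<mu> by (simp flip: mult.assoc ennreal_mult)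
    also have "ennreal (p s s) * B \<le> ennreal (p s s) * (change_prob F p k n s + ennreal (?q ^ k))"
      using Suc.IH[OF Suc.prems, of n] by (intro mult_left_mono) (auto simp: B_def y_def Suc)
    also have "act ?O y s \<le> act ?O (\<lambda>s'. change_prob F p k m s' + ennreal (?q ^ k)) s"
      unfolding act_def
      by (intro nn_integral_mono) (auto simp: jump_kernel_def y_def intro!: mult_left_mono Suc.IH)
    also have "\<dots> = act ?O (change_prob F p k m) s + ennreal (?q ^ k) * act ?O (\<lambda>_. 1) s"
      by (simp add: act_add flip: act_cmult)
    also have "act ?O (\<lambda>_. 1) s = ennreal (1 - p s s)"
      using Suc.prems by (subst act_jump_kernel_one[OF _ _ sum]) (auto simp: nonneg)
    also have "ennreal (p s s) * (change_prob F p k n s + ennreal (?q ^ k)) +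
        (act ?O (change_prob F p k m) s + ennreal (?q ^ k) * ennreal (1 - p s s)) =
        change_prob F p (Suc k) n s + (ennreal (p s s) * ennreal (?q ^ k) + ennreal (?q ^ k) * ennreal (1 - p s s))"
      by (simp add: Suc algebra_simps)
    also have "ennreal (p s s) * ennreal (?q ^ k) + ennreal (?q ^ k) * ennreal (1 - p s s) = ennreal (?q ^ k)"
      using p0 p1 \<mu> by (simp add: algebra_simps flip: ennreal_mult ennreal_plus)
    finally have le: "ennreal (1 + \<mu>) * B \<le> change_prob F p (Suc k) n s + ennreal (?q ^ k)"
      by (simp add: add_mono)
    have "B = ennreal ?q * (ennreal (1 + \<mu>) * B)"
      using \<mu> by (simp del: ennreal_plus flip: mult.assoc ennreal_mult)
    also have "\<dots> \<le> ennreal ?q * (change_prob F p (Suc k) n s + ennreal (?q ^ k))"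
      by (intro mult_left_mono le) simp
    also have "\<dots> = ennreal ?q * change_prob F p (Suc k) n s + ennreal (?q ^ Suc k)"
      using \<mu> by (simp add: distrib_left flip: ennreal_mult)
    also have "\<dots> \<le> 1 * change_prob F p (Suc k) n s + ennreal (?q ^ Suc k)"
      using \<mu> by (intro add_right_mono mult_right_mono) auto
    finally show ?thesis by (simp add: B_def y_def Suc)
  qed
qed

definition past :: "'w measure \<Rightarrow> (real \<Rightarrow> 'w \<Rightarrow> 's) \<Rightarrow> (real \<times> 's) set \<Rightarrow> real \<Rightarrow> 's \<Rightarrow> 'w set" where
  "past M Z A t s = {w \<in> space M. (\<forall>(r, x)\<in>A. Z r w = x) \<and> Z t w = s}"

primrec changes :: "(real \<Rightarrow> 'w \<Rightarrow> 's) \<Rightarrow> real \<Rightarrow> nat \<Rightarrow> real \<Rightarrow> 'w \<Rightarrow> nat" where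
  "changes Z \<delta> 0 t w = 0"
| "changes Z \<delta> (Suc k) t w = of_bool (Z (t + \<delta>) w \<noteq> Z t w) + changes Z \<delta> k (t + \<delta>) w"

context
  fixes F :: "state set" and P :: "real \<Rightarrow> matrix" and M :: "'w measure" and Z :: "real \<Rightarrow> 'w \<Rightarrow> state"
  assumes mc: "markov_chain F P M Z"
begin

interpretation prob_space M using mc by (simp add: markov_chain_def)

lemma Z_measurable: "0 \<le> t \<Longrightarrow> Z t \<in> M \<rightarrow>\<^sub>M count_space UNIV"
  by (rule measurable_compose[of "Z t" M "count_space F" "\<lambda>x. x"])
    (use mc in \<open>auto simp only: markov_chain_def measurable_count_space_eq1 space_count_space\<close>)

lemma sets_past:
  assumes "finite A" "\<forall>(r, x)\<in>A. 0 \<le> r" "0 \<le> t" shows "past M Z A t s \<in> sets M"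
proof -
  have *: "{w \<in> space M. Z r w = x} \<in> sets M" if "0 \<le> r" for r x
  proof -
    have [measurable]: "Z r \<in> M \<rightarrow>\<^sub>M count_space UNIV" using that by (rule Z_measurable)
    show ?thesis by measurable
  qed
  have "past M Z A t s = {w \<in> space M. Z t w = s} \<inter> {w \<in> space M. \<forall>a\<in>A. Z (fst a) w = snd a}"
    by (auto simp: past_def)
  moreover have "{w \<in> space M. \<forall>a\<in>A. Z (fst a) w = snd a} \<in> sets M"
  proof (rule sets.sets_Collect_finite_All[OF _ assms(1)])
    fix a assume "a \<in> A"
    then show "{w \<in> space M. Z (fst a) w = snd a} \<in> sets M" using assms(2) by (intro *) auto
  qed
  ultimately show ?thesis using *[OF assms(3)] by (simp add: sets.Int)
qed

lemma emeasure_past_step: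
  assumes A: "finite A" "\<forall>(r, x)\<in>A. 0 \<le> r \<and> r < t" and t: "0 \<le> t" "0 < \<delta>" and s: "s \<in> F" "s' \<in> F"
  shows "emeasure M (past M Z (insert (t, s) A) (t + \<delta>) s') = emeasure M (past M Z A t s) * ennreal (P \<delta> s s')"
proof (cases "prob (past M Z A t s) = 0")
  case True
  have "past M Z (insert (t, s) A) (t + \<delta>) s' \<subseteq> past M Z A t s" by (auto simp: past_def)
  moreover have "past M Z A t s \<in> sets M" using A t by (intro sets_past) auto
  ultimately have "prob (past M Z (insert (t, s) A) (t + \<delta>) s') \<le> 0"
    unfolding True[symmetric] by (rule finite_measure_mono)
  then show ?thesis using True by (simp add: emeasure_eq_measure measure_le_0_iff)
next
  case False
  then have pos: "prob (past M Z A t s) > 0" by (simp add: zero_less_measure_iff)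
  have eq: "{w \<in> space M. Z (t + \<delta>) w = s' \<and> (\<forall>(r, x)\<in>A. Z r w = x) \<and> Z t w = s} = past M Z (insert (t, s) A) (t + \<delta>) s'"
    by (auto simp: past_def)
  have "\<P>(w in M. Z (t + \<delta>) w = s' \<bar> (\<forall>(r, x)\<in>A. Z r w = x) \<and> Z t w = s) = P \<delta> s s'"
    using A t s pos
      mc[unfolded markov_chain_def, THEN conjunct2, THEN conjunct2, THEN conjunct2, THEN spec[of _ A],
        THEN spec[of _ t], THEN spec[of _ \<delta>], THEN spec[of _ s], THEN spec[of _ s']]
    unfolding past_def by simp
  then have "prob (past M Z (insert (t, s) A) (t + \<delta>) s') = prob (past M Z A t s) * P \<delta> s s'"
    using pos unfolding cond_prob_def eq by (simp add: past_def[symmetric] field_simps)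
  moreover have "0 \<le> P \<delta> s s'"
    using mc t s by (auto simp: markov_chain_def transition_matrix_function_def)
  ultimately show ?thesis by (simp add: emeasure_eq_measure ennreal_mult)
qed

lemma measurable_changes:
  "0 \<le> t \<Longrightarrow> 0 < \<delta> \<Longrightarrow> changes Z \<delta> k t \<in> M \<rightarrow>\<^sub>M count_space UNIV"
proof (induction k arbitrary: t)
  case (Suc k)
  have [measurable]: "Z t \<in> M \<rightarrow>\<^sub>M count_space UNIV" "Z (t + \<delta>) \<in> M \<rightarrow>\<^sub>M count_space UNIV"
    "changes Z \<delta> k (t + \<delta>) \<in> M \<rightarrow>\<^sub>M count_space UNIV"
    using Suc by (auto intro!: Z_measurable)
  show ?case unfolding changes.simps by measurable
next
  case 0
  have "changes Z \<delta> 0 t = (\<lambda>w. 0)" by (rule ext) simp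
  then show ?case by simp
qed

text \<open>
  Condition on the state at the next sampling time. The current state then becomes part of the past,
  which is why the induction runs over arbitrary finite pasts.
\<close>

lemma emeasure_changes_ge:
  assumes "finite A" "\<forall>(r, x)\<in>A. 0 \<le> r \<and> r < t" "0 \<le> t" "0 < \<delta>" "s \<in> F"
  shows "emeasure M (past M Z A t s) * change_prob F (P \<delta>) k n s
           \<le> emeasure M {w \<in> past M Z A t s. n \<le> changes Z \<delta> k t w}"
  using assms
proof (induction F\<equiv>F p\<equiv>"P \<delta>" k n s arbitrary: A t rule: change_prob.induct)
  case (3 k n s)
  let ?S = "\<lambda>s'. {w \<in> past M Z (insert (t, s) A) (t + \<delta>) s'. (if s' = s then Suc n else n) \<le> changes Z \<delta> k (t + \<delta>) w}"
  let ?cp = "\<lambda>s'. change_prob F (P \<delta>) k (if s' = s then Suc n else n) s'"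
  have A': "finite (insert (t, s) A)" "\<forall>(r, x)\<in>insert (t, s) A. 0 \<le> r \<and> r < t + \<delta>"
    using "3.prems" by auto
  have step: "emeasure M (past M Z A t s) * (if s' \<in> F then ennreal (P \<delta> s s') * ?cp s' else 0) \<le> emeasure M (?S s')" for s'
  proof (cases "s' \<in> F")
    case True
    have "emeasure M (past M Z (insert (t, s) A) (t + \<delta>) s') * ?cp s' \<le> emeasure M (?S s')"
    proof (cases "s' = s")
      case True
      have "emeasure M (past M Z (insert (t, s) A) (t + \<delta>) s) * change_prob F (P \<delta>) k (Suc n) s
          \<le> emeasure M {w \<in> past M Z (insert (t, s) A) (t + \<delta>) s. Suc n \<le> changes Z \<delta> k (t + \<delta>) w}"
        using "3.prems" by (intro "3.hyps"(1) A') auto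
      then show ?thesis by (simp only: True if_True refl)
    next
      case False
      have "emeasure M (past M Z (insert (t, s) A) (t + \<delta>) s') * change_prob F (P \<delta>) k n s'
          \<le> emeasure M {w \<in> past M Z (insert (t, s) A) (t + \<delta>) s'. n \<le> changes Z \<delta> k (t + \<delta>) w}"
        using "3.prems" True by (intro "3.hyps"(2) A') auto
      then show ?thesis by (simp only: False if_False)
    qed
    then show ?thesis
      using True "3.prems" by (simp add: emeasure_past_step mult.assoc)
  qed simp
  have dis: "disjoint_family ?S" by (auto simp: disjoint_family_on_def past_def)
  have meas: "?S s' \<in> sets M" for s'
  proof -
    have [measurable]: "past M Z (insert (t, s) A) (t + \<delta>) s' \<in> sets M"
      using A' "3.prems" by (intro sets_past) auto
    have [measurable]: "changes Z \<delta> k (t + \<delta>) \<in> M \<rightarrow>\<^sub>M count_space UNIV"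
      using "3.prems" by (intro measurable_changes) auto
    have "?S s' = past M Z (insert (t, s) A) (t + \<delta>) s' \<inter>
        {w \<in> space M. (if s' = s then Suc n else n) \<le> changes Z \<delta> k (t + \<delta>) w}"
      by (auto simp: past_def)
    also have "\<dots> \<in> sets M" by measurable
    finally show ?thesis .
  qed
  have "change_prob F (P \<delta>) (Suc k) (Suc n) s =
      (\<integral>\<^sup>+s'. (if s' = s then ennreal (P \<delta> s s') * ?cp s' else 0) +
        (if s' \<in> F \<and> s' \<noteq> s then ennreal (P \<delta> s s') * ?cp s' else 0) \<partial>count_space UNIV)"
  proof -
    have "(\<integral>\<^sup>+s'. (if s' = s then ennreal (P \<delta> s s') * ?cp s' else 0) \<partial>count_space UNIV) =
        (\<integral>\<^sup>+s'. (ennreal (P \<delta> s s) * change_prob F (P \<delta>) k (Suc n) s) * indicator {s} s' \<partial>count_space UNIV)"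
      by (intro nn_integral_cong) (auto simp: indicator_def)
    also have "\<dots> = ennreal (P \<delta> s s) * change_prob F (P \<delta>) k (Suc n) s"
      by (subst nn_integral_cmult_indicator) auto
    finally have 1: "(\<integral>\<^sup>+s'. (if s' = s then ennreal (P \<delta> s s') * ?cp s' else 0) \<partial>count_space UNIV) =
      ennreal (P \<delta> s s) * change_prob F (P \<delta>) k (Suc n) s" .
    have 2: "(\<integral>\<^sup>+s'. (if s' \<in> F \<and> s' \<noteq> s then ennreal (P \<delta> s s') * ?cp s' else 0) \<partial>count_space UNIV) =
      act (jump_kernel F (P \<delta>) (\<lambda>_. 1)) (change_prob F (P \<delta>) k n) s"
      unfolding act_def jump_kernel_def using "3.prems" by (intro nn_integral_cong) auto
    show ?thesis by (subst nn_integral_add) (simp_all only: 1 2 change_prob.simps borel_measurable_count_space)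
  qed
  also have "\<dots> = (\<integral>\<^sup>+s'. (if s' \<in> F then ennreal (P \<delta> s s') * ?cp s' else 0) \<partial>count_space UNIV)"
    using "3.prems" by (intro nn_integral_cong) auto
  finally have "emeasure M (past M Z A t s) * change_prob F (P \<delta>) (Suc k) (Suc n) s =
      (\<integral>\<^sup>+s'. emeasure M (past M Z A t s) * (if s' \<in> F then ennreal (P \<delta> s s') * ?cp s' else 0) \<partial>count_space UNIV)"
    by (simp add: nn_integral_cmult)
  also have "\<dots> \<le> (\<integral>\<^sup>+s'. emeasure M (?S s') \<partial>count_space UNIV)"
    by (intro nn_integral_mono step)
  also have "\<dots> = emeasure M (\<Union>s'. ?S s')"
    by (rule emeasure_UN_countable[symmetric]) (simp_all only: dis meas countableI_type)
  also have "(\<Union>s'. ?S s') = {w \<in> past M Z A t s. Suc n \<le> changes Z \<delta> (Suc k) t w}"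
    by (auto simp: past_def split: if_splits)
  finally show ?case .
qed auto

end

section \<open>Regular paths exclude explosion\<close>

text \<open>
  If two consecutive samples differ, the path has a discontinuity between them, since a locally
  constant function on an interval is constant. At the left end point right-continuity suffices, so
  the discontinuity may be sought in a half-open interval, and these intervals are disjoint.
\<close>

lemma changes_le_card_discontinuities:
  fixes Z :: "real \<Rightarrow> 'w \<Rightarrow> state"
  defines "disc \<equiv> \<lambda>w. {t. \<not> (\<forall>\<^sub>F u in at t within {0..}. Z u w = Z t w)}"
  assumes right: "\<forall>t\<ge>0. \<forall>\<^sub>F u in at_right t. Z u w = Z t w"
    and fin: "\<forall>a\<ge>0. finite {t \<in> {0..a}. \<not> (\<forall>\<^sub>F u in at t within {0..}. Z u w = Z t w)}"
    and "0 \<le> t" "0 < \<delta>"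
  shows "changes Z \<delta> k t w \<le> card ({t<..t + real k * \<delta>} \<inter> disc w)"
  using \<open>0 \<le> t\<close>
proof (induction k arbitrary: t)
  case (Suc k)
  have fin': "finite ({a<..b} \<inter> disc w)" if "0 \<le> a" for a b
  proof (cases "b \<ge> 0")
    case True
    have "{a<..b} \<inter> disc w \<subseteq> {t \<in> {0..b}. \<not> (\<forall>\<^sub>F u in at t within {0..}. Z u w = Z t w)}"
      using that by (auto simp: disc_def)
    then show ?thesis using fin True finite_subset by blast
  qed (use that in auto)
  have first: "of_bool (Z (t + \<delta>) w \<noteq> Z t w) \<le> card ({t<..t + \<delta>} \<inter> disc w)"
  proof (cases "{t<..t + \<delta>} \<inter> disc w = {}")
    case True
    have "Z t w = Z (t + \<delta>) w"
    proof (rule connected_local_const[of "{t..t + \<delta>}" t "t + \<delta>" "\<lambda>u. Z u w"])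
      show "\<forall>a\<in>{t..t + \<delta>}. \<forall>\<^sub>F b in at a within {t..t + \<delta>}. Z a w = Z b w"
      proof
        fix a assume a: "a \<in> {t..t + \<delta>}"
        show "\<forall>\<^sub>F b in at a within {t..t + \<delta>}. Z a w = Z b w"
        proof (cases "a = t")
          case True
          have "\<forall>\<^sub>F u in at_right t. Z u w = Z t w" using right Suc.prems by blast
          then show ?thesis unfolding True eventually_at_filter by eventually_elim auto
        next
          case False
          then have "a \<in> {t<..t + \<delta>}" using a by auto
          then have "a \<notin> disc w" using True by blast
          then have "\<forall>\<^sub>F u in at a within {0..}. Z u w = Z a w" by (simp add: disc_def)
          then show ?thesis
            unfolding eventually_at_filter by eventually_elim (use Suc.prems in auto)
        qed
      qed
    qed (use \<open>0 < \<delta>\<close> in auto)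
    then show ?thesis by simp
  next
    case False
    then have "card ({t<..t + \<delta>} \<inter> disc w) \<noteq> 0" using fin'[OF Suc.prems] by simp
    then show ?thesis by auto
  qed
  have "changes Z \<delta> (Suc k) t w \<le> card ({t<..t + \<delta>} \<inter> disc w) + card ({t + \<delta><..t + \<delta> + real k * \<delta>} \<inter> disc w)"
    using first Suc.IH[of "t + \<delta>"] Suc.prems \<open>0 < \<delta>\<close> by simp
  also have "\<dots> = card (({t<..t + \<delta>} \<inter> disc w) \<union> ({t + \<delta><..t + \<delta> + real k * \<delta>} \<inter> disc w))"
    using Suc.prems \<open>0 < \<delta>\<close> by (intro card_Un_disjoint[symmetric] fin') auto
  also have "({t<..t + \<delta>} \<inter> disc w) \<union> ({t + \<delta><..t + \<delta> + real k * \<delta>} \<inter> disc w) =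
      {t<..t + real (Suc k) * \<delta>} \<inter> disc w"
  proof -
    define c where "c = real k * \<delta>"
    have "0 \<le> c" "real (Suc k) * \<delta> = \<delta> + c" using \<open>0 < \<delta>\<close> by (auto simp: c_def algebra_simps)
    then show ?thesis using \<open>0 < \<delta>\<close> unfolding c_def[symmetric] by auto
  qed
  finally show ?case .
qed simp

lemma conservative_diag:
  assumes "conservative_q_matrix F Q" "s \<in> F"
  shows "Q s s \<le> 0"
proof -
  have sum: "(Q s has_sum 0) F" using assms by (simp add: conservative_q_matrix_def)
  have "(Q s has_sum (0 - Q s s)) (F - {s})"
    using has_sum_Diff[OF sum has_sum_finite[of "{s}" "Q s"]] assms(2) by simp
  then have "0 \<le> 0 - Q s s"
    by (rule has_sum_nonneg) (use assms in \<open>auto simp: conservative_q_matrix_def\<close>)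
  then show ?thesis by simp
qed

lemma act_jump_kernel_sub_markov:
  assumes "conservative_q_matrix F Q" "lam > 0"
  shows "act (jump_kernel F Q (\<lambda>s. lam - Q s s)) (\<lambda>_. 1) s \<le> 1"
proof (cases "s \<in> F")
  case True
  have "act (jump_kernel F Q (\<lambda>s. lam - Q s s)) (\<lambda>_. 1) s = ennreal ((0 - Q s s) / (lam - Q s s))"
    by (rule act_jump_kernel_one)
      (use True assms conservative_diag[OF assms(1) True] in \<open>auto simp: conservative_q_matrix_def\<close>)
  also have "(0 - Q s s) / (lam - Q s s) \<le> 1"
    using conservative_diag[OF assms(1) True] assms(2) by (subst divide_le_eq_1_pos) auto
  finally show ?thesis by (simp add: ennreal_leI)
qed (simp add: act_def jump_kernel_def)

text \<open>
  With killing parameter \<open>\<lambda> h\<close> for the step \<open>h\<close>, dividing numerator and denominator by \<open>h\<close> turns both into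
  difference quotients of the transition function at \<open>0\<close>.
\<close>

lemma skeleton_kernel_tendsto:
  assumes "infinitesimal_generator F P Q" "conservative_q_matrix F Q" "lam > 0"
    and h: "filterlim h (at_right 0) sequentially"
  shows "(\<lambda>m. jump_kernel F (P (h m)) (\<lambda>s. lam * h m + 1 - P (h m) s s) s s')
           \<longlonglongrightarrow> jump_kernel F Q (\<lambda>s. lam - Q s s) s s'"
proof (cases "s \<in> F \<and> s' \<in> F \<and> s \<noteq> s'")
  case True
  have lim: "(\<lambda>m. (P (h m) s u - of_bool (s = u)) / h m) \<longlonglongrightarrow> Q s u" if "u \<in> F" for u
    using filterlim_compose[OF _ h] assms(1) True that unfolding infinitesimal_generator_def by fast
  have "Q s s \<le> 0" using conservative_diag assms(2) True by blast
  have "(\<lambda>m. (P (h m) s s' / h m) / (lam - (P (h m) s s - 1) / h m)) \<longlonglongrightarrow> Q s s' / (lam - Q s s)"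
    using lim[of s'] lim[of s] True \<open>Q s s \<le> 0\<close> \<open>lam > 0\<close> by (intro tendsto_intros) auto
  moreover have "\<forall>\<^sub>F m in sequentially. (P (h m) s s' / h m) / (lam - (P (h m) s s - 1) / h m) =
      P (h m) s s' / (lam * h m + 1 - P (h m) s s)"
  proof -
    have "\<forall>\<^sub>F m in sequentially. h m > 0"
      using h by (auto simp: filterlim_at elim: eventually_mono)
    then show ?thesis
      by eventually_elim (simp add: divide_simps algebra_simps)
  qed
  ultimately have "(\<lambda>m. P (h m) s s' / (lam * h m + 1 - P (h m) s s)) \<longlonglongrightarrow> Q s s' / (lam - Q s s)"
    by (rule Lim_transform_eventually)
  then show ?thesis using True by (simp add: jump_kernel_def tendsto_ennrealI)
qed (auto simp: jump_kernel_def)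

text \<open>
  The Laplace transform of the \<open>n\<close>-th jump time becomes small, i.e. the jump times tend to infinity.
  For a regular path the number of changes on a grid is bounded by the number of discontinuities,
  whatever the mesh; hence for large \<open>n\<close> it is unlikely that some grid shows \<open>n\<close> changes. This bounds the
  killed skeletons uniformly in the mesh, and the bound passes to the jump chain in the limit.
\<close>

lemma no_explosion:
  assumes mc: "markov_chain F P M Z" and reg: "regular_jump M Z"
    and gen: "infinitesimal_generator F P Q" "conservative_q_matrix F Q"
    and s: "s \<in> F" and u: "0 \<le> u" "\<P>(w in M. Z u w = s) > 0"
    and "lam > 0" "\<epsilon> > 0"
  shows "\<exists>n. (act (jump_kernel F Q (\<lambda>s. lam - Q s s)) ^^ n) (\<lambda>_. 1) s \<le> ennreal \<epsilon>"
proof -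
  interpret prob_space M using mc by (simp add: markov_chain_def)
  \<comment> \<open>killing at rate \<open>lam\<close> is survived up to time \<open>T\<close> with probability at most \<open>1 / (1 + lam T) \<le> \<epsilon> / 2\<close>\<close>
  define T where "T = 2 / (\<epsilon> * lam)"
  have T: "T > 0" "1 / (1 + lam * T) \<le> \<epsilon> / 2"
    using \<open>lam > 0\<close> \<open>\<epsilon> > 0\<close> by (auto simp: T_def field_simps)
  define \<delta> where "\<delta> m = T / real (Suc m)" for m
  have \<delta>: "\<delta> m > 0" "real (Suc m) * \<delta> m = T" for m using T by (auto simp: \<delta>_def)
  \<comment> \<open>the paths that show at least \<open>n\<close> changes on some grid; these events decrease to a null set\<close>
  define G where "G n = {w \<in> space M. Z u w = s \<and> (\<exists>m. n \<le> changes Z (\<delta> m) (Suc m) u w)}" for n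
  have [measurable]: "Z u \<in> M \<rightarrow>\<^sub>M count_space UNIV" using Z_measurable[OF mc u(1)] .
  have [measurable]: "changes Z (\<delta> m) k u \<in> M \<rightarrow>\<^sub>M count_space UNIV" for m k
    using measurable_changes[OF mc u(1) \<delta>(1)] .
  have G_sets: "G n \<in> sets M" for n
    unfolding G_def by measurable
  have ae: "AE w in M. w \<notin> (\<Inter>n. G n)"
    using reg unfolding regular_jump_def
  proof eventually_elim
    case (elim w)
    define d where "d = card ({u<..u + T} \<inter> {t. \<not> (\<forall>\<^sub>F u in at t within {0..}. Z u w = Z t w)})"
    have "changes Z (\<delta> m) (Suc m) u w \<le> d" for m
      using changes_le_card_discontinuities[of Z w u "\<delta> m" "Suc m"] elim u(1) \<delta>[of m]
      unfolding d_def by (simp del: of_nat_Suc changes.simps)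
    then have "w \<notin> G (Suc d)" by (auto simp: G_def not_le less_Suc_eq_le simp del: changes.simps)
    then show ?case by blast
  qed
  have inter: "(\<Inter>n. G n) \<in> sets M" using G_sets by auto
  have "{w \<in> space M. \<not> w \<notin> (\<Inter>n. G n)} = (\<Inter>n. G n)"
    using sets.sets_into_space[OF G_sets] by auto
  from AE_iff_measurable[OF inter this] ae have "emeasure M (\<Inter>n. G n) = 0" by (rule iffD1)
  then have "measure M (\<Inter>n. G n) = 0" by (simp add: measure_def)
  moreover have "(\<lambda>n. measure M (G n)) \<longlonglongrightarrow> measure M (\<Inter>n. G n)"
    using G_sets by (intro finite_Lim_measure_decseq)
      (auto simp: decseq_def G_def simp del: changes.simps intro: order.trans)
  ultimately have "(\<lambda>n. measure M (G n)) \<longlonglongrightarrow> 0" by simp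
  moreover define p where "p = \<P>(w in M. Z u w = s)"
  have "p > 0" using u by (simp add: p_def)
  ultimately have "\<forall>\<^sub>F n in sequentially. measure M (G n) < p * (\<epsilon> / 2)"
    using \<open>\<epsilon> > 0\<close> by (intro order_tendstoD) auto
  then obtain n where n: "measure M (G n) < p * (\<epsilon> / 2)"
    by (auto simp: eventually_sequentially)
  have P0: "0 \<le> P (\<delta> m) s s'" "(P (\<delta> m) s has_sum 1) F" if "s \<in> F" "s' \<in> F" for m s s'
    using mc that \<delta>(1)[of m] by (auto simp: markov_chain_def transition_matrix_function_def)
  define K where "K m = jump_kernel F (P (\<delta> m)) (\<lambda>s. lam * \<delta> m + 1 - P (\<delta> m) s s)" for m
  have past_eq: "past M Z {} u s = {w \<in> space M. Z u w = s}" by (auto simp: past_def)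
  have le: "(act (K m) ^^ n) (\<lambda>_. 1) s \<le> ennreal \<epsilon>" for m
  proof -
    have "ennreal p * change_prob F (P (\<delta> m)) (Suc m) n s
        \<le> emeasure M {w \<in> past M Z {} u s. n \<le> changes Z (\<delta> m) (Suc m) u w}"
      using emeasure_changes_ge[OF mc, of "{}" u "\<delta> m" s "Suc m" n] u(1) s \<delta>(1)[of m]
      unfolding emeasure_eq_measure past_eq p_def
      by (simp del: changes.simps change_prob.simps)
    also have "\<dots> \<le> emeasure M (G n)"
      using G_sets by (intro emeasure_mono) (auto simp: G_def past_def simp del: changes.simps)
    also have "\<dots> \<le> ennreal p * ennreal (\<epsilon> / 2)"
      using n \<open>p > 0\<close> \<open>\<epsilon> > 0\<close> by (simp add: emeasure_eq_measure flip: ennreal_mult)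
    finally have 1: "change_prob F (P (\<delta> m)) (Suc m) n s \<le> ennreal (\<epsilon> / 2)"
      using \<open>p > 0\<close> by (subst (asm) ennreal_mult_le_mult_iff) auto
    have "(act (K m) ^^ n) (\<lambda>_. 1) s \<le> change_prob F (P (\<delta> m)) (Suc m) n s +
        ennreal ((1 / (1 + lam * \<delta> m)) ^ Suc m)"
      unfolding K_def by (rule killed_skeleton_le) (use P0 s \<delta>(1)[of m] \<open>lam > 0\<close> in auto)
    also have "(1 / (1 + lam * \<delta> m)) ^ Suc m \<le> 1 / (1 + lam * T)"
    proof -
      have "1 + real (Suc m) * (lam * \<delta> m) \<le> (1 + lam * \<delta> m) ^ Suc m"
        by (rule Bernoulli_inequality) (use \<delta>(1)[of m] \<open>lam > 0\<close> in \<open>simp add: order.trans[of _ 0]\<close>)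
      also have "real (Suc m) * (lam * \<delta> m) = lam * T" using \<delta>(2)[of m] by (simp only: mult_ac)
      finally show ?thesis
        using \<open>lam > 0\<close> T(1) \<delta>(1)[of m]
        by (simp only: power_divide power_one) (intro divide_left_mono mult_pos_pos add_pos_pos zero_less_power; simp)
    qed
    also have "change_prob F (P (\<delta> m)) (Suc m) n s + ennreal (1 / (1 + lam * T)) \<le>
        ennreal (\<epsilon> / 2) + ennreal (\<epsilon> / 2)"
      by (intro add_mono 1 ennreal_leI T)
    also have "\<dots> = ennreal \<epsilon>"
      using \<open>\<epsilon> > 0\<close> by (simp flip: ennreal_plus)
    finally show ?thesis by (simp add: add_left_mono ennreal_leI)
  qed
  have "(act (jump_kernel F Q (\<lambda>s. lam - Q s s)) ^^ n) (\<lambda>_. 1) s \<le> ennreal \<epsilon>"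
  proof (rule funpow_act_limit_le[where K = K])
    have "filterlim (\<lambda>m. real (Suc m)) at_top sequentially"
      by (rule filterlim_compose[OF filterlim_real_sequentially filterlim_Suc])
    then have "\<delta> \<longlonglongrightarrow> 0"
      unfolding \<delta>_def by (rule real_tendsto_divide_at_top[OF tendsto_const])
    then have "filterlim \<delta> (at_right 0) sequentially"
      using \<delta>(1) by (simp add: filterlim_at less_imp_neq[THEN not_sym] eventually_sequentially)
    then show "(\<lambda>m. K m s s') \<longlonglongrightarrow> jump_kernel F Q (\<lambda>s. lam - Q s s) s s'" for s s'
      unfolding K_def by (rule skeleton_kernel_tendsto[OF gen \<open>lam > 0\<close>])
  qed (use le in \<open>auto simp: jump_kernel_def intro!: act_jump_kernel_sub_markov gen \<open>lam > 0\<close>\<close>)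
  then show ?thesis ..
qed

section \<open>Finite closed sets are absorbing\<close>

lemma partial_row_nonpos:
  assumes Q: "conservative_q_matrix F Q" and A: "finite A" "A \<subseteq> F" "s \<in> A"
  shows "(\<Sum>u\<in>A. Q s u) \<le> 0"
proof (rule has_sum_mono_neutral[OF has_sum_finite[OF A(1)]])
  show "(Q s has_sum 0) F" using Q A by (auto simp: conservative_q_matrix_def)
  show "0 \<le> Q s u" if "u \<in> F - A" for u
    using Q A that by (auto simp: conservative_q_matrix_def)
qed (use A in auto)

text \<open>
  If the entries of a row inside \<open>A\<close> already add up to the total \<open>0\<close>, nothing is left for the nonnegative
  entries outside.
\<close>

lemma full_row_closed:
  assumes Q: "conservative_q_matrix F Q" and A: "finite A" "A \<subseteq> F" "s \<in> A"
    and "(\<Sum>u\<in>A. Q s u) = 0" "s' \<in> F - A"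
  shows "Q s s' = 0"
proof -
  have "(\<Sum>u\<in>insert s' A. Q s u) \<le> 0"
    by (rule partial_row_nonpos[OF Q]) (use assms in auto)
  moreover have "0 \<le> Q s s'"
    using Q assms(3,4,6) by (auto simp: conservative_q_matrix_def)
  ultimately show ?thesis using A(1) assms(5,6) by auto
qed

text \<open>
  The mass \<open>\<phi> h\<close> found outside \<open>A\<close> at time \<open>h\<close>, summed over the starting points in \<open>A\<close>, is \<open>o(h)\<close>, because
  the rows of the generator restricted to \<open>A\<close> add up to \<open>0\<close>. The loss up to time \<open>t\<close> is at most \<open>m\<close> times the
  loss up to time \<open>t / m\<close>, hence zero.
\<close>

lemma finite_closed_set_absorbing:
  assumes P: "transition_matrix_function F P" and gen: "infinitesimal_generator F P Q"
    and Q: "conservative_q_matrix F Q" and A: "finite A" "A \<subseteq> F"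
    and closed: "\<And>s s'. s \<in> A \<Longrightarrow> s' \<in> F - A \<Longrightarrow> Q s s' = 0"
    and s: "s \<in> A" "s' \<in> F - A" and t: "t > 0"
  shows "P t s s' = 0"
proof -
  have nonneg: "0 \<le> P h u u'" if "0 \<le> h" "u \<in> F" "u' \<in> F" for h u u'
    using P that by (simp add: transition_matrix_function_def)
  have sum_le: "(\<Sum>u'\<in>B. P h u u') \<le> 1" if "0 \<le> h" "u \<in> F" "finite B" "B \<subseteq> F" for h u B
  proof (rule has_sum_mono_neutral[OF has_sum_finite[OF that(3)]])
    show "(P h u has_sum 1) F" using P that by (simp add: transition_matrix_function_def)
  qed (use that nonneg in auto)
  define \<phi> where "\<phi> h = (\<Sum>u\<in>A. 1 - (\<Sum>u'\<in>A. P h u u'))" for h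
  have \<phi>0: "0 \<le> \<phi> h" if "0 \<le> h" for h
    unfolding \<phi>_def using A sum_le[OF that] by (intro sum_nonneg) auto
  have \<phi>_ge: "1 - (\<Sum>u'\<in>A. P h u u') \<le> \<phi> h" if "0 \<le> h" "u \<in> A" for h u
    unfolding \<phi>_def using A sum_le[OF that(1)] that by (intro member_le_sum) auto
  have step: "1 - (\<Sum>u'\<in>A. P (a + h) u u') \<le> 1 - (\<Sum>u'\<in>A. P a u u') + \<phi> h"
    if "0 \<le> a" "0 \<le> h" "u \<in> A" for a h u
  proof -
    have "(\<Sum>x\<in>A. P a u x * P h x u') \<le> P (a + h) u u'" if "u' \<in> A" for u'
    proof -
      have nn: "0 \<le> P a u x * P h x u'" if "x \<in> F" for x
        using subsetD[OF A(2)] \<open>u' \<in> A\<close> that \<open>0 \<le> a\<close> \<open>0 \<le> h\<close> \<open>u \<in> A\<close>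
        by (intro mult_nonneg_nonneg nonneg) blast+
      show ?thesis
      proof (rule has_sum_mono_neutral[OF has_sum_finite[OF A(1)]])
        show "((\<lambda>x. P a u x * P h x u') has_sum P (a + h) u u') F"
          using P[unfolded transition_matrix_function_def] A that \<open>0 \<le> a\<close> \<open>0 \<le> h\<close> \<open>u \<in> A\<close> by blast
      qed (use A nn in auto)
    qed
    then have "(\<Sum>u'\<in>A. \<Sum>x\<in>A. P a u x * P h x u') \<le> (\<Sum>u'\<in>A. P (a + h) u u')"
      by (rule sum_mono)
    also have "(\<Sum>u'\<in>A. \<Sum>x\<in>A. P a u x * P h x u') = (\<Sum>x\<in>A. P a u x * (\<Sum>u'\<in>A. P h x u'))"
      by (subst sum.swap) (simp add: sum_distrib_left)
    finally have 1: "(\<Sum>x\<in>A. P a u x * (\<Sum>u'\<in>A. P h x u')) \<le> (\<Sum>u'\<in>A. P (a + h) u u')" .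
    have "(\<Sum>x\<in>A. P a u x) - \<phi> h \<le> (\<Sum>x\<in>A. P a u x) - (\<Sum>x\<in>A. P a u x) * \<phi> h"
      using mult_right_mono[OF sum_le[of a u A] \<phi>0[of h]] that A by auto
    also have "\<dots> = (\<Sum>x\<in>A. P a u x * (1 - \<phi> h))"
      by (simp add: algebra_simps sum_subtractf sum_distrib_left sum_distrib_right)
    also have "\<dots> \<le> (\<Sum>x\<in>A. P a u x * (\<Sum>u'\<in>A. P h x u'))"
    proof (intro sum_mono mult_left_mono)
      fix x assume "x \<in> A"
      then show "1 - \<phi> h \<le> (\<Sum>u'\<in>A. P h x u')" using \<phi>_ge[OF \<open>0 \<le> h\<close>] by fastforce
      show "0 \<le> P a u x" using nonneg[OF \<open>0 \<le> a\<close>] \<open>x \<in> A\<close> \<open>u \<in> A\<close> A(2) by blast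
    qed
    finally show ?thesis using 1 by simp
  qed
  have iter: "1 - (\<Sum>u'\<in>A. P (real k * h) s u') \<le> real k * \<phi> h" if "0 \<le> h" for k h
  proof (induction k)
    case 0
    have "P 0 s u' = of_bool (s = u')" if "u' \<in> A" for u'
      using P[unfolded transition_matrix_function_def] A(2) s(1) that by blast
    then have "(\<Sum>u'\<in>A. P 0 s u') = (\<Sum>u'\<in>A. of_bool (s = u'))"
      by (rule sum.cong[OF refl])
    then show ?case using A s by (simp add: of_bool_def)
  next
    case (Suc k)
    have "real (Suc k) * h = real k * h + h" by (simp add: algebra_simps)
    with step[of "real k * h" h s] Suc that s show ?case by (simp add: algebra_simps)
  qed
  have "((\<lambda>h. \<phi> h / h) \<longlongrightarrow> - (\<Sum>u\<in>A. \<Sum>u'\<in>A. Q u u')) (at_right 0)"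
  proof -
    have "\<phi> h / h = - (\<Sum>u\<in>A. \<Sum>u'\<in>A. (P h u u' - of_bool (u = u')) / h)" for h
    proof -
      have "\<phi> h = - (\<Sum>u\<in>A. \<Sum>u'\<in>A. P h u u' - of_bool (u = u'))"
        using A(1) by (simp add: \<phi>_def sum_subtractf of_bool_def)
      then show ?thesis by (simp add: sum_divide_distrib)
    qed
    moreover have "((\<lambda>h. - (\<Sum>u\<in>A. \<Sum>u'\<in>A. (P h u u' - of_bool (u = u')) / h)) \<longlongrightarrow>
        - (\<Sum>u\<in>A. \<Sum>u'\<in>A. Q u u')) (at_right 0)"
      using gen A(2) unfolding infinitesimal_generator_def by (intro tendsto_intros) blast
    ultimately show ?thesis by simp
  qed
  moreover have "(\<Sum>u'\<in>A. Q u u') = 0" if "u \<in> A" for u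
  proof -
    have "(Q u has_sum 0) F" using Q A that by (auto simp: conservative_q_matrix_def)
    then have "(Q u has_sum 0) A"
      by (subst has_sum_cong_neutral[where T = F]) (use A that closed in auto)
    then show ?thesis using A(1) by (metis has_sum_finite has_sum_unique)
  qed
  ultimately have lim: "((\<lambda>h. \<phi> h / h) \<longlongrightarrow> 0) (at_right 0)" by simp
  have "filterlim (\<lambda>m. real (Suc m)) at_top sequentially"
    by (rule filterlim_compose[OF filterlim_real_sequentially filterlim_Suc])
  then have "(\<lambda>m. t / real (Suc m)) \<longlonglongrightarrow> 0"
    by (rule real_tendsto_divide_at_top[OF tendsto_const])
  then have "filterlim (\<lambda>m. t / real (Suc m)) (at_right 0) sequentially"
    using t by (simp add: filterlim_at)
  from tendsto_mult[OF tendsto_const[of t] filterlim_compose[OF lim this]]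
  have "(\<lambda>m. t * (\<phi> (t / real (Suc m)) / (t / real (Suc m)))) \<longlonglongrightarrow> 0" by simp
  moreover have "1 - (\<Sum>u'\<in>A. P t s u') \<le> t * (\<phi> (t / real (Suc m)) / (t / real (Suc m)))" for m
  proof -
    have "real (Suc m) * (t / real (Suc m)) = t" by (simp del: of_nat_Suc)
    moreover have "t * (\<phi> (t / real (Suc m)) / (t / real (Suc m))) = real (Suc m) * \<phi> (t / real (Suc m))"
      using t by (simp del: of_nat_Suc)
    ultimately show ?thesis using iter[of "t / real (Suc m)" "Suc m"] t by (simp add: mult.commute)
  qed
  ultimately have "1 - (\<Sum>u'\<in>A. P t s u') \<le> 0"
    by (intro LIMSEQ_le_const) auto
  moreover have "P t s s' + (\<Sum>u'\<in>A. P t s u') \<le> 1"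
    using sum_le[of t s "insert s' A"] A s t by auto
  ultimately show ?thesis using nonneg[of t s s'] A s t by fastforce
qed

section \<open>Resolvent of a finite truncation of the generator\<close>

lemma sum_of_bool_mult:
  fixes f :: "'a \<Rightarrow> real"
  assumes "finite A" "s \<in> A" shows "(\<Sum>u\<in>A. r * of_bool (s = u) * f u) = r * f s"
proof -
  have "(\<Sum>u\<in>A. r * of_bool (s = u) * f u) = (\<Sum>u\<in>A. if s = u then r * f u else 0)"
    by (intro sum.cong) auto
  then show ?thesis using assms by simp
qed

text \<open>
  The binomial theorem applies because the shift is a multiple of the identity. It relates a
  generator to the nonnegative matrix obtained by raising its diagonal.
\<close>

lemma submatrix_power_shift:
  assumes "finite A" "s \<in> A"
  shows "submatrix_power A (\<lambda>s u. B s u + r * of_bool (s = u)) p s s' =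
    (\<Sum>k\<le>p. of_nat (p choose k) * r ^ (p - k) * submatrix_power A B k s s')"
  using \<open>s \<in> A\<close>
proof (induction p arbitrary: s)
  case (Suc p)
  let ?C = "\<lambda>s u. B s u + r * of_bool (s = u)" and ?b = "\<lambda>k. submatrix_power A B k s s'"
  have "submatrix_power A ?C (Suc p) s s' =
      (\<Sum>u\<in>A. B s u * submatrix_power A ?C p u s') + r * submatrix_power A ?C p s s'"
    by (simp only: submatrix_power.simps distrib_right sum.distrib sum_of_bool_mult[OF \<open>finite A\<close> Suc.prems])
  also have "(\<Sum>u\<in>A. B s u * submatrix_power A ?C p u s') =
      (\<Sum>u\<in>A. B s u * (\<Sum>k\<le>p. of_nat (p choose k) * r ^ (p - k) * submatrix_power A B k u s'))"
    by (intro sum.cong refl arg_cong2[of _ _ _ _ "(*)"] Suc.IH)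
  also have "\<dots> = (\<Sum>k\<le>p. of_nat (p choose k) * r ^ (p - k) * ?b (Suc k))"
    by (simp add: sum_distrib_left mult_ac) (rule sum.swap)
  also have "\<dots> = (\<Sum>k=1..Suc p. of_nat (p choose (k - 1)) * r ^ (Suc p - k) * ?b k)"
    by (subst One_nat_def, subst sum.shift_bounds_cl_Suc_ivl)
       (simp add: atMost_atLeast0 del: submatrix_power.simps)
  also have "r * submatrix_power A ?C p s s' = (\<Sum>k\<le>p. of_nat (p choose k) * r ^ (Suc p - k) * ?b k)"
    by (subst Suc.IH[OF Suc.prems]) (auto simp: sum_distrib_left mult_ac Suc_diff_le intro!: sum.cong)
  also have "\<dots> = r ^ Suc p * ?b 0 + (\<Sum>k=1..Suc p. of_nat (p choose k) * r ^ (Suc p - k) * ?b k)"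
  proof -
    have "(\<Sum>k\<le>p. of_nat (p choose k) * r ^ (Suc p - k) * ?b k) =
        (\<Sum>k\<le>Suc p. of_nat (p choose k) * r ^ (Suc p - k) * ?b k)"
      by (simp add: binomial_eq_0 del: submatrix_power.simps)
    also have "\<dots> = r ^ Suc p * ?b 0 + (\<Sum>k=1..Suc p. of_nat (p choose k) * r ^ (Suc p - k) * ?b k)"
      by (simp add: atMost_atLeast0 sum.atLeast_Suc_atMost del: submatrix_power.simps power_Suc sum.cl_ivl_Suc)
    finally show ?thesis .
  qed
  also have "(\<Sum>k=1..Suc p. of_nat (p choose (k - 1)) * r ^ (Suc p - k) * ?b k) +
     (r ^ Suc p * ?b 0 + (\<Sum>k=1..Suc p. of_nat (p choose k) * r ^ (Suc p - k) * ?b k)) =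
     r ^ Suc p * ?b 0 + (\<Sum>k=1..Suc p. of_nat (Suc p choose k) * r ^ (Suc p - k) * ?b k)"
  proof -
    have pascal: "Suc p choose k = (p choose (k - 1)) + (p choose k)" if "k \<in> {1..Suc p}" for k
      using that by (cases k) auto
    have "(\<Sum>k=1..Suc p. of_nat (Suc p choose k) * r ^ (Suc p - k) * ?b k) =
        (\<Sum>k=1..Suc p. of_nat (p choose (k - 1)) * r ^ (Suc p - k) * ?b k +
          of_nat (p choose k) * r ^ (Suc p - k) * ?b k)"
      by (intro sum.cong refl) (simp only: pascal of_nat_add distrib_right)
    then show ?thesis
      by (simp only: sum.distrib add.left_commute)
  qed
  also have "\<dots> = (\<Sum>k\<le>Suc p. of_nat (Suc p choose k) * r ^ (Suc p - k) * ?b k)"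
    by (simp add: atMost_atLeast0 sum.atLeast_Suc_atMost del: submatrix_power.simps power_Suc sum.cl_ivl_Suc binomial_Suc_Suc)
  finally show ?case .
qed simp

lemma submatrix_power_nonneg:
  assumes "\<And>s u. s \<in> A \<Longrightarrow> u \<in> A \<Longrightarrow> 0 \<le> B s u" "s \<in> A" "s' \<in> A"
  shows "0 \<le> submatrix_power A B p s s'"
  using assms(2)
  by (induction p arbitrary: s) (auto intro!: sum_nonneg mult_nonneg_nonneg assms)

lemma submatrix_power_le:
  assumes "finite A" "\<And>s u. s \<in> A \<Longrightarrow> u \<in> A \<Longrightarrow> 0 \<le> B s u"
    and "\<And>s. s \<in> A \<Longrightarrow> (\<Sum>u\<in>A. B s u) \<le> q" "s \<in> A" "s' \<in> A"
  shows "submatrix_power A B p s s' \<le> q ^ p"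
proof -
  have q: "0 \<le> q" using assms(3)[OF assms(4)] sum_nonneg[of A "B s"] assms(2,4) by fastforce
  show ?thesis using \<open>s \<in> A\<close>
  proof (induction p arbitrary: s)
    case (Suc p)
    have "submatrix_power A B (Suc p) s s' \<le> (\<Sum>u\<in>A. B s u * q ^ p)"
      unfolding submatrix_power.simps by (intro sum_mono mult_left_mono Suc.IH assms Suc.prems)
    also have "\<dots> \<le> q * q ^ p"
      using assms(3)[OF Suc.prems] q by (simp add: mult_right_mono flip: sum_distrib_right)
    finally show ?case by simp
  qed simp
qed

text \<open>
  Uniformisation: for large \<open>q\<close> the matrix \<open>B = Q + q I\<close> is nonnegative with row sums at most \<open>q\<close>, and
  \<open>exp (Q t) = exp (- q t) exp (B t)\<close>. Integrating this nonnegative series term by term against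
  Erlang densities gives \<open>R = \<Sum>p. \<beta> B\<^sup>p / (\<beta> + q)\<^sup>p\<^sup>+\<^sup>1\<close>; the bounds and the resolvent equation are
  read off from the series.
\<close>

lemma submatrix_resolvent:
  assumes A: "finite A" and Q: "\<And>s u. s \<in> A \<Longrightarrow> u \<in> A \<Longrightarrow> s \<noteq> u \<Longrightarrow> 0 \<le> Q s u"
    and rows: "\<And>s. s \<in> A \<Longrightarrow> (\<Sum>u\<in>A. Q s u) \<le> 0" and \<beta>: "\<beta> > 0" and s: "s \<in> A" "s' \<in> A"
  defines "R \<equiv> Phi (submatrix_exp A Q) \<beta>"
  shows "0 \<le> R s s'" "R s s' \<le> 1"
    "\<beta> * R s s' = \<beta> * of_bool (s = s') + (\<Sum>u\<in>A. Q s u * R u s')"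
proof -
  define q where "q = (\<Sum>s\<in>A. \<bar>Q s s\<bar>)"
  define l where "l = \<beta> + q"
  have q: "q \<ge> 0" "- Q s s \<le> q" if "s \<in> A" for s
    using member_le_sum[of s A "\<lambda>s. \<bar>Q s s\<bar>"] that A by (auto simp: q_def intro!: sum_nonneg)
  have q0: "q \<ge> 0" using q s by blast
  have l: "l > 0" "q < l" using \<beta> q0 by (auto simp: l_def)
  define B where "B = (\<lambda>s u. Q s u + q * of_bool (s = u))"
  have B0: "0 \<le> B s u" if "s \<in> A" "u \<in> A" for s u
    using Q[OF that] q(2)[OF that(1)] by (auto simp: B_def of_bool_def)
  have Bq: "(\<Sum>u\<in>A. B s u) \<le> q" if "s \<in> A" for s
    using rows[OF that] sum_of_bool_mult[OF A that, of q "\<lambda>_. 1"] by (simp add: B_def sum.distrib)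
  let ?b = "submatrix_power A B"
  have b0: "0 \<le> ?b p s u" and bq: "?b p s u \<le> q ^ p" if "s \<in> A" "u \<in> A" for p s u
    using submatrix_power_nonneg[OF B0] submatrix_power_le[OF A B0 Bq] that by auto
  have exp_eq: "submatrix_exp A Q t s u = exp (- q * t) * (\<Sum>p. t ^ p / fact p * ?b p s u)"
    and exp_summable: "summable (\<lambda>p. t ^ p / fact p * ?b p s u)"
    if t: "0 \<le> t" and su: "s \<in> A" "u \<in> A" for t s u
  proof -
    have summ: "summable (\<lambda>p. norm (t ^ p / fact p * ?b p s u))"
    proof (rule summable_comparison_test')
      show "summable (\<lambda>p. (t * q) ^ p /\<^sub>R fact p)" by (rule summable_exp_generic)
      show "norm (norm (t ^ n / fact n * ?b n s u)) \<le> (t * q) ^ n /\<^sub>R fact n" for n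
        using t b0[OF su] bq[OF su, of n] by (simp add: power_mult_distrib divide_simps mult_left_mono)
    qed
    then show "summable (\<lambda>p. t ^ p / fact p * ?b p s u)" by (rule summable_norm_cancel)
    have "(\<lambda>k. \<Sum>i\<le>k. (t ^ i / fact i * ?b i s u) * ((- q * t) ^ (k - i) /\<^sub>R fact (k - i))) sums
        ((\<Sum>p. t ^ p / fact p * ?b p s u) * (\<Sum>p. (- q * t) ^ p /\<^sub>R fact p))"
      by (rule Cauchy_product_sums[OF summ]) (rule summable_norm_exp)
    moreover have "(\<Sum>i\<le>k. (t ^ i / fact i * ?b i s u) * ((- q * t) ^ (k - i) /\<^sub>R fact (k - i))) =
        t ^ k / fact k * submatrix_power A Q k s u" for k
    proof -
      have "Q = (\<lambda>s u. B s u + (- q) * of_bool (s = u))" by (auto simp: B_def)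
      then have "submatrix_power A Q k s u =
          (\<Sum>i\<le>k. of_nat (k choose i) * (- q) ^ (k - i) * ?b i s u)"
        using submatrix_power_shift[OF A su(1), of B "- q" k u] by simp
      also have "t ^ k / fact k * \<dots> =
          (\<Sum>i\<le>k. (t ^ i / fact i * ?b i s u) * ((- q * t) ^ (k - i) /\<^sub>R fact (k - i)))"
        unfolding sum_distrib_left
      proof (rule sum.cong)
        fix i assume "i \<in> {..k}"
        then have "t ^ k = t ^ i * t ^ (k - i)" "real (k choose i) = fact k / (fact i * fact (k - i))"
          by (auto simp flip: power_add simp: binomial_fact)
        then show "t ^ k / fact k * (of_nat (k choose i) * (- q) ^ (k - i) * ?b i s u) =
            (t ^ i / fact i * ?b i s u) * ((- q * t) ^ (k - i) /\<^sub>R fact (k - i))"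
          by (simp add: power_mult_distrib[of "- q" t, simplified mult_minus_left] divide_inverse mult_ac)
      qed simp
      finally show ?thesis by simp
    qed
    ultimately show "submatrix_exp A Q t s u = exp (- q * t) * (\<Sum>p. t ^ p / fact p * ?b p s u)"
      by (simp add: submatrix_exp_def exp_def sums_iff mult.commute)
  qed
  have R: "(\<lambda>p. \<beta> * ?b p s u / l ^ Suc p) sums R s u" if su: "s \<in> A" "u \<in> A" for s u
  proof -
    let ?f = "\<lambda>t. \<Sum>p. (\<beta> * ?b p s u / l ^ Suc p) * erlang_density p l t"
    have pos: "0 \<le> \<beta> * ?b p s u / l ^ Suc p" for p using \<beta> l b0[OF su] by simp
    have pos': "0 \<le> (\<beta> * ?b p s u / l ^ Suc p) * erlang_density p l t" for p t
      by (intro mult_nonneg_nonneg pos erlang_density_nonneg l less_imp_le)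
    have geom: "summable (\<lambda>p. \<beta> * ?b p s u / l ^ Suc p)"
    proof (rule summable_comparison_test')
      show "summable (\<lambda>p. (\<beta> / l) * (q / l) ^ p)"
        using l q0 by (intro summable_mult summable_geometric) auto
      show "norm (\<beta> * ?b n s u / l ^ Suc n) \<le> (\<beta> / l) * (q / l) ^ n" for n
        using l \<beta> b0[OF su] bq[OF su, of n] by (simp add: power_divide divide_simps mult_left_mono)
    qed
    have eq: "indicat_real {0..} t *\<^sub>R (\<beta> * exp (- \<beta> * t) * submatrix_exp A Q t s u) = ?f t"
      and sm: "summable (\<lambda>p. (\<beta> * ?b p s u / l ^ Suc p) * erlang_density p l t)" for t
    proof -
      have e: "(\<beta> * ?b p s u / l ^ Suc p) * erlang_density p l t =
          (\<beta> * exp (- l * t)) * (t ^ p / fact p * ?b p s u)" if "0 \<le> t" for p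
        using that l by (simp add: erlang_density_def)
      show "summable (\<lambda>p. (\<beta> * ?b p s u / l ^ Suc p) * erlang_density p l t)"
      proof (cases "0 \<le> t")
        case True then show ?thesis
          by (subst e[OF True]) (intro summable_mult exp_summable su)
      qed (simp add: erlang_density_def)
      show "indicat_real {0..} t *\<^sub>R (\<beta> * exp (- \<beta> * t) * submatrix_exp A Q t s u) = ?f t"
      proof (cases "0 \<le> t")
        case True
        have "?f t = (\<beta> * exp (- l * t)) * (\<Sum>p. t ^ p / fact p * ?b p s u)"
          by (subst e[OF True]) (intro suminf_mult exp_summable su True)
        also have "exp (- l * t) = exp (- \<beta> * t) * exp (- q * t)"
          by (simp add: l_def algebra_simps flip: exp_add)
        finally show ?thesis using exp_eq[OF True su] True by simp
      qed (simp add: erlang_density_def)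
    qed
    have "has_bochner_integral lborel ?f (\<Sum>p. \<beta> * ?b p s u / l ^ Suc p)"
    proof (rule has_bochner_integral_nn_integral)
      show "?f \<in> borel_measurable lborel" by measurable
      show "AE t in lborel. 0 \<le> ?f t"
        by (intro AE_I2 suminf_nonneg sm pos')
      show "0 \<le> (\<Sum>p. \<beta> * ?b p s u / l ^ Suc p)"
        by (rule suminf_nonneg[OF geom pos])
      have "(\<integral>\<^sup>+t. ennreal (?f t) \<partial>lborel) =
          (\<integral>\<^sup>+t. (\<Sum>p. ennreal (\<beta> * ?b p s u / l ^ Suc p) * ennreal (erlang_density p l t)) \<partial>lborel)"
        by (intro nn_integral_cong, subst suminf_ennreal2[OF pos' sm, symmetric])
           (simp only: ennreal_mult[OF pos erlang_density_nonneg[OF less_imp_le[OF l(1)]]])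
      also have "\<dots> = (\<Sum>p. \<integral>\<^sup>+t. ennreal (\<beta> * ?b p s u / l ^ Suc p) * ennreal (erlang_density p l t) \<partial>lborel)"
        by (rule nn_integral_suminf) measurable
      also have "\<dots> = (\<Sum>p. ennreal (\<beta> * ?b p s u / l ^ Suc p))"
      proof (rule suminf_cong)
        fix p
        have "(\<integral>\<^sup>+t. ennreal (erlang_density p l t) \<partial>lborel) = 1"
          using prob_space.emeasure_space_1[OF prob_space_erlang_density[OF l(1), of p]]
          by (subst (asm) emeasure_density) auto
        then show "(\<integral>\<^sup>+t. ennreal (\<beta> * ?b p s u / l ^ Suc p) * ennreal (erlang_density p l t) \<partial>lborel) =
            ennreal (\<beta> * ?b p s u / l ^ Suc p)"
          by (subst nn_integral_cmult) auto
      qed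
      also have "\<dots> = ennreal (\<Sum>p. \<beta> * ?b p s u / l ^ Suc p)"
        by (rule suminf_ennreal2[OF pos geom])
      finally show "(\<integral>\<^sup>+t. ennreal (?f t) \<partial>lborel) = ennreal (\<Sum>p. \<beta> * ?b p s u / l ^ Suc p)" .
    qed
    then have "R s u = (\<Sum>p. \<beta> * ?b p s u / l ^ Suc p)"
      unfolding R_def Phi_def set_lebesgue_integral_def eq by (rule has_bochner_integral_integral_eq)
    then show ?thesis using geom by (simp add: summable_sums)
  qed
  show "0 \<le> R s s'"
    by (rule sums_le[OF _ sums_zero R]) (use s b0 \<beta> l in auto)
  show "R s s' \<le> 1"
  proof (rule sums_le[OF _ R])
    have "(\<lambda>p. (\<beta> / l) * (q / l) ^ p) sums ((\<beta> / l) * (1 / (1 - q / l)))"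
      using l q0 by (intro sums_mult geometric_sums) auto
    also have "(\<beta> / l) * (1 / (1 - q / l)) = 1"
    proof -
      have "1 - q / l = \<beta> / l" using l by (simp add: l_def field_simps)
      then show ?thesis using l \<beta> by simp
    qed
    finally show "(\<lambda>p. (\<beta> / l) * (q / l) ^ p) sums 1" .
    show "\<beta> * ?b n s s' / l ^ Suc n \<le> (\<beta> / l) * (q / l) ^ n" for n
      using l \<beta> bq[OF s, of n] by (simp add: power_divide divide_simps mult_left_mono)
  qed (use s in auto)
  show "\<beta> * R s s' = \<beta> * of_bool (s = s') + (\<Sum>u\<in>A. Q s u * R u s')"
  proof -
    have "(\<lambda>p. \<Sum>u\<in>A. B s u * (\<beta> * ?b p u s' / l ^ Suc p)) sums (\<Sum>u\<in>A. B s u * R u s')"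
      using s by (intro sums_sum sums_mult R)
    also have "(\<lambda>p. \<Sum>u\<in>A. B s u * (\<beta> * ?b p u s' / l ^ Suc p)) =
        (\<lambda>p. l * (\<beta> * ?b (Suc p) s s' / l ^ Suc (Suc p)))"
      using l by (simp add: sum_distrib_left sum_divide_distrib field_simps)
    finally have 1: "(\<lambda>p. l * (\<beta> * ?b (Suc p) s s' / l ^ Suc (Suc p))) sums (\<Sum>u\<in>A. B s u * R u s')" .
    have "(\<lambda>p. l * (\<beta> * ?b p s s' / l ^ Suc p)) sums (l * R s s')"
      using s by (intro sums_mult R)
    then have "(\<lambda>p. l * (\<beta> * ?b (Suc p) s s' / l ^ Suc (Suc p))) sums
        (l * R s s' - l * (\<beta> * ?b 0 s s' / l ^ Suc 0))"
      by (subst sums_Suc_iff)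
         simp
    with 1 have "(\<Sum>u\<in>A. B s u * R u s') = l * R s s' - \<beta> * of_bool (s = s')"
      using l by (auto dest: sums_unique2)
    moreover have "(\<Sum>u\<in>A. B s u * R u s') = (\<Sum>u\<in>A. Q s u * R u s') + q * R s s'"
      by (simp only: B_def distrib_right sum.distrib sum_of_bool_mult[OF A s(1)])
    ultimately show ?thesis by (simp add: l_def algebra_simps)
  qed
qed

section \<open>Poisson equation by excursions from an atom\<close>

text \<open>
  A chain with stationary distribution \<open>\<pi>\<close>, seen from an atom \<open>\<alpha>\<close>: a Lyapunov function \<open>w\<close> has drift at most \<open>- r\<close> away from \<open>\<alpha>\<close>.
  Non-explosion is recorded in the form in which it is used, as the decay of the Laplace
  transforms of the jump times.
\<close>

locale drift_chain =
  fixes F :: "state set" and Q :: matrix and \<pi> :: vector and \<alpha> :: state and w r :: vector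
  assumes conservative: "conservative_q_matrix F Q"
    and stationary: "stationary_distribution F Q \<pi>"
    and alpha: "\<alpha> \<in> F"
    and explosion: "\<And>s lam \<epsilon>. s \<in> F \<Longrightarrow> lam > 0 \<Longrightarrow> \<epsilon> > 0 \<Longrightarrow>
      \<exists>n. (act (jump_kernel F Q (\<lambda>s. lam - Q s s)) ^^ n) (\<lambda>_. 1) s \<le> ennreal \<epsilon>"
    and w_pos: "\<And>s. s \<in> F \<Longrightarrow> 0 < w s"
    and r_ge: "\<And>s. s \<in> F \<Longrightarrow> 1 \<le> r s"
    and w_summable: "\<And>s. s \<in> F \<Longrightarrow> (\<lambda>s'. Q s s' * w s') summable_on F"
    and w_drift: "\<And>s. s \<in> F - {\<alpha>} \<Longrightarrow> (\<Sum>\<^sub>\<infinity>s'\<in>F. Q s s' * w s') \<le> - r s"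
begin

abbreviation E :: "state set" where "E \<equiv> F - {\<alpha>}"

text \<open>
  The jump chain killed on entering \<open>\<alpha>\<close>.
\<close>

definition H :: "state \<Rightarrow> state \<Rightarrow> ennreal" where
  "H = jump_kernel E Q (\<lambda>s. - Q s s)"

text \<open>
  With cost rate \<open>f\<close> this is the expected cost of one visit to \<open>s\<close>, the mean holding time being
  \<open>1 / (- Q s s)\<close>. Its potential is the expected cost until \<open>\<alpha>\<close> is hit.
\<close>

definition visit_cost :: "vector \<Rightarrow> state \<Rightarrow> ennreal" where
  "visit_cost f s = (if s \<in> E then ennreal (f s / - Q s s) else 0)"

lemma Q_nonneg: "s \<in> F \<Longrightarrow> s' \<in> F \<Longrightarrow> s \<noteq> s' \<Longrightarrow> 0 \<le> Q s s'"
  using conservative by (simp add: conservative_q_matrix_def)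

lemma Q_sum: "s \<in> F \<Longrightarrow> (Q s has_sum 0) F"
  using conservative by (simp add: conservative_q_matrix_def)

lemma pi_nonneg: "s \<in> F \<Longrightarrow> 0 \<le> \<pi> s"
  using stationary by (simp add: stationary_distribution_def)

lemma has_sum_remove_finite:
  fixes g :: "state \<Rightarrow> real"
  assumes "(g has_sum x) F" "B \<subseteq> F" "finite B"
  shows "(g has_sum (x - sum g B)) (F - B)"
  using has_sum_Diff[OF assms(1) has_sum_finite[OF assms(3)] assms(2)] .

lemma has_sum_remove_pair:
  fixes g :: "state \<Rightarrow> real"
  assumes "(g has_sum x) F" "s \<in> E"
  shows "(g has_sum (x - g s - g \<alpha>)) (E - {s})"
proof -
  have "\<alpha> \<noteq> s" "{\<alpha>, s} \<subseteq> F" "F - {\<alpha>, s} = E - {s}" using assms(2) alpha by auto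
  then show ?thesis using has_sum_remove_finite[OF assms(1), of "{\<alpha>, s}"] by (simp add: algebra_simps)
qed

lemma has_sum_insert_finite:
  fixes g :: "state \<Rightarrow> real"
  assumes "(g has_sum x) (F - B)" "B \<subseteq> F" "finite B"
  shows "(g has_sum (x + sum g B)) F"
proof -
  have "(g has_sum (x + sum g B)) ((F - B) \<union> B)"
    by (rule has_sum_Un_disjoint[OF assms(1) has_sum_finite[OF assms(3)]]) auto
  then show ?thesis using assms(2) by (simp add: Un_absorb2)
qed

lemma act_H_has_sum:
  assumes s: "s \<in> E" "Q s s < 0" and u: "\<And>s'. s' \<in> E \<Longrightarrow> 0 \<le> u s'"
    and sum: "((\<lambda>s'. Q s s' * u s') has_sum x) (E - {s})"
    and U: "\<And>s'. s' \<in> E \<Longrightarrow> U s' = ennreal (u s')"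
  shows "act H U s = ennreal (x / - Q s s)"
proof -
  have "((\<lambda>s'. Q s s' * u s' * inverse (- Q s s)) has_sum (x * inverse (- Q s s))) (E - {s})"
    by (rule has_sum_cmult_left[OF sum])
  moreover have nn: "0 \<le> Q s s' * u s' * inverse (- Q s s)" if "s' \<in> E - {s}" for s'
    using s u[of s'] Q_nonneg[of s s'] that by (intro mult_nonneg_nonneg) auto
  ultimately have "(\<integral>\<^sup>+s'. (if s' \<in> E - {s} then ennreal (Q s s' * u s' * inverse (- Q s s)) else 0) \<partial>count_space UNIV)
      = ennreal (x * inverse (- Q s s))"
    by (intro nn_integral_count_space_has_sum) auto
  also have "(\<integral>\<^sup>+s'. (if s' \<in> E - {s} then ennreal (Q s s' * u s' * inverse (- Q s s)) else 0) \<partial>count_space UNIV)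
      = act H U s"
    unfolding act_def
  proof (intro nn_integral_cong)
    fix s'
    show "(if s' \<in> E - {s} then ennreal (Q s s' * u s' * inverse (- Q s s)) else 0) = H s s' * U s'"
    proof (cases "s' \<in> E - {s}")
      case True
      then have "H s s' * U s' = ennreal (Q s s' / - Q s s) * ennreal (u s')"
        using s U[of s'] by (auto simp: H_def jump_kernel_def)
      also have "\<dots> = ennreal (Q s s' / - Q s s * u s')"
        using True s Q_nonneg[of s s'] u[of s'] by (intro ennreal_mult[symmetric]) (auto simp: divide_nonneg_nonpos)
      finally show ?thesis using True by (simp only: if_True) (simp add: field_simps)
    next
      case False then show ?thesis by (auto simp: H_def jump_kernel_def)
    qed
  qed
  finally show ?thesis by (simp only: divide_inverse)
qed

lemma act_H_outside: "s \<notin> E \<Longrightarrow> act H u s = 0"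
  unfolding act_def by (subst nn_integral_cong[where v = "\<lambda>_. 0"]) (auto simp: H_def jump_kernel_def)

text \<open>
  An absorbing state would leave \<open>w\<close> without negative drift there.
\<close>

lemma Q_diag_neg: assumes "s \<in> E" shows "Q s s < 0"
proof (rule ccontr)
  assume "\<not> Q s s < 0"
  then have "0 \<le> Q s s' * w s'" if "s' \<in> F" for s'
    using that assms Q_nonneg[of s s'] w_pos[OF that] by (cases "s' = s") auto
  then have "0 \<le> (\<Sum>\<^sub>\<infinity>s'\<in>F. Q s s' * w s')" by (intro infsum_nonneg) auto
  then show False using w_drift[OF assms] r_ge[of s] assms by simp
qed

lemma supersolution:
  assumes C: "0 \<le> C" and f: "\<And>s. s \<in> E \<Longrightarrow> 0 \<le> f s \<and> f s \<le> C * r s"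
  shows "potential H (visit_cost f) s \<le> (if s \<in> E then ennreal (C * w s) else 0)"
proof (rule potential_least)
  fix s
  let ?w = "\<lambda>s. if s \<in> E then ennreal (C * w s) else 0"
  show "visit_cost f s + act H ?w s \<le> ?w s"
  proof (cases "s \<in> E")
    case True
    note neg = Q_diag_neg[OF True]
    define x where "x = (\<Sum>\<^sub>\<infinity>s'\<in>F. Q s s' * w s')"
    have "((\<lambda>s'. Q s s' * w s') has_sum x) F"
      using w_summable[of s] True by (simp add: x_def)
    from has_sum_remove_pair[OF this True]
    have "((\<lambda>s'. Q s s' * w s') has_sum (x - Q s s * w s - Q s \<alpha> * w \<alpha>)) (E - {s})" .
    from has_sum_cmult_left[OF this, of C]
    have "((\<lambda>s'. Q s s' * (C * w s')) has_sum ((x - Q s s * w s - Q s \<alpha> * w \<alpha>) * C)) (E - {s})"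
      by (simp add: mult_ac)
    moreover have Cw: "0 \<le> C * w s'" if "s' \<in> F" for s'
      using C w_pos[OF that] by simp
    ultimately have a: "act H ?w s = ennreal ((x - Q s s * w s - Q s \<alpha> * w \<alpha>) * C / - Q s s)"
      by (intro act_H_has_sum[OF True neg]) auto
    have "0 \<le> (x - Q s s * w s - Q s \<alpha> * w \<alpha>) * C"
      using \<open>((\<lambda>s'. Q s s' * (C * w s')) has_sum ((x - Q s s * w s - Q s \<alpha> * w \<alpha>) * C)) (E - {s})\<close>
      by (rule has_sum_nonneg) (intro mult_nonneg_nonneg Q_nonneg Cw, use True in auto)
    then have "visit_cost f s + act H ?w s = ennreal (f s / - Q s s + (x - Q s s * w s - Q s \<alpha> * w \<alpha>) * C / - Q s s)"
      unfolding a visit_cost_def using True neg f[OF True]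
      by (simp only: if_True) (intro ennreal_plus[symmetric] divide_nonneg_pos; simp)
    also have "\<dots> \<le> ennreal (C * w s)"
    proof (rule ennreal_leI)
      have "0 \<le> Q s \<alpha> * w \<alpha>"
        using True alpha w_pos[OF alpha] by (intro mult_nonneg_nonneg Q_nonneg) auto
      then have "(x - Q s s * w s - Q s \<alpha> * w \<alpha>) * C \<le> (- r s - Q s s * w s) * C"
        using w_drift[OF True] C by (intro mult_right_mono) (auto simp: x_def)
      then have "f s + (x - Q s s * w s - Q s \<alpha> * w \<alpha>) * C \<le> (C * w s) * - Q s s"
        using f[OF True] by (simp add: algebra_simps)
      then show "f s / - Q s s + (x - Q s s * w s - Q s \<alpha> * w \<alpha>) * C / - Q s s \<le> C * w s"
        using neg unfolding add_divide_distrib[symmetric] by (subst pos_divide_le_eq) auto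
    qed
    finally show ?thesis using True by simp
  next
    case False
    then show ?thesis by (simp only: visit_cost_def act_H_outside[OF False] if_False add_0 order.refl)
  qed
qed

text \<open>
  A jump from \<open>s\<close> either enters \<open>\<alpha>\<close> or stays in \<open>E\<close>.
\<close>

lemma one_decomposition:
  "(if s \<in> E then 1 else 0) = visit_cost (\<lambda>s. Q s \<alpha>) s + act H (\<lambda>s. if s \<in> E then 1 else 0) s"
proof (cases "s \<in> E")
  case True
  note neg = Q_diag_neg[OF True]
  have 1: "((\<lambda>s'. Q s s' * 1) has_sum (- Q s s - Q s \<alpha>)) (E - {s})"
    using has_sum_remove_pair[OF Q_sum True] True by simp
  then have "act H (\<lambda>s. if s \<in> E then 1 else 0) s = ennreal ((- Q s s - Q s \<alpha>) / - Q s s)"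
    by (rule act_H_has_sum[OF True neg, rotated]) auto
  moreover have "0 \<le> - Q s s - Q s \<alpha>"
    using 1 by (rule has_sum_nonneg) (intro mult_nonneg_nonneg Q_nonneg, use True in auto)
  moreover have "Q s \<alpha> \<ge> 0" using Q_nonneg True alpha by auto
  ultimately have "visit_cost (\<lambda>s. Q s \<alpha>) s + act H (\<lambda>s. if s \<in> E then 1 else 0) s =
      ennreal (Q s \<alpha> / - Q s s + (- Q s s - Q s \<alpha>) / - Q s s)"
    unfolding visit_cost_def using True neg
    by (simp only: if_True) (intro ennreal_plus[symmetric] divide_nonneg_pos; simp)
  also have "Q s \<alpha> / - Q s s + (- Q s s - Q s \<alpha>) / - Q s s = 1"
    using neg unfolding add_divide_distrib[symmetric] by simp
  finally show ?thesis using True by simp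
next
  case False
  then show ?thesis by (simp only: visit_cost_def act_H_outside[OF False] if_False add_0)
qed

text \<open>
  Avoiding \<open>\<alpha>\<close> during \<open>n\<close> jumps means either to survive killing at rate \<open>lam\<close> as well, or to be killed
  before \<open>\<alpha>\<close> is hit; the latter has probability at most \<open>lam\<close> times the expected hitting time.
\<close>

lemma survival_le_killing:
  assumes "lam > 0"
  shows "(act H ^^ n) (\<lambda>_. 1) s \<le> (act (jump_kernel F Q (\<lambda>s. lam - Q s s)) ^^ n) (\<lambda>_. 1) s
           + ennreal lam * potential H (visit_cost (\<lambda>_. 1)) s"
proof (induction n arbitrary: s)
  case (Suc n)
  let ?K = "jump_kernel F Q (\<lambda>s. lam - Q s s)"
  let ?y = "(act ?K ^^ n) (\<lambda>_. 1)" and ?g = "potential H (visit_cost (\<lambda>_. 1))"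
  show ?case
  proof (cases "s \<in> E")
    case True
    note neg = Q_diag_neg[OF True]
    have y1: "?y s \<le> 1" for s
      by (rule funpow_act_one_le) (rule act_jump_kernel_sub_markov[OF conservative assms])
    \<comment> \<open>\<open>d\<close> is the probability of being killed before the next jump\<close>
    define d where "d = lam / (lam - Q s s)"
    have "0 < (lam - Q s s) * - Q s s" using neg assms by (intro mult_pos_pos) auto
    then have d: "0 \<le> d" "d \<le> lam / - Q s s"
      unfolding d_def using neg assms divide_left_mono[of "- Q s s" "lam - Q s s" lam] by auto
    have H1: "act H (\<lambda>_. 1) s \<le> 1"
    proof -
      have "act H (\<lambda>_. 1) s = act H (\<lambda>s. if s \<in> E then 1 else 0) s"
        unfolding act_def by (intro nn_integral_cong) (auto simp: H_def jump_kernel_def)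
      also have "\<dots> \<le> visit_cost (\<lambda>s. Q s \<alpha>) s + act H (\<lambda>s. if s \<in> E then 1 else 0) s"
        by (rule add_increasing) auto
      also have "\<dots> = 1" unfolding one_decomposition[symmetric] using True by simp
      finally show ?thesis .
    qed
    have "H s s' \<le> ?K s s' + ennreal d * H s s'" for s'
    proof (cases "s' \<in> E \<and> s' \<noteq> s")
      case True
      note s' = True
      have qq: "Q s s' / - Q s s = Q s s' / (lam - Q s s) + d * (Q s s' / - Q s s)"
        using neg assms by (simp add: d_def divide_simps) (simp add: algebra_simps)
      have "0 \<le> Q s s'" using s' \<open>s \<in> E\<close> by (intro Q_nonneg) auto
      have "H s s' = ennreal (Q s s' / - Q s s)" using s' \<open>s \<in> E\<close> by (auto simp: H_def jump_kernel_def)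
      moreover have "?K s s' = ennreal (Q s s' / (lam - Q s s))" using s' \<open>s \<in> E\<close> by (auto simp: jump_kernel_def)
      ultimately show ?thesis
        using \<open>0 \<le> Q s s'\<close> d(1) neg assms qq
        by (simp only: ennreal_mult[symmetric] ennreal_plus[symmetric] divide_nonneg_pos mult_nonneg_nonneg)
    qed (auto simp: H_def jump_kernel_def)
    then have "act H ?y s \<le> act (\<lambda>s s'. ?K s s' + ennreal d * H s s') ?y s"
      unfolding act_def by (intro nn_integral_mono mult_right_mono) auto
    also have "\<dots> = act ?K ?y s + ennreal d * act H ?y s"
      unfolding act_def by (simp add: distrib_right nn_integral_add nn_integral_cmult mult.assoc)
    also have "\<dots> \<le> act ?K ?y s + ennreal d * 1"
      using act_one_le[OF y1 H1] by (intro add_left_mono mult_left_mono) auto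
    also have "ennreal d * 1 \<le> ennreal lam * visit_cost (\<lambda>_. 1) s"
      using d True neg assms by (simp add: visit_cost_def ennreal_leI flip: ennreal_mult)
    finally have Hy: "act H ?y s \<le> act ?K ?y s + ennreal lam * visit_cost (\<lambda>_. 1) s"
      by (simp add: add_left_mono)
    have "(act H ^^ Suc n) (\<lambda>_. 1) s \<le> act H (\<lambda>s. ?y s + ennreal lam * ?g s) s"
      by (simp, rule act_mono) (auto intro: Suc.IH)
    also have "\<dots> = act H ?y s + ennreal lam * act H ?g s"
      by (simp add: act_add act_cmult)
    also have "\<dots> \<le> act ?K ?y s + ennreal lam * visit_cost (\<lambda>_. 1) s + ennreal lam * act H ?g s"
      by (intro add_right_mono Hy)
    also have "\<dots> = act ?K ?y s + ennreal lam * ?g s"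
      by (simp add: potential_unfold[of H "visit_cost (\<lambda>_. 1)" s] distrib_left add.assoc)
    finally show ?thesis by simp
  qed (simp add: act_H_outside)
qed simp

text \<open>
  The chain hits \<open>\<alpha>\<close> surely. The probability to avoid \<open>\<alpha>\<close> for \<open>n\<close> jumps is at most the Laplace transform
  of the \<open>n\<close>-th jump time at \<open>lam\<close>, small by non-explosion, plus \<open>lam\<close> times the mean hitting time, which
  is bounded by \<open>w s\<close>; and \<open>lam\<close> is arbitrary.
\<close>

lemma recurrence:
  assumes "s \<in> E" shows "potential H (visit_cost (\<lambda>s. Q s \<alpha>)) s = 1"
proof (rule antisym)
  let ?u = "visit_cost (\<lambda>s. Q s \<alpha>)" and ?one = "\<lambda>s. if s \<in> E then 1 else 0 :: ennreal"
  have "potential H ?u s \<le> ?one s"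
    by (rule potential_least) (simp only: one_decomposition[symmetric])
  then show "potential H ?u s \<le> 1" using assms by simp
  have iter: "?one s \<le> potential H ?u s + (act H ^^ n) (\<lambda>_. 1) s" for n s
  proof (induction n arbitrary: s)
    case 0 show ?case by (simp add: add_increasing)
  next
    case (Suc n)
    have "?one s = ?u s + act H ?one s" by (rule one_decomposition)
    also have "\<dots> \<le> ?u s + act H (\<lambda>s. potential H ?u s + (act H ^^ n) (\<lambda>_. 1) s) s"
      by (intro add_left_mono act_mono Suc.IH) auto
    also have "\<dots> = potential H ?u s + (act H ^^ Suc n) (\<lambda>_. 1) s"
      by (subst (2) potential_unfold) (simp add: act_add add.assoc)
    finally show ?case .
  qed
  show "1 \<le> potential H ?u s"
  proof (rule ennreal_le_epsilon)
    fix e :: real assume "e > 0"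
    \<comment> \<open>makes \<open>lam\<close> times the bound \<open>w s\<close> of the mean hitting time equal to \<open>e / 2\<close>\<close>
    define lam where "lam = e / 2 / w s"
    have ws: "w s > 0" using w_pos assms by auto
    have "lam > 0" using ws \<open>e > 0\<close> by (simp add: lam_def)
    obtain n where n: "(act (jump_kernel F Q (\<lambda>s. lam - Q s s)) ^^ n) (\<lambda>_. 1) s \<le> ennreal (e / 2)"
      using explosion[of s lam "e / 2"] assms \<open>lam > 0\<close> \<open>e > 0\<close> by auto
    have "potential H (visit_cost (\<lambda>_. 1)) s \<le> ennreal (w s)"
      using supersolution[of 1 "\<lambda>_. 1" s] r_ge assms by simp
    then have "ennreal lam * potential H (visit_cost (\<lambda>_. 1)) s \<le> ennreal lam * ennreal (w s)"
      by (rule mult_left_mono) simp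
    also have "\<dots> = ennreal (e / 2)"
      using ws \<open>lam > 0\<close> by (simp add: lam_def flip: ennreal_mult)
    finally have "(act H ^^ n) (\<lambda>_. 1) s \<le> ennreal (e / 2) + ennreal (e / 2)"
      using survival_le_killing[OF \<open>lam > 0\<close>, of n s] n by (meson add_mono order_trans)
    also have "\<dots> = ennreal e" using \<open>e > 0\<close> by (simp flip: ennreal_plus)
    finally show "1 \<le> potential H ?u s + ennreal e"
      using iter[of s n] assms by (simp add: add_left_mono order_trans)
  qed
qed

definition outflow :: "state \<Rightarrow> ennreal" where
  "outflow s = (if s \<in> E then ennreal (\<pi> s * - Q s s) else 0)"

definition entrance :: "state \<Rightarrow> ennreal" where
  "entrance s = (if s \<in> E then ennreal (\<pi> \<alpha> * Q \<alpha> s) else 0)"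

lemma pi_balance: "s' \<in> F \<Longrightarrow> ((\<lambda>s. \<pi> s * Q s s') has_sum 0) F"
  using stationary by (simp add: stationary_distribution_def)

lemma outflow_visit_cost:
  assumes "\<And>s. s \<in> E \<Longrightarrow> 0 \<le> f s"
  shows "pairing outflow (visit_cost f) = (\<integral>\<^sup>+s. (if s \<in> E then ennreal (\<pi> s * f s) else 0) \<partial>count_space UNIV)"
  unfolding pairing_def
proof (rule nn_integral_cong)
  fix s
  show "outflow s * visit_cost f s = (if s \<in> E then ennreal (\<pi> s * f s) else 0)"
  proof (cases "s \<in> E")
    case True
    note neg = Q_diag_neg[OF True]
    have "outflow s * visit_cost f s = ennreal ((\<pi> s * - Q s s) * (f s / - Q s s))"
      unfolding outflow_def visit_cost_def using True neg assms[OF True] pi_nonneg[of s]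
      by (simp only: if_True) (intro ennreal_mult[symmetric] mult_nonneg_nonneg divide_nonneg_pos; simp)
    also have "(\<pi> s * - Q s s) * (f s / - Q s s) = \<pi> s * f s" using neg by simp
    finally show ?thesis using True by simp
  next
    case False then show ?thesis by (simp only: outflow_def if_False mult_zero_left)
  qed
qed

lemma outflow_balance: "outflow s' = entrance s' + act H\<^sup>T outflow s'"
proof (cases "s' \<in> E")
  case True
  note neg = Q_diag_neg[OF True]
  have sum: "((\<lambda>s. \<pi> s * Q s s') has_sum (- (\<pi> s' * Q s' s') - \<pi> \<alpha> * Q \<alpha> s')) (E - {s'})"
    using has_sum_remove_pair[OF pi_balance True] True by simp
  have nn: "0 \<le> \<pi> s * Q s s'" if "s \<in> F" "s \<noteq> s'" for s
    using that True by (intro mult_nonneg_nonneg pi_nonneg Q_nonneg) auto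
  have "act H\<^sup>T outflow s' = (\<integral>\<^sup>+s. (if s \<in> E - {s'} then ennreal (\<pi> s * Q s s') else 0) \<partial>count_space UNIV)"
    unfolding act_def
  proof (rule nn_integral_cong)
    fix s
    show "H s s' * outflow s = (if s \<in> E - {s'} then ennreal (\<pi> s * Q s s') else 0)"
    proof (cases "s \<in> E - {s'}")
      case s: True
      then have neg: "Q s s < 0" and "0 \<le> Q s s'" "0 \<le> \<pi> s"
        using Q_diag_neg[of s] True by (auto intro!: Q_nonneg pi_nonneg)
      have "H s s' * outflow s = ennreal (Q s s' / - Q s s) * ennreal (\<pi> s * - Q s s)"
        using s True by (auto simp: H_def jump_kernel_def outflow_def)
      also have "\<dots> = ennreal (Q s s' / - Q s s * (\<pi> s * - Q s s))"
        using neg \<open>0 \<le> Q s s'\<close> \<open>0 \<le> \<pi> s\<close>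
        by (intro ennreal_mult[symmetric] mult_nonneg_nonneg divide_nonneg_pos) auto
      also have "Q s s' / - Q s s * (\<pi> s * - Q s s) = \<pi> s * Q s s'" using neg by simp
      finally show ?thesis using s by simp
    next
      case False then show ?thesis by (auto simp: H_def jump_kernel_def outflow_def)
    qed
  qed
  also have "\<dots> = ennreal (- (\<pi> s' * Q s' s') - \<pi> \<alpha> * Q \<alpha> s')"
    by (rule nn_integral_count_space_has_sum[OF _ sum]) (rule nn, auto)
  finally have a: "act H\<^sup>T outflow s' = ennreal (- (\<pi> s' * Q s' s') - \<pi> \<alpha> * Q \<alpha> s')" .
  have "0 \<le> - (\<pi> s' * Q s' s') - \<pi> \<alpha> * Q \<alpha> s'"
    by (rule has_sum_nonneg[OF sum]) (rule nn, auto)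
  moreover have "0 \<le> \<pi> \<alpha> * Q \<alpha> s'" using True alpha by (intro nn) auto
  ultimately have "entrance s' + act H\<^sup>T outflow s' = ennreal (- (\<pi> s' * Q s' s'))"
    unfolding a entrance_def using True by (simp flip: ennreal_plus)
  then show ?thesis using True by (simp add: outflow_def)
next
  case False
  have "act H\<^sup>T outflow s' = 0"
    unfolding act_def by (subst nn_integral_cong[where v = "\<lambda>_. 0"]) (use False in \<open>auto simp: H_def jump_kernel_def\<close>)
  then show ?thesis using False by (simp only: outflow_def entrance_def if_False add_0)
qed

text \<open>
  The cycle formula: the mean of \<open>f\<close> under \<open>\<pi>\<close> off \<open>\<alpha>\<close> is \<open>\<pi> \<alpha>\<close> times the rate of excursions from \<open>\<alpha>\<close>,
  weighted with the cost of an excursion. The stationary flow dominates the occupation of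
  excursions, and they agree because both return to \<open>\<alpha>\<close> with the same total flow
  \<open>- \<pi> \<alpha> * Q \<alpha> \<alpha>\<close>: this is recurrence on one side and stationarity on the other.
\<close>

lemma entrance_potential:
  assumes "\<And>s. s \<in> E \<Longrightarrow> 0 \<le> f s"
  shows "(\<integral>\<^sup>+s. (if s \<in> E then ennreal (\<pi> s * f s) else 0) \<partial>count_space UNIV)
    = pairing entrance (potential H (visit_cost f))"
proof -
  have one: "pairing entrance (potential H (visit_cost (\<lambda>s. Q s \<alpha>))) = ennreal (- (\<pi> \<alpha> * Q \<alpha> \<alpha>))"
  proof -
    have "((\<lambda>s. \<pi> \<alpha> * Q \<alpha> s) has_sum (\<pi> \<alpha> * (0 - Q \<alpha> \<alpha>))) E"
      using has_sum_remove_finite[OF Q_sum[OF alpha], of "{\<alpha>}"] alpha by (intro has_sum_cmult_right) simp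
    then have "(\<integral>\<^sup>+s. (if s \<in> E then ennreal (\<pi> \<alpha> * Q \<alpha> s) else 0) \<partial>count_space UNIV) = ennreal (\<pi> \<alpha> * (0 - Q \<alpha> \<alpha>))"
      by (rule nn_integral_count_space_has_sum[rotated])
        (intro mult_nonneg_nonneg pi_nonneg Q_nonneg alpha, auto)
    moreover have "entrance s * potential H (visit_cost (\<lambda>s. Q s \<alpha>)) s = (if s \<in> E then ennreal (\<pi> \<alpha> * Q \<alpha> s) else 0)" for s
      using recurrence[of s] by (auto simp: entrance_def)
    ultimately show ?thesis by (simp add: pairing_def)
  qed
  have two: "pairing outflow (visit_cost (\<lambda>s. Q s \<alpha>)) = ennreal (- (\<pi> \<alpha> * Q \<alpha> \<alpha>))"
  proof -
    have "((\<lambda>s. \<pi> s * Q s \<alpha>) has_sum (- (\<pi> \<alpha> * Q \<alpha> \<alpha>))) E"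
      using has_sum_remove_finite[OF pi_balance[OF alpha], of "{\<alpha>}"] alpha by simp
    then have "(\<integral>\<^sup>+s. (if s \<in> E then ennreal (\<pi> s * Q s \<alpha>) else 0) \<partial>count_space UNIV) = ennreal (- (\<pi> \<alpha> * Q \<alpha> \<alpha>))"
      by (rule nn_integral_count_space_has_sum[rotated])
        (intro mult_nonneg_nonneg pi_nonneg Q_nonneg alpha, auto)
    moreover have "0 \<le> Q s \<alpha>" if "s \<in> E" for s using that alpha by (intro Q_nonneg) auto
    ultimately show ?thesis by (simp only: outflow_visit_cost)
  qed
  have rho: "outflow s = potential H\<^sup>T entrance s" if "s \<in> E" for s
    by (rule potential_eq_of_recurrent[OF outflow_balance, where ?u0.0 = "visit_cost (\<lambda>s. Q s \<alpha>)"])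
       (simp_all add: one two recurrence[OF that])
  have "pairing outflow (visit_cost f) = pairing (potential H\<^sup>T entrance) (visit_cost f)"
    unfolding pairing_def using rho by (intro nn_integral_cong) (auto simp: visit_cost_def)
  then show ?thesis using outflow_visit_cost[OF assms] by (simp add: pairing_potential)
qed

lemma pi_alpha_pos: "0 < \<pi> \<alpha>"
proof (rule ccontr)
  assume "\<not> 0 < \<pi> \<alpha>"
  then have "entrance s = 0" for s
    using pi_nonneg[OF alpha] by (auto simp: entrance_def)
  then have "(\<integral>\<^sup>+s. (if s \<in> E then ennreal (\<pi> s * 1) else 0) \<partial>count_space UNIV) = 0"
    by (subst entrance_potential) (auto simp: pairing_def)
  then have "((\<lambda>s. \<pi> s * 1) has_sum 0) E"
    by (intro has_sum_of_nn_integral_count_space) (use pi_nonneg in auto)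
  from has_sum_insert_finite[OF this] have "(\<pi> has_sum \<pi> \<alpha>) F" using alpha by simp
  moreover have "(\<pi> has_sum 1) F" using stationary by (simp add: stationary_distribution_def)
  ultimately show False using \<open>\<not> 0 < \<pi> \<alpha>\<close> has_sum_unique by fastforce
qed

text \<open>
  The solution \<open>h s\<close> is the expected cost until \<open>\<alpha>\<close> is hit. Off \<open>\<alpha>\<close> the equation is first-step analysis,
  at \<open>\<alpha>\<close> it is the cycle formula.
\<close>

lemma poisson_nonneg:
  assumes C: "0 \<le> C" and f: "\<And>s. s \<in> F \<Longrightarrow> 0 \<le> f s \<and> f s \<le> C * r s"
  obtains h where "\<And>s. s \<in> F \<Longrightarrow> 0 \<le> h s \<and> h s \<le> C * w s"
    and "\<And>s. s \<in> E \<Longrightarrow> ((\<lambda>s'. Q s s' * h s') has_sum (- f s)) F"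
    and "(\<lambda>s. \<pi> s * f s) summable_on F"
    and "((\<lambda>s'. Q \<alpha> s' * h s') has_sum ((\<Sum>\<^sub>\<infinity>s\<in>F. \<pi> s * f s) / \<pi> \<alpha> - f \<alpha>)) F"
proof -
  define u where "u = potential H (visit_cost f)"
  define h where "h s = enn2real (u s)" for s
  have Cw: "0 \<le> C * w s" if "s \<in> F" for s using C w_pos[OF that] by simp
  have u_le: "u s \<le> (if s \<in> E then ennreal (C * w s) else 0)" for s
    unfolding u_def by (rule supersolution[OF C]) (use f in auto)
  have u_eq: "u s = ennreal (h s)" for s
    using order_le_less_trans[OF u_le[of s], of top] by (simp add: h_def)
  have h0: "0 \<le> h s" for s by (simp add: h_def)
  have h_alpha: "h \<alpha> = 0" using u_le[of \<alpha>] by (simp add: h_def)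
  have h_le: "h s \<le> C * w s" if "s \<in> F" for s
  proof (cases "s = \<alpha>")
    case False
    then have "ennreal (h s) \<le> ennreal (C * w s)" using u_le[of s] that by (simp add: u_eq)
    then show ?thesis using Cw[OF that] by (simp add: ennreal_le_iff)
  qed (use h_alpha Cw[OF that] in simp)
  have nn: "0 \<le> Q s s' * h s'" if "s \<in> F" "s' \<in> F - {s}" for s s'
    using that by (intro mult_nonneg_nonneg Q_nonneg h0) auto
  have summ: "(\<lambda>s'. Q s s' * h s') summable_on (F - {s})" if s: "s \<in> F" for s
  proof (rule summable_on_comparison_test)
    have "(\<lambda>s'. Q s s' * w s') summable_on (F - {s})"
      using w_summable[OF s] by (rule summable_on_subset_banach) auto
    then show "(\<lambda>s'. Q s s' * w s' * C) summable_on (F - {s})" by (rule summable_on_cmult_left)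
    show "Q s s' * h s' \<le> Q s s' * w s' * C" if "s' \<in> F - {s}" for s'
      using mult_left_mono[OF h_le[of s'] Q_nonneg[of s s']] s that by (auto simp: mult_ac)
    show "0 \<le> Q s s' * h s'" if "s' \<in> F - {s}" for s' by (rule nn[OF s that])
  qed
  have poisson: "((\<lambda>s'. Q s s' * h s') has_sum (- f s)) F" if "s \<in> E" for s
  proof -
    note neg = Q_diag_neg[OF that]
    define x where "x = (\<Sum>\<^sub>\<infinity>s'\<in>E - {s}. Q s s' * h s')"
    have "(\<lambda>s'. Q s s' * h s') summable_on (E - {s})"
      by (rule summable_on_subset_banach[OF summ[of s]]) (use that in auto)
    then have x: "((\<lambda>s'. Q s s' * h s') has_sum x) (E - {s})" by (simp add: x_def)
    have x0: "0 \<le> x" by (rule has_sum_nonneg[OF x]) (rule nn, use that in auto)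
    have "u s = visit_cost f s + act H u s" unfolding u_def by (rule potential_unfold)
    also have "act H u s = ennreal (x / - Q s s)"
      by (rule act_H_has_sum[OF that neg _ x]) (auto simp: u_eq h0)
    also have "visit_cost f s + ennreal (x / - Q s s) = ennreal (f s / - Q s s + x / - Q s s)"
      unfolding visit_cost_def using that neg f[of s] x0
      by (simp only: if_True) (intro ennreal_plus[symmetric] divide_nonneg_pos; simp)
    finally have "ennreal (h s) = ennreal (f s / - Q s s + x / - Q s s)"
      unfolding u_eq .
    moreover have "0 \<le> f s / - Q s s + x / - Q s s"
      using neg f[of s] x0 that by (intro add_nonneg_nonneg divide_nonneg_pos) auto
    ultimately have "h s = f s / - Q s s + x / - Q s s"
      using h0[of s] by (metis ennreal_inj)
    then have "h s = (f s + x) / - Q s s" by (simp only: add_divide_distrib)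
    moreover have "- Q s s \<noteq> 0" using neg by simp
    ultimately have hs: "h s * - Q s s = f s + x" by (metis nonzero_eq_divide_eq)
    have "((\<lambda>s'. Q s s' * h s') has_sum (x + (\<Sum>s'\<in>{\<alpha>, s}. Q s s' * h s'))) F"
    proof (rule has_sum_insert_finite)
      have "E - {s} = F - {\<alpha>, s}" by auto
      then show "((\<lambda>s'. Q s s' * h s') has_sum x) (F - {\<alpha>, s})" using x by simp
    qed (use that alpha in auto)
    also have "x + (\<Sum>s'\<in>{\<alpha>, s}. Q s s' * h s') = - f s"
    proof -
      have "\<alpha> \<noteq> s" using that by auto
      then show ?thesis using hs by (simp add: h_alpha algebra_simps)
    qed
    finally show ?thesis .
  qed
  define y where "y = (\<Sum>\<^sub>\<infinity>s\<in>E. Q \<alpha> s * h s)"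
  have y: "((\<lambda>s. Q \<alpha> s * h s) has_sum y) E" using summ[OF alpha] by (simp add: y_def)
  have y0: "0 \<le> y" by (rule has_sum_nonneg[OF y]) (rule nn, use alpha in auto)
  have "pairing entrance u = ennreal (\<pi> \<alpha> * y)"
  proof -
    have "((\<lambda>s. \<pi> \<alpha> * (Q \<alpha> s * h s)) has_sum (\<pi> \<alpha> * y)) E"
      by (rule has_sum_cmult_right[OF y])
    then have "(\<integral>\<^sup>+s. (if s \<in> E then ennreal (\<pi> \<alpha> * (Q \<alpha> s * h s)) else 0) \<partial>count_space UNIV) = ennreal (\<pi> \<alpha> * y)"
      by (rule nn_integral_count_space_has_sum[rotated])
        (intro mult_nonneg_nonneg[of "\<pi> \<alpha>"] pi_nonneg nn alpha, auto)
    moreover have "entrance s * u s = (if s \<in> E then ennreal (\<pi> \<alpha> * (Q \<alpha> s * h s)) else 0)" for s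
    proof (cases "s \<in> E")
      case True
      have "0 \<le> \<pi> \<alpha> * Q \<alpha> s"
        using True alpha by (intro mult_nonneg_nonneg pi_nonneg Q_nonneg) auto
      then show ?thesis using True h0[of s]
        by (simp add: entrance_def u_eq mult.assoc flip: ennreal_mult)
    next
      case False
      then show ?thesis by (simp only: entrance_def if_False mult_zero_left)
    qed
    ultimately show ?thesis by (simp add: pairing_def)
  qed
  then have "(\<integral>\<^sup>+s. (if s \<in> E then ennreal (\<pi> s * f s) else 0) \<partial>count_space UNIV) = ennreal (\<pi> \<alpha> * y)"
    unfolding u_def by (subst entrance_potential) (use f in auto)
  then have "((\<lambda>s. \<pi> s * f s) has_sum (\<pi> \<alpha> * y)) E"
    by (intro has_sum_of_nn_integral_count_space) (use f pi_nonneg less_imp_le[OF pi_alpha_pos] y0 in \<open>simp_all add: mult_nonneg_nonneg\<close>)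
  from has_sum_insert_finite[OF this] have pf: "((\<lambda>s. \<pi> s * f s) has_sum (\<pi> \<alpha> * y + \<pi> \<alpha> * f \<alpha>)) F"
    using alpha by simp
  show thesis
  proof (rule that[of h])
    show "(\<lambda>s. \<pi> s * f s) summable_on F" using pf by (auto simp: summable_on_def)
    from has_sum_insert_finite[OF y] have "((\<lambda>s. Q \<alpha> s * h s) has_sum y) F"
      using alpha by (simp add: h_alpha)
    also have "y = (\<Sum>\<^sub>\<infinity>s\<in>F. \<pi> s * f s) / \<pi> \<alpha> - f \<alpha>"
      using infsumI[OF pf] pi_alpha_pos by (simp add: field_simps)
    finally show "((\<lambda>s'. Q \<alpha> s' * h s') has_sum ((\<Sum>\<^sub>\<infinity>s\<in>F. \<pi> s * f s) / \<pi> \<alpha> - f \<alpha>)) F" .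
    show "0 \<le> h s \<and> h s \<le> C * w s" if "s \<in> F" for s using h0 h_le[OF that] by simp
  qed (rule poisson)
qed

text \<open>
  Solve for the positive and the negative part of \<open>f\<close>. The two excess terms at \<open>\<alpha>\<close> cancel because \<open>f\<close> is
  centred, and the difference of two numbers in \<open>{0..C * w s}\<close> has absolute value at most \<open>C * w s\<close>.
\<close>

lemma poisson:
  assumes C: "0 \<le> C" and f: "\<And>s. s \<in> F \<Longrightarrow> \<bar>f s\<bar> \<le> C * r s"
    and centred: "(\<Sum>\<^sub>\<infinity>s\<in>F. \<pi> s * f s) = 0"
  obtains h where "\<And>s. s \<in> F \<Longrightarrow> \<bar>h s\<bar> \<le> C * w s"
    and "\<And>s. s \<in> F \<Longrightarrow> ((\<lambda>s'. Q s s' * h s') has_sum (- f s)) F"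
proof -
  have fp: "0 \<le> max 0 (f s) \<and> max 0 (f s) \<le> C * r s" if "s \<in> F" for s
    using f[OF that] by auto
  have fm: "0 \<le> max 0 (- f s) \<and> max 0 (- f s) \<le> C * r s" if "s \<in> F" for s
    using f[OF that] by auto
  obtain h where h: "\<And>s. s \<in> F \<Longrightarrow> 0 \<le> h s \<and> h s \<le> C * w s"
    "\<And>s. s \<in> E \<Longrightarrow> ((\<lambda>s'. Q s s' * h s') has_sum (- max 0 (f s))) F"
    "(\<lambda>s. \<pi> s * max 0 (f s)) summable_on F"
    "((\<lambda>s'. Q \<alpha> s' * h s') has_sum ((\<Sum>\<^sub>\<infinity>s\<in>F. \<pi> s * max 0 (f s)) / \<pi> \<alpha> - max 0 (f \<alpha>))) F"
    by (rule poisson_nonneg[OF C fp], assumption, rule that; assumption)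
  obtain k where k: "\<And>s. s \<in> F \<Longrightarrow> 0 \<le> k s \<and> k s \<le> C * w s"
    "\<And>s. s \<in> E \<Longrightarrow> ((\<lambda>s'. Q s s' * k s') has_sum (- max 0 (- f s))) F"
    "(\<lambda>s. \<pi> s * max 0 (- f s)) summable_on F"
    "((\<lambda>s'. Q \<alpha> s' * k s') has_sum ((\<Sum>\<^sub>\<infinity>s\<in>F. \<pi> s * max 0 (- f s)) / \<pi> \<alpha> - max 0 (- f \<alpha>))) F"
    by (rule poisson_nonneg[OF C fm], assumption, rule that; assumption)
  have dec: "max 0 (f s) - max 0 (- f s) = f s" for s by auto
  have "(\<Sum>\<^sub>\<infinity>s\<in>F. \<pi> s * max 0 (f s)) - (\<Sum>\<^sub>\<infinity>s\<in>F. \<pi> s * max 0 (- f s)) =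
      (\<Sum>\<^sub>\<infinity>s\<in>F. \<pi> s * max 0 (f s) - \<pi> s * max 0 (- f s))"
    using has_sum_diff[OF has_sum_infsum[OF h(3)] has_sum_infsum[OF k(3)]] by (simp add: infsumI)
  also have "\<dots> = 0" by (simp add: dec centred flip: right_diff_distrib)
  finally have eq: "(\<Sum>\<^sub>\<infinity>s\<in>F. \<pi> s * max 0 (f s)) = (\<Sum>\<^sub>\<infinity>s\<in>F. \<pi> s * max 0 (- f s))" by simp
  show thesis
  proof (rule that[of "\<lambda>s. h s - k s"])
    fix s assume s: "s \<in> F"
    show "\<bar>h s - k s\<bar> \<le> C * w s" using h(1)[OF s] k(1)[OF s] by auto
    show "((\<lambda>s'. Q s s' * (h s' - k s')) has_sum (- f s)) F"
    proof (cases "s = \<alpha>")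
      case True
      have "(x - max 0 (f \<alpha>)) - (x - max 0 (- f \<alpha>)) = - f \<alpha>" for x by auto
      then show ?thesis using has_sum_diff[OF h(4) k(4)] unfolding eq True
        by (simp only: right_diff_distrib)
    next
      case False
      then have "s \<in> E" using s by simp
      moreover have "- max 0 (f s) - - max 0 (- f s) = - f s" by auto
      ultimately show ?thesis using has_sum_diff[OF h(2) k(2), of s s]
        by (simp only: right_diff_distrib)
    qed
  qed
qed

end

section \<open>The augmented truncation\<close>

lemma finite_FF_upto: "finite (FF_upto S n)"
  by (auto simp: FF_upto_def)

lemma FF_upto_subset: "FF_upto S n \<subseteq> FF S"
  by (auto simp: FF_upto_def FF_def)

lemma FF_minus_upto: "FF S - FF_upto S n = (SIGMA m:{n<..}. {..S m})"
  by (auto simp: FF_upto_def FF_def)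

lemma sum_FF_upto: "(\<Sum>s\<in>FF_upto S n. g s) = (\<Sum>k\<le>n. \<Sum>i\<le>S k. g (k, i))"
  unfolding FF_upto_def by (subst sum.Sigma) auto

lemma level_sums_above:
  fixes g :: "state \<Rightarrow> real"
  assumes "(g has_sum x) (FF S)"
  shows "((\<lambda>m. \<Sum>j\<le>S m. g (m, j)) has_sum (x - sum g (FF_upto S n))) {n<..}"
proof -
  have "(g has_sum (x - sum g (FF_upto S n))) (SIGMA m:{n<..}. {..S m})"
    using has_sum_Diff[OF assms has_sum_finite[OF finite_FF_upto] FF_upto_subset]
    unfolding FF_minus_upto .
  then show ?thesis by (rule has_sum_SigmaD) (rule has_sum_finite, simp)
qed

text \<open>
  All levels above \<open>n\<close> have the same phases, so the sums over levels and phases may be interchanged.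
\<close>

lemma phase_sums_above:
  assumes Q: "conservative_q_matrix (FF S) Q" and S: "\<forall>k\<ge>1. S k = S 1" and "n \<ge> 1" "s \<in> FF S"
  shows "((\<lambda>m. \<Sum>j\<le>S m. Q s (m, j) * y j) has_sum
    (\<Sum>j\<le>S n. (\<Sum>\<^sub>\<infinity>m\<in>{n<..}. Q s (m, j)) * y j)) {n<..}"
proof -
  have S_eq: "S m = S n" if "n < m" for m
    using spec[OF S, of m] spec[OF S, of n] \<open>n \<ge> 1\<close> that by simp
  have "((\<lambda>m. Q s (m, j) * y j) has_sum ((\<Sum>\<^sub>\<infinity>m\<in>{n<..}. Q s (m, j)) * y j)) {n<..}"
    if "j \<in> {..S n}" for j
  proof (rule has_sum_cmult_left)
    have "Q s summable_on FF S"
      using Q \<open>s \<in> FF S\<close> by (auto simp: conservative_q_matrix_def summable_on_def)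
    then have "Q s summable_on (\<lambda>m. (m, j)) ` {n<..}"
      by (rule summable_on_subset_banach) (use that S_eq in \<open>auto simp: FF_def\<close>)
    then have "(\<lambda>m. Q s (m, j)) summable_on {n<..}"
      by (subst (asm) summable_on_reindex) (auto simp: inj_on_def o_def)
    then show "((\<lambda>m. Q s (m, j)) has_sum (\<Sum>\<^sub>\<infinity>m\<in>{n<..}. Q s (m, j))) {n<..}" by simp
  qed
  then have "((\<lambda>m. \<Sum>j\<le>S n. Q s (m, j) * y j) has_sum
    (\<Sum>j\<le>S n. (\<Sum>\<^sub>\<infinity>m\<in>{n<..}. Q s (m, j)) * y j)) {n<..}"
    by (rule has_sum_sum)
  then show ?thesis
    by (rule has_sum_cong[THEN iffD1, rotated]) (use S_eq in auto)
qed

lemma lc_trunc_row: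
  assumes "s \<in> FF_upto S n"
  shows "(\<Sum>s'\<in>FF_upto S n. lc_trunc Q n s s' * h s') =
    (\<Sum>s'\<in>FF_upto S n. Q s s' * h s') + (\<Sum>j\<le>S n. (\<Sum>\<^sub>\<infinity>m\<in>{n<..}. Q s (m, j)) * h (n, j))"
proof -
  obtain k i where s: "s = (k, i)" "k \<le> n" using assms by (auto simp: FF_upto_def)
  have "{m. n < m \<and> m \<noteq> k} = {n<..}" using s by auto
  then have "lc_trunc Q n s (l, j) * h (l, j) = Q s (l, j) * h (l, j) +
      (if l = n then (\<Sum>\<^sub>\<infinity>m\<in>{n<..}. Q s (m, j)) * h (l, j) else 0)" if "l \<le> n" for l j
    using that by (auto simp: lc_trunc_def s algebra_simps)
  then have "(\<Sum>s'\<in>FF_upto S n. lc_trunc Q n s s' * h s') = (\<Sum>l\<le>n. \<Sum>j\<le>S l. Q s (l, j) * h (l, j) +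
      (if l = n then (\<Sum>\<^sub>\<infinity>m\<in>{n<..}. Q s (m, j)) * h (l, j) else 0))"
    unfolding sum_FF_upto by (intro sum.cong refl) auto
  also have "\<dots> = (\<Sum>s'\<in>FF_upto S n. Q s s' * h s') +
      (\<Sum>l\<le>n. \<Sum>j\<le>S l. if l = n then (\<Sum>\<^sub>\<infinity>m\<in>{n<..}. Q s (m, j)) * h (l, j) else 0)"
    by (simp add: sum.distrib sum_FF_upto)
  also have "(\<Sum>l\<le>n. \<Sum>j\<le>S l. if l = n then (\<Sum>\<^sub>\<infinity>m\<in>{n<..}. Q s (m, j)) * h (l, j) else 0) =
      (\<Sum>l\<le>n. if l = n then (\<Sum>j\<le>S l. (\<Sum>\<^sub>\<infinity>m\<in>{n<..}. Q s (m, j)) * h (l, j)) else 0)"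
    by (intro sum.cong refl) auto
  also have "\<dots> = (\<Sum>j\<le>S n. (\<Sum>\<^sub>\<infinity>m\<in>{n<..}. Q s (m, j)) * h (n, j))"
    by (simp add: sum.delta)
  finally show ?thesis .
qed

text \<open>
  In the columns of levels above \<open>n\<close> the truncation has only diagonal blocks, so the part of \<open>x\<close> in level \<open>k\<close> is
  stationary for \<open>Q(k; k)\<close>. No mass may leak out of its support, which is therefore a finite set
  closed under \<open>Q\<close>; irreducibility makes it empty.
\<close>

lemma lc_trunc_stationary_above:
  assumes mc: "transition_matrix_function (FF S) P" and irr: "irreducible_chain (FF S) P"
    and gen: "infinitesimal_generator (FF S) P Q" and Q: "conservative_q_matrix (FF S) Q"
    and stat: "stationary_distribution (FF S) (lc_trunc Q n) x" and k: "n < k" "i \<le> S k"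
  shows "x (k, i) = 0"
proof (rule ccontr)
  assume nz: "x (k, i) \<noteq> 0"
  define L where "L = {k} \<times> {..S k}"
  define A where "A = {s \<in> L. 0 < x s}"
  have L: "finite L" "L \<subseteq> FF S" by (auto simp: L_def FF_def)
  have x0: "0 \<le> x s" if "s \<in> FF S" for s using stat that by (simp add: stationary_distribution_def)
  have A: "finite A" "A \<subseteq> FF S" "A \<subseteq> L" using L by (auto simp: A_def)
  have Q0: "0 \<le> Q s s'" if "s \<in> FF S" "s' \<in> FF S" "s \<noteq> s'" for s s'
    using Q that by (simp add: conservative_q_matrix_def)
  have col: "(\<Sum>s\<in>L. x s * Q s s') = 0" if "s' \<in> L" for s'
  proof -
    have "((\<lambda>s. x s * lc_trunc Q n s s') has_sum 0) (FF S)"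
      using stat that L unfolding stationary_distribution_def by blast
    moreover have e: "lc_trunc Q n s s' = (if fst s = k then Q s s' else 0)" for s
      using that k by (cases s) (auto simp: L_def lc_trunc_def)
    ultimately have "((\<lambda>s. x s * Q s s') has_sum 0) L"
      by (subst has_sum_cong_neutral[where T = "FF S" and g = "\<lambda>s. x s * lc_trunc Q n s s'"])
        (use e L(2) in \<open>auto simp: L_def FF_def\<close>)
    then show ?thesis using L(1) by (metis has_sum_finite has_sum_unique)
  qed
  have row: "(\<Sum>u\<in>L. Q s u) = 0" if "s \<in> A" for s
  proof -
    have "(\<Sum>s\<in>L. - (x s * (\<Sum>u\<in>L. Q s u))) = - (\<Sum>u\<in>L. \<Sum>s\<in>L. x s * Q s u)"
      by (subst sum.swap) (simp add: sum_distrib_left sum_negf)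
    also have "\<dots> = 0" using col by simp
    finally have "(\<Sum>s\<in>L. - (x s * (\<Sum>u\<in>L. Q s u))) = 0" .
    moreover have "0 \<le> - (x s * (\<Sum>u\<in>L. Q s u))" if "s \<in> L" for s
      using x0[of s] partial_row_nonpos[OF Q L(1,2) that] that L by (simp add: mult_nonneg_nonpos subsetD)
    ultimately have "- (x s * (\<Sum>u\<in>L. Q s u)) = 0"
      using L(1) A(3) that by (subst (asm) sum_nonneg_eq_0_iff) auto
    then show ?thesis using that by (auto simp: A_def)
  qed
  have closed: "Q s s' = 0" if s: "s \<in> A" and s': "s' \<in> FF S - A" for s s'
  proof (cases "s' \<in> L")
    case False
    then show ?thesis
      using full_row_closed[OF Q L(1,2) _ row[OF s], of s'] s s' A(3) by auto
  next
    case True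
    then have "x s' = 0" using s' x0[of s'] by (auto simp: A_def)
    have "0 \<le> x u * Q u s'" if "u \<in> L" for u
    proof (cases "u = s'")
      case False
      then show ?thesis using that True L by (intro mult_nonneg_nonneg x0 Q0) auto
    qed (simp add: \<open>x s' = 0\<close>)
    then have "x s * Q s s' = 0"
      using col[OF True] L(1) s A(3) by (subst (asm) sum_nonneg_eq_0_iff) auto
    then show ?thesis using s by (auto simp: A_def)
  qed
  have ki: "(k, i) \<in> A" using nz x0[of "(k, i)"] k by (auto simp: A_def L_def FF_def)
  have z: "(0, 0) \<in> FF S - A" using k by (auto simp: FF_def A_def L_def)
  obtain t where "t > 0" "0 < P t (k, i) (0, 0)"
    using irr ki z A(2) unfolding irreducible_chain_def by blast
  with finite_closed_set_absorbing[OF mc gen Q A(1,2) closed ki z]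
  show False by simp
qed

text \<open>
  The rate of jumps above level \<open>n\<close>, each weighted with \<open>y\<close> both at its target \<open>(m, j)\<close> and at the state
  \<open>(n, j)\<close> to which the truncation redirects it.
\<close>

definition overflow :: "(nat \<Rightarrow> nat) \<Rightarrow> matrix \<Rightarrow> nat \<Rightarrow> vector \<Rightarrow> vector" where
  "overflow S Q n y s = (\<Sum>\<^sub>\<infinity>m\<in>{n<..}. \<Sum>j\<le>S m. Q s (m, j) * (y (m, j) + y (n, j)))"

lemma overflow_summable:
  assumes Q: "conservative_q_matrix (FF S) Q" and S: "\<forall>k\<ge>1. S k = S 1" and "n \<ge> 1" "s \<in> FF S"
    and y: "(\<lambda>s'. Q s s' * y s') summable_on FF S"
  shows "(\<lambda>m. \<Sum>j\<le>S m. Q s (m, j) * (y (m, j) + y (n, j))) summable_on {n<..}"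
proof -
  have "(\<lambda>m. (\<Sum>j\<le>S m. Q s (m, j) * y (m, j)) + (\<Sum>j\<le>S m. Q s (m, j) * y (n, j))) summable_on {n<..}"
    using level_sums_above[OF has_sum_infsum[OF y], of n] phase_sums_above[OF assms(1-4), of "\<lambda>j. y (n, j)"]
    by (intro summable_on_add) (auto simp: summable_on_def)
  then show ?thesis by (simp add: distrib_left sum.distrib)
qed

text \<open>
  The two generators differ only in the redirected jumps, and \<open>x\<close> annihilates the truncated one,
  \<open>Q'\<close>. Hence \<open>- x f = x Q h = x (Q - Q') h\<close>, where the row of \<open>(Q - Q') h\<close> at \<open>s\<close> is
  \<open>\<Sum> Q(s; m, j) (h(m, j) - h(n, j))\<close>.
\<close>

lemma truncation_error:
  assumes Q: "conservative_q_matrix (FF S) Q" and S: "\<forall>k\<ge>1. S k = S 1" and "n \<ge> 1"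
    and stat: "stationary_distribution (FF S) (lc_trunc Q n) x"
    and above: "\<And>s. s \<in> FF S - FF_upto S n \<Longrightarrow> x s = 0"
    and h: "\<And>s. s \<in> FF S \<Longrightarrow> ((\<lambda>s'. Q s s' * h s') has_sum (- f s)) (FF S)"
    and bound: "\<And>s. s \<in> FF S \<Longrightarrow> \<bar>h s\<bar> \<le> C * y s" and "0 \<le> C"
    and y: "\<And>s. s \<in> FF S \<Longrightarrow> (\<lambda>s'. Q s s' * y s') summable_on FF S"
  shows "\<bar>\<Sum>s\<in>FF_upto S n. x s * f s\<bar> \<le>
    C * (\<Sum>s\<in>FF_upto S n. x s * overflow S Q n y s)"
proof -
  let ?F = "FF_upto S n"
  let ?G = "overflow S Q n y"
  have S_eq: "S m = S n" if "m > n" for m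
    using spec[OF S, of m] spec[OF S, of n] \<open>n \<ge> 1\<close> that by simp
  have row: "\<bar>- f s - (\<Sum>s'\<in>?F. lc_trunc Q n s s' * h s')\<bar> \<le> C * ?G s" if s: "s \<in> ?F" for s
  proof -
    have sF: "s \<in> FF S" using s FF_upto_subset by blast
    have "((\<lambda>m. (\<Sum>j\<le>S m. Q s (m, j) * h (m, j)) - (\<Sum>j\<le>S m. Q s (m, j) * h (n, j))) has_sum
        ((- f s - (\<Sum>s'\<in>?F. Q s s' * h s')) - (\<Sum>j\<le>S n. (\<Sum>\<^sub>\<infinity>m\<in>{n<..}. Q s (m, j)) * h (n, j)))) {n<..}"
      using has_sum_diff[OF level_sums_above[OF h[OF sF], of n] phase_sums_above[OF Q S \<open>n \<ge> 1\<close> sF]] .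
    then have 1: "((\<lambda>m. \<Sum>j\<le>S m. Q s (m, j) * (h (m, j) - h (n, j))) has_sum
        (- f s - (\<Sum>s'\<in>?F. lc_trunc Q n s s' * h s'))) {n<..}"
      unfolding lc_trunc_row[OF s] by (simp add: sum_subtractf right_diff_distrib diff_diff_eq)
    have 2: "((\<lambda>m. C * (\<Sum>j\<le>S m. Q s (m, j) * (y (m, j) + y (n, j)))) has_sum (C * ?G s)) {n<..}"
      unfolding overflow_def
      by (intro has_sum_cmult_right has_sum_infsum overflow_summable[OF Q S \<open>n \<ge> 1\<close> sF y[OF sF]])
    have "norm (- f s - (\<Sum>s'\<in>?F. lc_trunc Q n s s' * h s')) \<le> C * ?G s"
    proof (rule norm_infsum_le[OF 1 2])
      fix m assume m: "m \<in> {n<..}"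
      have "norm (Q s (m, j) * (h (m, j) - h (n, j))) \<le> C * (Q s (m, j) * (y (m, j) + y (n, j)))"
        if "j \<in> {..S m}" for j
      proof -
        have mj: "(m, j) \<in> FF S" "(n, j) \<in> FF S" "s \<noteq> (m, j)"
          using m that S_eq[of m] s by (auto simp: FF_def FF_upto_def)
        then have "0 \<le> Q s (m, j)" using Q sF by (auto simp: conservative_q_matrix_def)
        moreover have "\<bar>h (m, j) - h (n, j)\<bar> \<le> C * (y (m, j) + y (n, j))"
          using bound[OF mj(1)] bound[OF mj(2)] by (auto simp: distrib_left)
        ultimately have "Q s (m, j) * \<bar>h (m, j) - h (n, j)\<bar> \<le> Q s (m, j) * (C * (y (m, j) + y (n, j)))"
          by (intro mult_left_mono)
        then show ?thesis using \<open>0 \<le> Q s (m, j)\<close> by (simp add: abs_mult mult_ac)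
      qed
      then show "norm (\<Sum>j\<le>S m. Q s (m, j) * (h (m, j) - h (n, j))) \<le>
          C * (\<Sum>j\<le>S m. Q s (m, j) * (y (m, j) + y (n, j)))"
        unfolding sum_distrib_left by (rule sum_norm_le)
    qed
    then show ?thesis by simp
  qed
  have x0: "0 \<le> x s" if "s \<in> FF S" for s using stat that by (simp add: stationary_distribution_def)
  have col: "(\<Sum>s\<in>?F. x s * lc_trunc Q n s s') = 0" if "s' \<in> ?F" for s'
  proof -
    have "((\<lambda>s. x s * lc_trunc Q n s s') has_sum 0) (FF S)"
      using stat that FF_upto_subset unfolding stationary_distribution_def by blast
    then have "((\<lambda>s. x s * lc_trunc Q n s s') has_sum 0) ?F"
      by (subst has_sum_cong_neutral[where T = "FF S" and g = "\<lambda>s. x s * lc_trunc Q n s s'"])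
        (use above subsetD[OF FF_upto_subset[of S n]] in auto)
    then show ?thesis by (metis finite_FF_upto has_sum_finite has_sum_unique)
  qed
  have "(\<Sum>s\<in>?F. x s * (\<Sum>s'\<in>?F. lc_trunc Q n s s' * h s')) =
      (\<Sum>s'\<in>?F. \<Sum>s\<in>?F. x s * lc_trunc Q n s s' * h s')"
    by (subst sum.swap) (simp add: sum_distrib_left mult_ac)
  also have "\<dots> = 0" using col by (simp flip: sum_distrib_right)
  finally have "(\<Sum>s\<in>?F. x s * f s) = - (\<Sum>s\<in>?F. x s * (- f s - (\<Sum>s'\<in>?F. lc_trunc Q n s s' * h s')))"
    by (simp add: right_diff_distrib sum_subtractf sum_negf)
  then have "\<bar>\<Sum>s\<in>?F. x s * f s\<bar> \<le> (\<Sum>s\<in>?F. \<bar>x s * (- f s - (\<Sum>s'\<in>?F. lc_trunc Q n s s' * h s'))\<bar>)"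
    by (simp add: sum_abs)
  also have "\<dots> \<le> (\<Sum>s\<in>?F. x s * (C * ?G s))"
  proof (rule sum_mono)
    fix s assume s: "s \<in> ?F"
    then have "0 \<le> x s" using x0 FF_upto_subset by blast
    then show "\<bar>x s * (- f s - (\<Sum>s'\<in>?F. lc_trunc Q n s s' * h s'))\<bar> \<le> x s * (C * ?G s)"
      using mult_left_mono[OF row[OF s]] by (simp add: abs_mult)
  qed
  also have "\<dots> = C * (\<Sum>s\<in>?F. x s * ?G s)"
    by (simp add: sum_distrib_left mult.left_commute)
  finally show ?thesis .
qed

lemma overflow_nonneg:
  assumes Q: "conservative_q_matrix (FF S) Q" and S: "\<forall>k\<ge>1. S k = S 1" and "n \<ge> 1"
    and s: "s \<in> FF_upto S n" and y: "\<And>s. s \<in> FF S \<Longrightarrow> 0 \<le> y s"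
  shows "0 \<le> overflow S Q n y s"
  unfolding overflow_def
proof (rule infsum_nonneg, rule sum_nonneg)
  fix m j assume m: "m \<in> {n<..}" and j: "j \<in> {..S m}"
  have "S m = S n" using spec[OF S, of m] spec[OF S, of n] \<open>n \<ge> 1\<close> m by simp
  then have mj: "(m, j) \<in> FF S" "(n, j) \<in> FF S" "s \<noteq> (m, j)" "s \<in> FF S"
    using m j s by (auto simp: FF_def FF_upto_def)
  have "0 \<le> Q s (m, j)" using Q mj unfolding conservative_q_matrix_def by blast
  then show "0 \<le> Q s (m, j) * (y (m, j) + y (n, j))"
    using y[OF mj(1)] y[OF mj(2)] by simp
qed

lemma overflow_le_levelwise:
  assumes Q: "conservative_q_matrix (FF S) Q" and S: "\<forall>k\<ge>1. S k = S 1" and "n \<ge> 1"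
    and s: "s \<in> FF_upto S n" and summable: "(\<lambda>s'. Q s s' * y s') summable_on FF S"
    and mono: "levelwise_nondecreasing S y"
  shows "overflow S Q n y s \<le> 2 * (\<Sum>\<^sub>\<infinity>m\<in>{n<..}. \<Sum>j\<le>S m. Q s (m, j) * y (m, j))"
proof -
  have sF: "s \<in> FF S" using s FF_upto_subset by blast
  have S_eq: "S m = S n" if "n < m" for m
    using spec[OF S, of m] spec[OF S, of n] \<open>n \<ge> 1\<close> that by simp
  have y_mono: "y (n, j) \<le> y (m, j)" if "n \<le> m" "j \<le> S n" for m j
    using that
  proof (induction m rule: dec_induct)
    case (step m)
    have "S m = S n" using step.hyps S_eq[of m] by (cases "m = n") auto
    then have "y (m, j) \<le> y (m + 1, j)"
      using mono step \<open>n \<ge> 1\<close> unfolding levelwise_nondecreasing_def by auto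
    then show ?case using step by simp
  qed simp
  have up: "(\<lambda>m. \<Sum>j\<le>S m. Q s (m, j) * y (m, j)) summable_on {n<..}"
    using level_sums_above[OF has_sum_infsum[OF summable], of n] unfolding summable_on_def by blast
  have "overflow S Q n y s \<le> (\<Sum>\<^sub>\<infinity>m\<in>{n<..}. 2 * (\<Sum>j\<le>S m. Q s (m, j) * y (m, j)))"
    unfolding overflow_def
  proof (rule infsum_mono[OF overflow_summable[OF Q S \<open>n \<ge> 1\<close> sF summable] summable_on_cmult_right[OF up]])
    fix m assume m: "m \<in> {n<..}"
    show "(\<Sum>j\<le>S m. Q s (m, j) * (y (m, j) + y (n, j))) \<le> 2 * (\<Sum>j\<le>S m. Q s (m, j) * y (m, j))"
      unfolding sum_distrib_left
    proof (rule sum_mono)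
      fix j assume j: "j \<in> {..S m}"
      have "(m, j) \<in> FF S" "s \<noteq> (m, j)" using m j s by (auto simp: FF_def FF_upto_def)
      then have "0 \<le> Q s (m, j)" using Q sF unfolding conservative_q_matrix_def by blast
      moreover have "y (m, j) + y (n, j) \<le> 2 * y (m, j)"
        using y_mono[of m j] m j S_eq[of m] by auto
      ultimately have "Q s (m, j) * (y (m, j) + y (n, j)) \<le> Q s (m, j) * (2 * y (m, j))"
        by (intro mult_left_mono)
      then show "Q s (m, j) * (y (m, j) + y (n, j)) \<le> 2 * (Q s (m, j) * y (m, j))"
        by (simp only: mult.left_commute)
    qed
  qed
  also have "\<dots> = 2 * (\<Sum>\<^sub>\<infinity>m\<in>{n<..}. \<Sum>j\<le>S m. Q s (m, j) * y (m, j))"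
    by (rule infsum_cmult_right')
  finally show ?thesis .
qed

section \<open>An atom for the drift condition\<close>

lemma phi_bar_attained:
  assumes "\<And>s s'. s \<in> FF_upto S K \<Longrightarrow> s' \<in> FF_upto S K \<Longrightarrow> 0 < Phi_trunc S Q \<beta> N s s'" "K \<le> N"
  obtains \<alpha> where "\<alpha> \<in> FF_upto S N" "0 < phi_bar S Q \<beta> K N"
    "\<And>s. s \<in> FF_upto S K \<Longrightarrow> phi_bar S Q \<beta> K N \<le> Phi_trunc S Q \<beta> N s \<alpha>"
proof -
  define f where "f s' = Min ((\<lambda>s. Phi_trunc S Q \<beta> N s s') ` FF_upto S K)" for s'
  have z: "(0, 0) \<in> FF_upto S K" "(0, 0) \<in> FF_upto S N" by (auto simp: FF_upto_def)
  have fin: "finite (f ` FF_upto S N)" "f ` FF_upto S N \<noteq> {}"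
    using z by (auto intro: finite_FF_upto)
  have bar: "phi_bar S Q \<beta> K N = Max (f ` FF_upto S N)"
    unfolding phi_bar_def f_def[symmetric] by (rule cSup_eq_Max[OF fin])
  then obtain \<alpha> where \<alpha>: "\<alpha> \<in> FF_upto S N" "phi_bar S Q \<beta> K N = f \<alpha>"
    using Max_in[OF fin] by auto
  have "0 < f (0, 0)"
    unfolding f_def using z assms(1) finite_FF_upto by (subst Min_gr_iff) auto
  also have "f (0, 0) \<le> phi_bar S Q \<beta> K N"
    unfolding bar using fin z by (intro Max_ge) auto
  finally have "0 < phi_bar S Q \<beta> K N" .
  moreover have "phi_bar S Q \<beta> K N \<le> Phi_trunc S Q \<beta> N s \<alpha>" if "s \<in> FF_upto S K" for s
    unfolding \<alpha>(2) f_def using that finite_FF_upto by (intro Min_le) auto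
  ultimately show thesis using that \<alpha>(1) by blast
qed

text \<open>
  Let \<open>p\<close> be the resolvent column at \<open>\<alpha>\<close>, extended by \<open>0\<close>. The resolvent equation gives \<open>Q p = \<beta> p\<close> at the
  states of levels up to \<open>N\<close> other than \<open>\<alpha>\<close>, while \<open>Q p \<ge> 0\<close> above level \<open>N\<close>. Subtracting the right multiple of
  \<open>p\<close> from \<open>v\<close> therefore removes the term \<open>b\<close> on the levels up to \<open>K\<close>; the constant added to \<open>- p\<close>, which
  \<open>Q\<close> annihilates, keeps the result above \<open>v\<close>.
\<close>

lemma atom_drift:
  assumes Q: "conservative_q_matrix (FF S) Q" and "b > 0" "c > 0" "\<beta> > 0" "K \<le> N"
    and drift: "drift_condition (FF S) Q v c b (FF_upto S K)"
    and \<alpha>: "\<alpha> \<in> FF_upto S N" and \<phi>: "0 < \<phi>"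
    and minor: "\<And>s. s \<in> FF_upto S K \<Longrightarrow> \<phi> \<le> Phi_trunc S Q \<beta> N s \<alpha>"
  obtains w where
    "\<And>s. s \<in> FF S \<Longrightarrow> v s \<le> w s \<and> w s \<le> v s + b / (\<beta> * \<phi>)"
    "\<And>s. s \<in> FF S \<Longrightarrow> (\<lambda>s'. Q s s' * w s') summable_on FF S"
    "\<And>s. s \<in> FF S - {\<alpha>} \<Longrightarrow> (\<Sum>\<^sub>\<infinity>s'\<in>FF S. Q s s' * w s') \<le> - (c * v s)"
proof -
  let ?A = "FF_upto S N"
  define p where "p s = (if s \<in> ?A then Phi_trunc S Q \<beta> N s \<alpha> else 0)" for s
  \<comment> \<open>the multiple of \<open>p\<close> whose drift on the levels up to \<open>K\<close>, away from \<open>\<alpha>\<close>, is at least \<open>b\<close>\<close>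
  define \<kappa> where "\<kappa> = b / (\<beta> * \<phi>)"
  have \<kappa>: "\<kappa> > 0" "\<kappa> * (\<beta> * \<phi>) = b" using assms by (auto simp: \<kappa>_def)
  have res: "0 \<le> p s" "p s \<le> 1" "\<beta> * p s = \<beta> * of_bool (s = \<alpha>) + (\<Sum>u\<in>?A. Q s u * p u)" if "s \<in> ?A" for s
  proof -
    have nn: "0 \<le> Q s u" if "s \<in> ?A" "u \<in> ?A" "s \<noteq> u" for s u
      using Q that FF_upto_subset unfolding conservative_q_matrix_def by blast
    have rows: "(\<Sum>u\<in>?A. Q s u) \<le> 0" if "s \<in> ?A" for s
      by (rule partial_row_nonpos[OF Q finite_FF_upto FF_upto_subset that])
    note r = submatrix_resolvent[OF finite_FF_upto nn rows \<open>\<beta> > 0\<close> that \<alpha>, folded Phi_trunc_def]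
    show "0 \<le> p s" "p s \<le> 1" "\<beta> * p s = \<beta> * of_bool (s = \<alpha>) + (\<Sum>u\<in>?A. Q s u * p u)"
      using r that by (simp_all add: p_def)
  qed
  have p01: "0 \<le> p s" "p s \<le> 1" for s using res[of s] by (auto simp: p_def)
  define w where "w s = v s + \<kappa> * (1 - p s)" for s
  have wQ: "((\<lambda>s'. Q s s' * w s') has_sum
      ((\<Sum>\<^sub>\<infinity>s'\<in>FF S. Q s s' * v s') - \<kappa> * (\<Sum>u\<in>?A. Q s u * p u))) (FF S)" if s: "s \<in> FF S" for s
  proof -
    have pQ: "((\<lambda>s'. Q s s' * p s') has_sum (\<Sum>u\<in>?A. Q s u * p u)) (FF S)"
      using has_sum_finite[OF finite_FF_upto, of "\<lambda>s'. Q s s' * p s'" S N]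
      by (rule has_sum_cong_neutral[THEN iffD1, rotated 3])
        (use subsetD[OF FF_upto_subset[of S N]] in \<open>auto simp: p_def\<close>)
    have "((\<lambda>s'. Q s s' * 1) has_sum 0) (FF S)"
      using Q s by (simp add: conservative_q_matrix_def)
    moreover have "((\<lambda>s'. Q s s' * v s') has_sum (\<Sum>\<^sub>\<infinity>s'\<in>FF S. Q s s' * v s')) (FF S)"
      using drift s by (simp add: drift_condition_def)
    ultimately have "((\<lambda>s'. Q s s' * v s' + \<kappa> * (Q s s' * 1 - Q s s' * p s')) has_sum
        ((\<Sum>\<^sub>\<infinity>s'\<in>FF S. Q s s' * v s') + \<kappa> * (0 - (\<Sum>u\<in>?A. Q s u * p u)))) (FF S)"
      by (intro has_sum_add has_sum_cmult_right has_sum_diff pQ)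
    then show ?thesis by (simp add: w_def algebra_simps)
  qed
  show thesis
  proof (rule that[of w])
    fix s
    show "v s \<le> w s \<and> w s \<le> v s + b / (\<beta> * \<phi>)"
      using p01[of s] \<kappa>(1) unfolding w_def \<kappa>_def[symmetric] by (simp add: mult_left_le)
  next
    fix s assume "s \<in> FF S"
    then show "(\<lambda>s'. Q s s' * w s') summable_on FF S" using wQ unfolding summable_on_def by blast
  next
    fix s assume "s \<in> FF S - {\<alpha>}"
    then have s: "s \<in> FF S" "s \<noteq> \<alpha>" by auto
    have "\<beta> * \<phi> * indicator (FF_upto S K) s \<le> (\<Sum>u\<in>?A. Q s u * p u)"
    proof (cases "s \<in> ?A")
      case True
      have "\<phi> * indicator (FF_upto S K) s \<le> p s"
        using minor[of s] p01[of s] True by (auto simp: p_def indicator_def)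
      then have "\<beta> * (\<phi> * indicator (FF_upto S K) s) \<le> \<beta> * p s"
        using \<open>\<beta> > 0\<close> by (intro mult_left_mono) auto
      then show ?thesis using res(3)[OF True] s(2) by (simp add: mult.assoc)
    next
      case False
      have "0 \<le> (\<Sum>u\<in>?A. Q s u * p u)"
      proof (intro sum_nonneg mult_nonneg_nonneg p01)
        fix u assume "u \<in> ?A"
        then have "u \<in> FF S" "s \<noteq> u" using False FF_upto_subset by auto
        then show "0 \<le> Q s u" using Q s unfolding conservative_q_matrix_def by blast
      qed
      moreover have "s \<notin> FF_upto S K" using False \<open>K \<le> N\<close> by (auto simp: FF_upto_def)
      ultimately show ?thesis by simp
    qed
    then have "\<kappa> * (\<beta> * \<phi> * indicator (FF_upto S K) s) \<le> \<kappa> * (\<Sum>u\<in>?A. Q s u * p u)"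
      using \<kappa>(1) by (intro mult_left_mono) auto
    also have "\<kappa> * (\<beta> * \<phi> * indicator (FF_upto S K) s) = b * indicator (FF_upto S K) s"
      using \<kappa>(2) by (simp add: mult.assoc[symmetric])
    finally show "(\<Sum>\<^sub>\<infinity>s'\<in>FF S. Q s s' * w s') \<le> - (c * v s)"
      using drift s(1) infsumI[OF wQ[OF s(1)]] by (auto simp: drift_condition_def)
  qed
qed

section \<open>Error bounds\<close>

lemma E_tilde_eq:
  "E_tilde S Q v b c \<beta> K N x n =
     2 * (\<Sum>s\<in>FF_upto S n. x s * overflow S Q n (\<lambda>s. v s + b * (1 / c + 2 / (\<beta> * phi_bar S Q \<beta> K N))) s)"
proof -
  have eq: "x + y + 2 * b * t = (x + b * t) + (y + b * t)" for x y t :: real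
    by (simp add: algebra_simps)
  show ?thesis unfolding E_tilde_def sum_FF_upto overflow_def eq ..
qed

lemma shift_summable:
  assumes "conservative_q_matrix F Q" "s \<in> F" "(\<lambda>s'. Q s s' * v s') summable_on F"
  shows "(\<lambda>s'. Q s s' * (v s' + B)) summable_on F"
proof -
  have "(Q s has_sum 0) F" using assms by (simp add: conservative_q_matrix_def)
  from has_sum_add[OF has_sum_infsum[OF assms(3)] has_sum_cmult_left[OF this, of B]]
  show ?thesis by (auto simp: summable_on_def distrib_left)
qed

text \<open>
  The signed weight \<open>\<sigma> = sgn (\<pi> - x) g\<close> turns the weighted distance into the linear expression
  \<open>(\<pi> - x) \<sigma>\<close>, to which the Poisson equation for the centred function \<open>\<sigma> - \<pi> \<sigma>\<close> applies.
\<close>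

lemma weighted_error_bound:
  assumes S: "\<forall>k\<ge>1. S k = S 1" and n: "n \<ge> 1"
    and chain: "drift_chain (FF S) Q \<pi> \<alpha> w (\<lambda>s. c * v s)"
    and stat: "stationary_distribution (FF S) (lc_trunc Q n) x"
    and above: "\<And>s. s \<in> FF S - FF_upto S n \<Longrightarrow> x s = 0"
    and summable: "\<And>s. s \<in> FF S \<Longrightarrow> (\<lambda>s'. Q s s' * v s') summable_on FF S"
    and w: "\<And>s. s \<in> FF S \<Longrightarrow> w s \<le> v s + B"
    and g: "\<And>s. s \<in> FF S \<Longrightarrow> 0 \<le> g s \<and> g s \<le> c * v s"
  shows "(\<lambda>s. \<pi> s * g s) summable_on FF S"
    and "(\<lambda>s. \<bar>\<pi> s - x s\<bar> * g s) summable_on FF S"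
    and "(\<Sum>\<^sub>\<infinity>s\<in>FF S. \<bar>\<pi> s - x s\<bar> * g s) \<le> ((\<Sum>\<^sub>\<infinity>s\<in>FF S. \<pi> s * g s) + 1) *
      (\<Sum>s\<in>FF_upto S n. x s * overflow S Q n (\<lambda>s. v s + B) s)"
proof -
  interpret drift_chain "FF S" Q \<pi> \<alpha> w "\<lambda>s. c * v s" by (rule chain)
  show pg: "(\<lambda>s. \<pi> s * g s) summable_on FF S"
  proof (rule poisson_nonneg[of 1 g])
    show "0 \<le> g s \<and> g s \<le> 1 * (c * v s)" if "s \<in> FF S" for s using g[OF that] by simp
  qed simp
  define \<sigma> where "\<sigma> s = sgn (\<pi> s - x s) * g s" for s
  define G where "G = (\<Sum>\<^sub>\<infinity>s\<in>FF S. \<pi> s * g s)"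
  define \<mu> where "\<mu> = (\<Sum>\<^sub>\<infinity>s\<in>FF S. \<pi> s * \<sigma> s)"
  have \<sigma>: "\<bar>\<sigma> s\<bar> \<le> g s" if "s \<in> FF S" for s
    using g[OF that] by (auto simp: \<sigma>_def abs_mult sgn_if)
  have \<pi>\<sigma>: "\<bar>\<pi> s * \<sigma> s\<bar> \<le> \<pi> s * g s" if "s \<in> FF S" for s
    using mult_left_mono[OF \<sigma>[OF that] pi_nonneg[OF that]] pi_nonneg[OF that] by (simp add: abs_mult)
  have "(\<lambda>s. \<bar>\<pi> s * \<sigma> s\<bar>) summable_on FF S"
    by (rule summable_on_comparison_test[OF pg]) (use \<pi>\<sigma> in auto)
  then have ps: "(\<lambda>s. \<pi> s * \<sigma> s) summable_on FF S"
    unfolding summable_on_iff_abs_summable_on_real[of "\<lambda>s. \<pi> s * \<sigma> s"] by simp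
  have G: "((\<lambda>s. \<pi> s * g s) has_sum G) (FF S)" using pg by (simp add: G_def)
  have \<mu>: "((\<lambda>s. \<pi> s * \<sigma> s) has_sum \<mu>) (FF S)" using ps by (simp add: \<mu>_def)
  have "norm \<mu> \<le> G" by (rule norm_infsum_le[OF \<mu> G]) (use \<pi>\<sigma> in auto)
  then have \<mu>_le: "\<bar>\<mu>\<bar> \<le> G" by simp
  then have G0: "0 \<le> G" by linarith
  have pi1: "(\<pi> has_sum 1) (FF S)" using stationary by (simp add: stationary_distribution_def)
  have x1: "(x has_sum 1) (FF S)" using stat by (simp add: stationary_distribution_def)
  have fin_sum: "((\<lambda>s. x s * k s) has_sum (\<Sum>s\<in>FF_upto S n. x s * k s)) (FF S)" for k
    using has_sum_finite[OF finite_FF_upto, of "\<lambda>s. x s * k s" S n]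
    by (rule has_sum_cong_neutral[THEN iffD1, rotated 3]) (use above subsetD[OF FF_upto_subset[of S n]] in auto)
  have x_total: "(\<Sum>s\<in>FF_upto S n. x s) = 1"
    using has_sum_unique[OF x1] fin_sum[of "\<lambda>_. 1"] by simp
  have centred: "(\<Sum>\<^sub>\<infinity>s\<in>FF S. \<pi> s * (\<sigma> s - \<mu>)) = 0"
  proof (rule infsumI)
    show "((\<lambda>s. \<pi> s * (\<sigma> s - \<mu>)) has_sum 0) (FF S)"
      using has_sum_diff[OF \<mu> has_sum_cmult_left[OF pi1, of \<mu>]] by (simp add: right_diff_distrib)
  qed
  have bound: "\<bar>\<sigma> s - \<mu>\<bar> \<le> (G + 1) * (c * v s)" if "s \<in> FF S" for s
  proof -
    have "\<bar>\<sigma> s - \<mu>\<bar> \<le> c * v s + G * 1"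
      using \<sigma>[OF that] g[OF that] \<mu>_le by auto
    also have "\<dots> \<le> c * v s + G * (c * v s)"
      using r_ge[OF that] G0 by (intro add_left_mono mult_left_mono)
    finally show ?thesis by (simp add: algebra_simps)
  qed
  have "0 \<le> G + 1" using G0 by simp
  obtain h where h: "\<And>s. s \<in> FF S \<Longrightarrow> \<bar>h s\<bar> \<le> (G + 1) * w s"
    "\<And>s. s \<in> FF S \<Longrightarrow> ((\<lambda>s'. Q s s' * h s') has_sum (- (\<sigma> s - \<mu>))) (FF S)"
    by (rule poisson[OF \<open>0 \<le> G + 1\<close> bound centred], assumption, rule that; assumption)
  have h_le: "\<bar>h s\<bar> \<le> (G + 1) * (v s + B)" if "s \<in> FF S" for s
    using h(1)[OF that] mult_left_mono[OF w[OF that] \<open>0 \<le> G + 1\<close>] by linarith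
  have vB: "(\<lambda>s'. Q s s' * (v s' + B)) summable_on FF S" if "s \<in> FF S" for s
    by (rule shift_summable[OF conservative that summable[OF that]])
  have err: "\<bar>\<Sum>s\<in>FF_upto S n. x s * (\<sigma> s - \<mu>)\<bar> \<le> (G + 1) * (\<Sum>s\<in>FF_upto S n. x s * overflow S Q n (\<lambda>s. v s + B) s)"
    by (rule truncation_error[OF conservative S n stat above h(2) h_le \<open>0 \<le> G + 1\<close> vB])
  have "((\<lambda>s. \<pi> s * \<sigma> s - x s * \<sigma> s) has_sum (\<mu> - (\<Sum>s\<in>FF_upto S n. x s * \<sigma> s))) (FF S)"
    by (rule has_sum_diff[OF \<mu> fin_sum])
  moreover have "\<pi> s * \<sigma> s - x s * \<sigma> s = \<bar>\<pi> s - x s\<bar> * g s" for s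
    by (simp add: \<sigma>_def abs_sgn algebra_simps)
  moreover have "\<mu> - (\<Sum>s\<in>FF_upto S n. x s * \<sigma> s) = - (\<Sum>s\<in>FF_upto S n. x s * (\<sigma> s - \<mu>))"
    using x_total by (simp add: right_diff_distrib sum_subtractf flip: sum_distrib_right)
  ultimately have tot: "((\<lambda>s. \<bar>\<pi> s - x s\<bar> * g s) has_sum - (\<Sum>s\<in>FF_upto S n. x s * (\<sigma> s - \<mu>))) (FF S)"
    by simp
  then show "(\<lambda>s. \<bar>\<pi> s - x s\<bar> * g s) summable_on FF S" by (auto simp: summable_on_def)
  show "(\<Sum>\<^sub>\<infinity>s\<in>FF S. \<bar>\<pi> s - x s\<bar> * g s) \<le> ((\<Sum>\<^sub>\<infinity>s\<in>FF S. \<pi> s * g s) + 1) *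
      (\<Sum>s\<in>FF_upto S n. x s * overflow S Q n (\<lambda>s. v s + B) s)"
    unfolding infsumI[OF tot] G_def[symmetric] using err by linarith
qed

theorem corollary2p1:
  fixes S :: "nat \<Rightarrow> nat"
    and M :: "'w measure"
    and X J :: "real \<Rightarrow> 'w \<Rightarrow> nat"
    and P :: "real \<Rightarrow> matrix"
    and Q :: matrix
    and \<pi> :: vector
    and \<pi>n :: "nat \<Rightarrow> vector"
    and v :: vector
    and b c \<beta> :: real
    and K N :: nat
  assumes "\<forall>k\<ge>1. S k = S 1"
    and "markov_chain (FF S) P M (\<lambda>t w. (X t w, J t w))"
    and "regular_jump M (\<lambda>t w. (X t w, J t w))"
    and "ergodic (FF S) P M (\<lambda>t w. (X t w, J t w))"
    and "infinitesimal_generator (FF S) P Q"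
    and "conservative_q_matrix (FF S) Q"
    and "stationary_distribution (FF S) Q \<pi>"
    and "\<forall>n\<ge>1. \<exists>!C. closed_communicating_class (FF S) (lc_trunc Q n) C \<and> C \<subseteq> FF_upto S n"
    and "\<forall>n\<ge>1. stationary_distribution (FF S) (lc_trunc Q n) (\<pi>n n)"
    and "b > 0" and "c > 0"
    and "\<forall>s\<in>FF S. v s \<ge> 1 / c"
    and "drift_condition (FF S) Q v c b (FF_upto S K)"
    and "\<beta> > 0" and "N \<ge> K"
    and "\<forall>s\<in>FF_upto S K. \<forall>s'\<in>FF_upto S K.
           0 < Phi_trunc S Q \<beta> N s s' \<and> Phi_trunc S Q \<beta> N s s' \<le> Phi P \<beta> s s'"
  shows "(\<forall>n\<ge>1.
            (\<forall>g. (\<forall>s\<in>FF S. 0 \<le> g s \<and> g s \<le> c * v s) \<longrightarrow>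
               (\<lambda>s. \<pi> s * g s) summable_on FF S \<and>
               (\<lambda>s. \<bar>\<pi> s - \<pi>n n s\<bar> * g s) summable_on FF S \<and>
               row_col (FF S) (\<lambda>s. \<bar>\<pi> s - \<pi>n n s\<bar>) g
                 \<le> (row_col (FF S) \<pi> g + 1) / 2 * E_tilde S Q v b c \<beta> K N (\<pi>n n) n) \<and>
            (SUP g\<in>{g. \<forall>s\<in>FF S. 1 \<le> g s \<and> g s \<le> c * v s}.
               ereal (row_col (FF S) (\<lambda>s. \<bar>\<pi> s - \<pi>n n s\<bar>) g / row_col (FF S) \<pi> g))
              \<le> ereal (E_tilde S Q v b c \<beta> K N (\<pi>n n) n)) \<and>
         (levelwise_nondecreasing S v \<longrightarrow>
            (\<forall>n\<ge>1. E_tilde S Q v b c \<beta> K N (\<pi>n n) n \<le> E_tilde_plus S Q v b c \<beta> K N (\<pi>n n) n))"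
proof -
  define B where "B = b * (1 / c + 2 / (\<beta> * phi_bar S Q \<beta> K N))"
  note S = assms(1) and mc = assms(2) and Q = assms(6)
  obtain \<alpha> where \<alpha>: "\<alpha> \<in> FF_upto S N" "0 < phi_bar S Q \<beta> K N"
    "\<And>s. s \<in> FF_upto S K \<Longrightarrow> phi_bar S Q \<beta> K N \<le> Phi_trunc S Q \<beta> N s \<alpha>"
    by (rule phi_bar_attained[of S K Q \<beta> N]) (use assms(15,16) in auto)
  obtain w where w: "\<And>s. s \<in> FF S \<Longrightarrow> v s \<le> w s \<and> w s \<le> v s + b / (\<beta> * phi_bar S Q \<beta> K N)"
    "\<And>s. s \<in> FF S \<Longrightarrow> (\<lambda>s'. Q s s' * w s') summable_on FF S"
    "\<And>s. s \<in> FF S - {\<alpha>} \<Longrightarrow> (\<Sum>\<^sub>\<infinity>s'\<in>FF S. Q s s' * w s') \<le> - (c * v s)"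
    using atom_drift[OF Q assms(10,11,14,15,13) \<alpha>] by blast
  have v: "0 < v s" "1 \<le> c * v s" if "s \<in> FF S" for s
  proof -
    have *: "1 / c \<le> v s" using assms(12) that by blast
    then show "1 \<le> c * v s" using \<open>c > 0\<close> by (simp add: field_simps)
    show "0 < v s" using * \<open>c > 0\<close> by (smt (verit) divide_pos_pos)
  qed
  have chain: "drift_chain (FF S) Q \<pi> \<alpha> w (\<lambda>s. c * v s)"
  proof
    fix s and lam \<epsilon> :: real assume s: "s \<in> FF S" and pos: "0 < lam" "0 < \<epsilon>"
    have "positive_recurrent M (\<lambda>t w. (X t w, J t w)) s"
      using assms(4) s by (auto simp: ergodic_def)
    then obtain u where "0 \<le> u" "\<P>(w in M. (X u w, J u w) = s) > 0"
      by (auto simp: positive_recurrent_def)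
    then show "\<exists>n. (act (jump_kernel (FF S) Q (\<lambda>s. lam - Q s s)) ^^ n) (\<lambda>_. 1) s \<le> ennreal \<epsilon>"
      using no_explosion[OF mc assms(3,5) Q s] pos by blast
  next
    show "0 < w s" if "s \<in> FF S" for s using w(1)[OF that] v(1)[OF that] by linarith
  qed (use Q assms(7) \<alpha>(1) FF_upto_subset v w in auto)
  have drift: "(\<lambda>s'. Q s s' * v s') summable_on FF S" if "s \<in> FF S" for s
    using assms(13) that by (auto simp: drift_condition_def)
  have B: "0 \<le> B" "b / (\<beta> * phi_bar S Q \<beta> K N) \<le> B"
    using assms(10,11,14) \<alpha>(2) by (auto simp: B_def field_simps)
  have w_le: "w s \<le> v s + B" if "s \<in> FF S" for s using w(1)[OF that] B(2) by linarith
  have stat: "stationary_distribution (FF S) (lc_trunc Q n) (\<pi>n n)" if "n \<ge> 1" for n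
    using assms(9) that by blast
  have x0: "0 \<le> \<pi>n n s" if "n \<ge> 1" "s \<in> FF S" for n s
    using stat[OF that(1)] that(2) by (simp add: stationary_distribution_def)
  have above: "\<pi>n n s = 0" if n: "n \<ge> 1" and s: "s \<in> FF S - FF_upto S n" for n s
  proof -
    obtain k i where ki: "s = (k, i)" "n < k" "i \<le> S k" using s unfolding FF_minus_upto by auto
    have "transition_matrix_function (FF S) P" "irreducible_chain (FF S) P"
      using mc assms(4) by (auto simp: markov_chain_def ergodic_def)
    then show ?thesis unfolding ki(1)
      by (rule lc_trunc_stationary_above[OF _ _ assms(5) Q stat[OF n] ki(2,3)])
  qed
  have main: "(\<lambda>s. \<pi> s * g s) summable_on FF S \<and>
      (\<lambda>s. \<bar>\<pi> s - \<pi>n n s\<bar> * g s) summable_on FF S \<and>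
      row_col (FF S) (\<lambda>s. \<bar>\<pi> s - \<pi>n n s\<bar>) g
        \<le> (row_col (FF S) \<pi> g + 1) / 2 * E_tilde S Q v b c \<beta> K N (\<pi>n n) n"
    if n: "n \<ge> 1" and g: "\<forall>s\<in>FF S. 0 \<le> g s \<and> g s \<le> c * v s" for n g
  proof -
    have g': "0 \<le> g s \<and> g s \<le> c * v s" if "s \<in> FF S" for s using g that by blast
    note bnd = weighted_error_bound[OF S n chain stat[OF n] above[OF n] drift w_le g']
    show ?thesis
      using bnd unfolding row_col_def E_tilde_eq B_def[symmetric] by (simp add: mult.commute)
  qed
  have E0: "0 \<le> E_tilde S Q v b c \<beta> K N (\<pi>n n) n" if n: "n \<ge> 1" for n
  proof -
    have "0 \<le> \<pi>n n s * overflow S Q n (\<lambda>s. v s + B) s" if s: "s \<in> FF_upto S n" for s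
    proof (rule mult_nonneg_nonneg)
      show "0 \<le> \<pi>n n s" using x0[OF n] s FF_upto_subset by blast
      show "0 \<le> overflow S Q n (\<lambda>s. v s + B) s"
        by (rule overflow_nonneg[OF Q S n s]) (use v(1) B(1) in \<open>simp add: add_nonneg_nonneg less_imp_le\<close>)
    qed
    then show ?thesis unfolding E_tilde_eq B_def[symmetric] by (simp add: sum_nonneg)
  qed
  have ratio: "row_col (FF S) (\<lambda>s. \<bar>\<pi> s - \<pi>n n s\<bar>) g / row_col (FF S) \<pi> g
      \<le> E_tilde S Q v b c \<beta> K N (\<pi>n n) n"
    if n: "n \<ge> 1" and g: "\<forall>s\<in>FF S. 1 \<le> g s \<and> g s \<le> c * v s" for n g
  proof -
    have "\<forall>s\<in>FF S. 0 \<le> g s \<and> g s \<le> c * v s" using g by force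
    note m = main[OF n this]
    have pi: "(\<pi> has_sum 1) (FF S)" "\<forall>s\<in>FF S. 0 \<le> \<pi> s"
      using assms(7) by (auto simp: stationary_distribution_def)
    have one: "1 \<le> row_col (FF S) \<pi> g"
      unfolding row_col_def
    proof (rule has_sum_mono[OF pi(1) has_sum_infsum])
      show "(\<lambda>s. \<pi> s * g s) summable_on FF S" using m by blast
      show "\<pi> s \<le> \<pi> s * g s" if "s \<in> FF S" for s
        using mult_left_mono[of 1 "g s" "\<pi> s"] g pi(2) that by simp
    qed
    have "row_col (FF S) (\<lambda>s. \<bar>\<pi> s - \<pi>n n s\<bar>) g
        \<le> (row_col (FF S) \<pi> g + 1) / 2 * E_tilde S Q v b c \<beta> K N (\<pi>n n) n"
      using m by blast
    also have "\<dots> \<le> row_col (FF S) \<pi> g * E_tilde S Q v b c \<beta> K N (\<pi>n n) n"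
      using one E0[OF n] by (intro mult_right_mono) auto
    finally show ?thesis using one by (simp add: divide_le_eq mult.commute)
  qed
  have plus: "E_tilde S Q v b c \<beta> K N (\<pi>n n) n \<le> E_tilde_plus S Q v b c \<beta> K N (\<pi>n n) n"
    if mono: "levelwise_nondecreasing S v" and n: "n \<ge> 1" for n
  proof -
    let ?T = "\<lambda>s. \<Sum>\<^sub>\<infinity>m\<in>{n<..}. \<Sum>j\<le>S m. Q s (m, j) * (v (m, j) + B)"
    have "\<pi>n n s * overflow S Q n (\<lambda>s. v s + B) s \<le> 2 * (\<pi>n n s * ?T s)" if s: "s \<in> FF_upto S n" for s
    proof -
      have sF: "s \<in> FF S" using s FF_upto_subset by blast
      have "overflow S Q n (\<lambda>s. v s + B) s \<le> 2 * ?T s"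
        using overflow_le_levelwise[OF Q S n s shift_summable[OF Q sF drift[OF sF]], of B] mono
        by (simp add: levelwise_nondecreasing_def)
      from mult_left_mono[OF this x0[OF n sF]] show ?thesis by (simp only: mult.left_commute)
    qed
    then have "(\<Sum>s\<in>FF_upto S n. \<pi>n n s * overflow S Q n (\<lambda>s. v s + B) s) \<le> 2 * (\<Sum>s\<in>FF_upto S n. \<pi>n n s * ?T s)"
      unfolding sum_distrib_left by (rule sum_mono)
    then show ?thesis
      unfolding E_tilde_eq E_tilde_plus_def B_def[symmetric] sum_FF_upto[symmetric, of "\<lambda>s. \<pi>n n s * ?T s"] by simp
  qed
  show ?thesis
    using main ratio plus by (auto intro!: SUP_least)
qed

end
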